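(* Let $L>0$, $\sigma:\mathbb{Z}'\to[0,1]$ with $\sum_{l\in\mathbb{Z}',\,l<0}\sigma(l)<\infty$, and $s\in\mathbb{Z}'$ with $Q_\sigma(L,s)>0$. Let $Y=Y(z;L,s)$ be the solution of the discrete Riemann--Hilbert problem described in the context and $\alpha(L,s),\beta(L,s)$ the coefficients in its expansion at infinity. Then \[ \frac{Q_\sigma(L,s-1)}{Q_\sigma(L,s)}-1=\beta(L,s),\qquad \frac{\partial}{\partial L}\log Q_\sigma(L,s)=-\frac{2\alpha(L,s)}L. \]
   Context: $\mathbb{Z}'=\mathbb{Z}+\tfrac12$, $\mathbb{Z}'_+=\mathbb{Z}'\cap(0,\infty)$; $\mathrm{J}_k$ is the Bessel function of the first kind. $Q_\sigma(L,s)=\det(1-P_s\mathcal K_\sigma P_s)$ (Fredholm determinant), where $\mathcal K_\sigma$ is the operator on $\ell^2(\mathbb{Z}')$, $(\mathcal K_\sigma\psi)(a)=\sum_b K_\sigma(a,b)\psi(b)$, with kernel $K_\sigma(a,b)=\sum_{l\in\mathbb{Z}'}\sigma(l)\mathrm{J}_{a+l}(2L)\mathrm{J}_{b+l}(2L)$, and $P_s$ is the orthogonal projection onto $\ell^2(\{s+1,s+2,\dots\})$. Let $K^{\mathsf{Be}}(a,a)=\sum_{l\in\mathbb{Z}'_+}\mathrm{J}_{a+l}(2L)^2$, $M_s(a,a)=\sigma(a-s-\tfrac12)K^{\mathsf{Be}}(a,a)$ (which is $<1$), $\mathbf f(a)=\sqrt{\sigma(a-s-\tfrac12)}\,(\mathrm{J}_{a-\frac12}(2L),\,L\mathrm{J}_{a+\frac12}(2L))^\top$,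 $\mathbf g(a)=\sqrt{\sigma(a-s-\tfrac12)}\,(L\mathrm{J}_{a+\frac12}(2L),\,-\mathrm{J}_{a-\frac12}(2L))^\top$, $W_Y(a)=\mathbf f(a)\mathbf g(a)^\top/(1-M_s(a,a))$. Discrete RH problem: $Y(z)$ is a $2\times2$ matrix-valued meromorphic function with simple poles only at $\mathbb{Z}'$; for each $a\in\mathbb{Z}'$, $Y(z)\bigl(I-\frac{W_Y(a)}{z-a}\bigr)$ has a removable singularity at $z=a$; $\sup_{|z|=n}|Y(z)-I|\to0$ as $n\to+\infty$ through integers. When $Q_\sigma(L,s)>0$ this problem has a unique solution $Y(z;L,s)$, $\det Y\equiv1$, and $Y(z)=I+\begin{pmatrix}\alpha&\beta\\\gamma&-\alpha\end{pmatrix}z^{-1}+O(z^{-2})$ as $|z|\to\infty$ along circles $|z|=n$, $n$ integer; this defines $\alpha=\alpha(L,s)$, $\beta=\beta(L,s)$, $\gamma=\gamma(L,s)$. *)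

theory Defs
  imports "HOL-Analysis.Analysis" "HOL-Combinatorics.Permutations"
begin

definition Zp :: "real set" where
  "Zp = {x. \<exists>k::int. x = of_int k + 1/2}"

definition besselJ_int :: "int \<Rightarrow> real \<Rightarrow> real" where
  "besselJ_int n x =
     (if n \<ge> 0 then (\<Sum>m. (-1)^m / (fact m * fact (m + nat n)) * (x/2)^(2*m + nat n))
      else (-1)^(nat (-n)) *
        (\<Sum>m. (-1)^m / (fact m * fact (m + nat (-n))) * (x/2)^(2*m + nat (-n))))"

text \<open>J with a real order; only ever applied to integer orders.\<close>
definition J :: "real \<Rightarrow> real \<Rightarrow> real" where
  "J \<nu> x = besselJ_int \<lfloor>\<nu>\<rfloor> x"

definition Ksig :: "(real \<Rightarrow> real) \<Rightarrow> real \<Rightarrow> real \<Rightarrow> real \<Rightarrow> real" where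
  "Ksig \<sigma> L a b = (\<Sum>\<^sub>\<infinity>l\<in>Zp. \<sigma> l * J (a + l) (2*L) * J (b + l) (2*L))"

text \<open>Fredholm determinant det(1 - P_A K P_A) of a kernel K on the countable set A,
  given by its Fredholm series.\<close>
definition fredholm_det_1m :: "('a \<Rightarrow> 'a \<Rightarrow> real) \<Rightarrow> 'a set \<Rightarrow> real" where
  "fredholm_det_1m K A =
     (\<Sum>n. (-1)^n / fact n *
        (\<Sum>\<^sub>\<infinity>x \<in> PiE {..<n} (\<lambda>_. A).
           (\<Sum>p | p permutes {..<n}. of_int (sign p) * (\<Prod>i<n. K (x i) (x (p i))))))"

definition Q :: "(real \<Rightarrow> real) \<Rightarrow> real \<Rightarrow> real \<Rightarrow> real" where
  "Q \<sigma> L s = fredholm_det_1m (Ksig \<sigma> L) {a \<in> Zp. a \<ge> s + 1}"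

definition KBe :: "real \<Rightarrow> real \<Rightarrow> real" where
  "KBe L a = (\<Sum>\<^sub>\<infinity>l\<in>{l\<in>Zp. l > 0}. (J (a + l) (2*L))^2)"

definition Ms :: "(real \<Rightarrow> real) \<Rightarrow> real \<Rightarrow> real \<Rightarrow> real \<Rightarrow> real" where
  "Ms \<sigma> L s a = \<sigma> (a - s - 1/2) * KBe L a"

definition fvec :: "(real \<Rightarrow> real) \<Rightarrow> real \<Rightarrow> real \<Rightarrow> real \<Rightarrow> real^2" where
  "fvec \<sigma> L s a = vector [sqrt (\<sigma> (a - s - 1/2)) * J (a - 1/2) (2*L),
                          sqrt (\<sigma> (a - s - 1/2)) * (L * J (a + 1/2) (2*L))]"

definition gvec :: "(real \<Rightarrow> real) \<Rightarrow> real \<Rightarrow> real \<Rightarrow> real \<Rightarrow> real^2" where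
  "gvec \<sigma> L s a = vector [sqrt (\<sigma> (a - s - 1/2)) * (L * J (a + 1/2) (2*L)),
                          sqrt (\<sigma> (a - s - 1/2)) * (- J (a - 1/2) (2*L))]"

definition WY :: "(real \<Rightarrow> real) \<Rightarrow> real \<Rightarrow> real \<Rightarrow> real \<Rightarrow> complex^2^2" where
  "WY \<sigma> L s a = (\<chi> i j. complex_of_real (fvec \<sigma> L s a $ i * gvec \<sigma> L s a $ j / (1 - Ms \<sigma> L s a)))"

text \<open>The discrete Riemann--Hilbert problem for Y (entries meromorphic with at most simple
  poles, located only at Z'; residue condition; normalisation at infinity along circles |z| = n).\<close>
definition dRHP :: "(real \<Rightarrow> real) \<Rightarrow> real \<Rightarrow> real \<Rightarrow> (complex \<Rightarrow> complex^2^2) \<Rightarrow> bool" where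
  "dRHP \<sigma> L s Y \<longleftrightarrow>
     (\<forall>i j. (\<lambda>z. Y z $ i $ j) holomorphic_on (- (complex_of_real ` Zp))) \<and>
     (\<forall>a\<in>Zp. \<forall>i j. \<exists>r>0. \<exists>h. h holomorphic_on ball (complex_of_real a) r \<and>
        (\<forall>z\<in>ball (complex_of_real a) r - {complex_of_real a}.
            h z = (z - complex_of_real a) * Y z $ i $ j)) \<and>
     (\<forall>a\<in>Zp. \<forall>i j. \<exists>r>0. \<exists>h. h holomorphic_on ball (complex_of_real a) r \<and>
        (\<forall>z\<in>ball (complex_of_real a) r - {complex_of_real a}.
            h z = (Y z ** (mat 1 - (\<chi> p q. WY \<sigma> L s a $ p $ q / (z - complex_of_real a)))) $ i $ j)) \<and>
     (\<forall>\<epsilon>>0. \<exists>N::nat. \<forall>n\<ge>N. \<forall>z. cmod z = real n \<longrightarrow> norm (Y z - mat 1) \<le> \<epsilon>)"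

text \<open>Y(z) = I + [[alpha, beta],[gamma, -alpha]] / z + O(z^-2) along circles |z| = n.
  Rows/columns are indexed by 1 and 2 (= 0) of the numeral type 2.\<close>
definition has_expansion :: "(complex \<Rightarrow> complex^2^2) \<Rightarrow> complex \<Rightarrow> complex \<Rightarrow> complex \<Rightarrow> bool" where
  "has_expansion Y \<alpha> \<beta> \<gamma> \<longleftrightarrow>
     (\<exists>C. \<exists>N::nat. \<forall>n\<ge>N. \<forall>z. cmod z = real n \<longrightarrow>
        norm (Y z - mat 1 - (\<chi> i j. (if i = 1 then (if j = 1 then \<alpha> else \<beta>)
                                              else (if j = 1 then \<gamma> else - \<alpha>)) / z))
          \<le> C / (real n)^2)"

end

theory Submission
  imports Defs "HOL-Complex_Analysis.Complex_Analysis" "Jordan_Normal_Form.Char_Poly"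
begin

text \<open>
  Put $f_c(l) = \sqrt{\sigma(l)}\, J_{c+l}(2L)$. The kernel $K_\sigma$ is the Gram kernel of the $f_c$, so
  $Q_\sigma(L,s) = \det(1 - M)$ with $M = \sum_{c > s} f_c f_c^T$. In this dual form both identities come
  from perturbations of small rank. Lowering $s$ by one adds the rank-one term $f_s f_s^T$, and the
  Bessel differential-difference equations telescope $\partial_L M$ to $f_s f_{s+1}^T + f_{s+1} f_s^T$. Hence, with
  $G = (1 - M)^{-1} f_s$, the ratio $Q(s-1)/Q(s) - 1$ is $-\langle G, f_s\rangle$ and $\partial_L \log Q$ is
  $-2 \langle G, f_{s+1}\rangle$.
  Conversely the residues of the first row of $Y$ yield an $\ell^2$ solution $G$ of $(1 - M) G = f_s$:
  integrating over the circles $|z| = n$ turns the residue conditions into this linear equation, because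
  the off-diagonal part of $M$ is integrable (Christoffel--Darboux), and into
  $\beta = -\langle G, f_s\rangle$, $\alpha = L \langle G, f_{s+1}\rangle$.

  Everything is done for finite truncations of $1 - M$, whose determinants converge to $Q$. They are
  contractions, so Hadamard's inequality controls the determinant, its adjugate form and the
  Fredholm series uniformly in the size.
\<close>

section \<open>Determinants: Hadamard, Sylvester, rank-one updates\<close>

text \<open>The inverse of 1 - M is never formed. Let \<open>C\<close> be a truncation of 1 - M and
  suppose C G = y + r with a small residual r. Then x^T adj(C) y equals det(C) times the pairing of
  x with G, up to x^T adj(C) r, and for symmetric contractions this error is at most 7 |x| |r|
  whatever the size of the matrix. So a solution G is all that is required. Positivity of Q enters
  only at the very end: to divide by Q, and to conclude that the imaginary parts, which solve the
  homogeneous equation, pair to zero.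

  The delicate point is the derivative in L. The Riemann--Hilbert problem is posed at a single
  parameter L, so G is available there only. The derivatives of the truncated determinants at nearby
  t are therefore compared with the expression built from this fixed G, with an error linear in |t -
  L| whose constant does not depend on the truncation, plus terms that vanish as the truncation
  grows. The mean value inequality then survives the passage to the limit, and no differentiation of
  the Fredholm series takes place.\<close>

lemma sum_delta_lt: "i < n \<Longrightarrow> (\<Sum>k<n. (if k = i then f k else 0)) = (f i :: real)" for i n :: nat
  by (simp add: sum.delta)

text \<open>The new matrix is \<open>H * A\<close> for the reflection H = 1 - t w w^T. Condition
  \<open>tw\<close> makes \<open>H\<close> an involution, so its determinant is 1 or -1.\<close>

lemma det_sq_householder:
  fixes w :: "nat \<Rightarrow> real" and t :: real
  assumes A: "A \<in> carrier_mat n n" and tw: "t * (\<Sum>k<n. (w k)\<^sup>2) = 2"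
  shows "(Determinant.det (Matrix.mat n n (\<lambda>(i,j). A $$ (i,j) - t * w i * (\<Sum>k<n. w k * A $$ (k,j)))))\<^sup>2
     = (Determinant.det A)\<^sup>2"
proof -
  define H where "H = Matrix.mat n n (\<lambda>(i,j). (if i = j then 1 else 0) - t * w i * w j)"
  have H: "H \<in> carrier_mat n n" by (simp add: H_def)
  have HH: "H * H = 1\<^sub>m n"
  proof (rule eq_matI)
    fix i j assume ij: "i < dim_row (1\<^sub>m n)" "j < dim_col (1\<^sub>m n)"
    then have i: "i < n" and j: "j < n" by auto
    have "(H * H) $$ (i,j) = (\<Sum>k<n. ((if i = k then 1 else 0) - t * w i * w k) * ((if k = j then 1 else 0) - t * w k * w j))"
      using i j by (simp add: H_def scalar_prod_def lessThan_atLeast0)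
    also have "\<dots> = (\<Sum>k<n. (if k = i then (if k = j then 1 else 0) - t * w k * w j else 0)
         - (if k = j then t * w i * w k else 0) + t * w i * w j * (t * (w k)\<^sup>2))"
      by (intro sum.cong) (auto simp: algebra_simps power2_eq_square)
    also have "\<dots> = (if i = j then 1 else 0) - t * w i * w j - t * w i * w j + t * w i * w j * (t * (\<Sum>k<n. (w k)\<^sup>2))"
      using i j by (simp add: sum.distrib sum_subtractf sum_delta_lt sum_distrib_left)
    also have "\<dots> = (if i = j then 1 else 0)" by (simp add: tw)
    finally show "(H * H) $$ (i,j) = 1\<^sub>m n $$ (i,j)" using i j by simp
  qed (auto simp: H_def)
  have "Determinant.det H * Determinant.det H = 1"
    using det_mult[OF H H] HH by simp
  moreover have "Matrix.mat n n (\<lambda>(i,j). A $$ (i,j) - t * w i * (\<Sum>k<n. w k * A $$ (k,j))) = H * A"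
  proof (rule eq_matI)
    fix i j assume "i < dim_row (H * A)" "j < dim_col (H * A)"
    then have i: "i < n" and j: "j < n" using A H by auto
    have "(H * A) $$ (i,j) = (\<Sum>k<n. ((if i = k then 1 else 0) - t * w i * w k) * A $$ (k,j))"
      using i j A by (simp add: H_def scalar_prod_def lessThan_atLeast0)
    also have "\<dots> = (\<Sum>k<n. (if k = i then A $$ (k,j) else 0) - t * w i * (w k * A $$ (k,j)))"
      by (intro sum.cong) (auto simp: algebra_simps)
    also have "\<dots> = A $$ (i,j) - t * w i * (\<Sum>k<n. w k * A $$ (k,j))"
      using i by (simp add: sum_subtractf sum_delta_lt sum_distrib_left)
    finally show "Matrix.mat n n (\<lambda>(i,j). A $$ (i,j) - t * w i * (\<Sum>k<n. w k * A $$ (k,j))) $$ (i,j) = (H * A) $$ (i,j)"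
      using i j by simp
  qed (use A H in auto)
  ultimately show ?thesis
    using det_mult[OF H A] by (simp add: power2_eq_square algebra_simps)
qed

text \<open>A Householder reflection moves the first column onto the first axis without changing
  the square of the determinant or any column norm.\<close>
lemma hadamard_inequality:
  fixes A :: "real mat"
  assumes "A \<in> carrier_mat n n"
  shows "(Determinant.det A)\<^sup>2 \<le> (\<Prod>j<n. \<Sum>i<n. (A $$ (i,j))\<^sup>2)"
  using assms
proof (induction n arbitrary: A)
  case 0
  then show ?case by simp
next
  case (Suc n)
  note A = Suc.prems
  define c where "c i = A $$ (i,0)" for i
  define q where "q = (\<Sum>i<Suc n. (c i)\<^sup>2)"
  have q0: "q \<ge> 0" by (simp add: q_def sum_nonneg)
  show ?case
  proof (cases "q = 0")
    case True
    then have "\<forall>i<Suc n. c i = 0"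
      unfolding q_def by (subst (asm) sum_nonneg_eq_0_iff) auto
    then have "Determinant.det A = 0"
      by (subst laplace_expansion_column[OF A, of 0]) (auto simp: c_def)
    then show ?thesis by (simp add: prod_nonneg sum_nonneg)
  next
    case False
    define r where "r = sqrt q"
    have r: "r > 0" "r\<^sup>2 = q" using False q0 by (auto simp: r_def)
    \<comment> \<open>Taking \<open>e\<close> as the sign of \<open>c 0\<close> excludes
      cancellation in \<open>w 0\<close>. Half the squared norm of \<open>w\<close> is then
      \<open>p\<close>, which is positive.\<close>
    define e :: real where "e = (if c 0 \<ge> 0 then 1 else -1)"
    have e: "e * c 0 = \<bar>c 0\<bar>" "e * e = 1" by (auto simp: e_def)
    define w where "w i = c i + (if i = 0 then e * r else 0)" for i :: nat
    define p where "p = r * (r + \<bar>c 0\<bar>)"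
    have p: "p > 0" using r by (simp add: p_def add_pos_nonneg)
    define t where "t = 1 / p"
    have "(\<Sum>k<Suc n. (w k)\<^sup>2) = (\<Sum>k<Suc n. (c k)\<^sup>2 + (if k = 0 then 2 * e * r * c k + e * e * r\<^sup>2 else 0))"
      by (intro sum.cong) (auto simp: w_def power2_eq_square algebra_simps)
    also have "\<dots> = 2 * p"
      using e(1) by (simp add: sum.distrib sum_delta_lt q_def[symmetric] e(2) r(2) p_def del: sum.lessThan_Suc)
        (simp add: r(2)[symmetric] power2_eq_square algebra_simps)
    finally have w2: "(\<Sum>k<Suc n. (w k)\<^sup>2) = 2 * p" .
    have tw: "t * (\<Sum>k<Suc n. (w k)\<^sup>2) = 2" using p by (simp add: w2 t_def del: sum.lessThan_Suc)
    have wc: "(\<Sum>k<Suc n. w k * c k) = p"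
    proof -
      have "(\<Sum>k<Suc n. w k * c k) = (\<Sum>k<Suc n. (c k)\<^sup>2 + (if k = 0 then e * r * c k else 0))"
        by (intro sum.cong) (auto simp: w_def power2_eq_square algebra_simps)
      also have "\<dots> = p"
        using e(1) by (simp add: sum.distrib sum_delta_lt q_def[symmetric] e(2) r(2) p_def del: sum.lessThan_Suc)
          (simp add: r(2)[symmetric] power2_eq_square algebra_simps)
      finally show ?thesis .
    qed
    define B where "B = Matrix.mat (Suc n) (Suc n) (\<lambda>(i,j). A $$ (i,j) - t * w i * (\<Sum>k<Suc n. w k * A $$ (k,j)))"
    have B: "B \<in> carrier_mat (Suc n) (Suc n)" by (simp add: B_def)
    have detB: "(Determinant.det B)\<^sup>2 = (Determinant.det A)\<^sup>2"
      unfolding B_def by (rule det_sq_householder[OF A tw])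
    have colB: "(\<Sum>i<Suc n. (B $$ (i,j))\<^sup>2) = (\<Sum>i<Suc n. (A $$ (i,j))\<^sup>2)" if "j < Suc n" for j
    proof -
      define v where "v i = A $$ (i,j)" for i
      define u where "u = (\<Sum>k<Suc n. w k * v k)"
      have "(\<Sum>i<Suc n. (B $$ (i,j))\<^sup>2) = (\<Sum>i<Suc n. (v i - t * w i * u)\<^sup>2)"
        using that by (intro sum.cong) (auto simp: B_def v_def u_def)
      also have "\<dots> = (\<Sum>i<Suc n. (v i)\<^sup>2 - 2 * t * u * (w i * v i) + t * u\<^sup>2 * t * (w i)\<^sup>2)"
        by (intro sum.cong) (auto simp: power2_eq_square algebra_simps)
      also have "\<dots> = (\<Sum>i<Suc n. (v i)\<^sup>2) - 2 * t * u * u + t * u\<^sup>2 * (t * (\<Sum>i<Suc n. (w i)\<^sup>2))"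
        unfolding sum.distrib sum_subtractf u_def sum_distrib_left by (simp add: mult.assoc)
      also have "\<dots> = (\<Sum>i<Suc n. (v i)\<^sup>2)" unfolding tw by (simp add: power2_eq_square)
      finally show ?thesis by (simp only: v_def)
    qed
    have B0: "B $$ (i,0) = (if i = 0 then - e * r else 0)" if "i < Suc n" for i
    proof -
      have "B $$ (i,0) = c i - t * w i * (\<Sum>k<Suc n. w k * c k)"
        using that by (simp add: B_def c_def)
      also have "\<dots> = c i - w i" unfolding wc using p by (simp add: t_def)
      finally show ?thesis by (simp add: w_def)
    qed
    have md: "mat_delete B 0 0 \<in> carrier_mat n n" using mat_delete_carrier[OF B] by simp
    have "Determinant.det B = (\<Sum>i<Suc n. B $$ (i,0) * cofactor B i 0)"
      by (rule laplace_expansion_column[OF B]) simp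
    also have "\<dots> = (\<Sum>i<Suc n. if i = 0 then - e * r * cofactor B i 0 else 0)"
      by (intro sum.cong) (auto simp: B0)
    also have "\<dots> = - e * r * Determinant.det (mat_delete B 0 0)"
      by (subst sum_delta_lt) (auto simp: cofactor_def)
    finally have "(Determinant.det B)\<^sup>2 = q * (Determinant.det (mat_delete B 0 0))\<^sup>2"
      by (simp add: power_mult_distrib r(2)) (simp add: power2_eq_square e(2))
    also have "\<dots> \<le> q * (\<Prod>j<n. \<Sum>i<n. (mat_delete B 0 0 $$ (i,j))\<^sup>2)"
      by (intro mult_left_mono Suc.IH md q0)
    \<comment> \<open>The induction hypothesis sees the remaining columns without their first entry;
      restoring it only enlarges the product, and \<open>q\<close> is the factor of the first
      column.\<close>
    also have "\<dots> \<le> q * (\<Prod>j<n. \<Sum>i<Suc n. (B $$ (i, Suc j))\<^sup>2)"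
    proof (intro mult_left_mono q0 prod_mono conjI sum_nonneg zero_le_power2)
      fix j assume j: "j \<in> {..<n}"
      have "(\<Sum>i<n. (mat_delete B 0 0 $$ (i,j))\<^sup>2) = (\<Sum>i<n. (B $$ (Suc i, Suc j))\<^sup>2)"
        using j B by (intro sum.cong) (auto simp: mat_delete_def)
      also have "\<dots> \<le> (\<Sum>i<Suc n. (B $$ (i, Suc j))\<^sup>2)"
        by (subst sum.lessThan_Suc_shift) simp
      finally show "(\<Sum>i<n. (mat_delete B 0 0 $$ (i,j))\<^sup>2) \<le> (\<Sum>i<Suc n. (B $$ (i, Suc j))\<^sup>2)" .
    qed
    also have "\<dots> = (\<Prod>j<Suc n. \<Sum>i<Suc n. (A $$ (i,j))\<^sup>2)"
      unfolding prod.lessThan_Suc_shift o_def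
      using colB by (simp add: q_def c_def del: sum.lessThan_Suc)
    finally show ?thesis using detB by simp
  qed
qed

text \<open>Multiplying the block matrix \<open>X\<close> by the unipotent \<open>T\<close> from the
  left or from the right clears its lower left block, leaving one or the other of the two matrices
  as the only nontrivial diagonal block. Both determinants thus equal that of
  \<open>X\<close>.\<close>

lemma det_sylvester:
  fixes B B' :: "real mat"
  assumes B: "B \<in> carrier_mat m n" and B': "B' \<in> carrier_mat n m"
  shows "Determinant.det (1\<^sub>m m - B * B') = Determinant.det (1\<^sub>m n - B' * B)"
proof -
  define X where "X = four_block_mat (1\<^sub>m m) B B' (1\<^sub>m n)"
  define T where "T = four_block_mat (1\<^sub>m m) (0\<^sub>m m n) (- B') (1\<^sub>m n)"
  have X: "X \<in> carrier_mat (m+n) (m+n)" and T: "T \<in> carrier_mat (m+n) (m+n)"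
    using B B' by (auto simp: X_def T_def)
  have dT: "Determinant.det T = 1"
    unfolding T_def using B' by (subst det_four_block_mat_upper_right_zero[of _ m _ n]) auto
  have TX: "T * X = four_block_mat (1\<^sub>m m) B (0\<^sub>m n m) (1\<^sub>m n - B' * B)"
    unfolding T_def X_def using B B'
    by (subst mult_four_block_mat[of _ m m _ n _ n]) (auto intro!: cong_four_block_mat simp: minus_add_uminus_mat[symmetric])
  have XT: "X * T = four_block_mat (1\<^sub>m m - B * B') B (0\<^sub>m n m) (1\<^sub>m n)"
    unfolding T_def X_def using B B'
    by (subst mult_four_block_mat[of _ m m _ n _ n]) (auto intro!: cong_four_block_mat simp: minus_add_uminus_mat[symmetric])
  have "Determinant.det (T * X) = Determinant.det (1\<^sub>m n - B' * B)"
    unfolding TX using B B' by (subst det_four_block_mat_lower_left_zero[of _ m _ n]) auto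
  moreover have "Determinant.det (X * T) = Determinant.det (1\<^sub>m m - B * B')"
    unfolding XT using B B' by (subst det_four_block_mat_lower_left_zero[of _ m _ n]) auto
  ultimately show ?thesis
    using det_mult[OF T X] det_mult[OF X T] dT by simp
qed

section \<open>Determinants of entry functions and adjugate forms\<close>

definition fdet :: "nat \<Rightarrow> (nat \<Rightarrow> nat \<Rightarrow> real) \<Rightarrow> real" where
  "fdet n C = Determinant.det (Matrix.mat n n (\<lambda>(i,j). C i j))"

definition fcof :: "nat \<Rightarrow> (nat \<Rightarrow> nat \<Rightarrow> real) \<Rightarrow> nat \<Rightarrow> nat \<Rightarrow> real" where
  "fcof n C i j = cofactor (Matrix.mat n n (\<lambda>(i,j). C i j)) i j"

text \<open>This is x^T adj(C) y, since the adjugate has the cofactor at (i,j) in position (j,i). It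
  plays the role of det(C) x^T C^(-1) y and makes sense for singular \<open>C\<close> as
  well.\<close>

definition adjform :: "nat \<Rightarrow> (nat \<Rightarrow> nat \<Rightarrow> real) \<Rightarrow> (nat \<Rightarrow> real) \<Rightarrow> (nat \<Rightarrow> real) \<Rightarrow> real" where
  "adjform n C x y = (\<Sum>i<n. \<Sum>j<n. x j * y i * fcof n C i j)"

lemma fdet_expand: "fdet n C = (\<Sum>p | p permutes {0..<n}. signof p * (\<Prod>i = 0..<n. C i (p i)))"
  unfolding fdet_def
  by (subst det_def'[of _ n])
    (auto intro!: sum.cong prod.cong simp: permutes_in_image dest: permutes_in_image)

lemma fdet_cong: "(\<And>i j. i < n \<Longrightarrow> j < n \<Longrightarrow> C i j = C' i j) \<Longrightarrow> fdet n C = fdet n C'"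
  unfolding fdet_def by (intro arg_cong[where f = Determinant.det] eq_matI) auto

lemma fdet_laplace_row:
  assumes "i < n"
  shows "fdet n (\<lambda>k j. if k = i then r j else C k j) = (\<Sum>j<n. r j * fcof n C i j)"
proof -
  let ?A = "Matrix.mat n n (\<lambda>(k,j). if k = i then r j else C k j)"
  have "fdet n (\<lambda>k j. if k = i then r j else C k j) = (\<Sum>j<n. ?A $$ (i,j) * cofactor ?A i j)"
    unfolding fdet_def using assms by (intro laplace_expansion_row) auto
  also have "\<dots> = (\<Sum>j<n. r j * fcof n C i j)"
  proof (intro sum.cong refl arg_cong2[where f = "(*)"])
    fix j assume j: "j \<in> {..<n}"
    then show "?A $$ (i,j) = r j" using assms by simp
    have "mat_delete ?A i j = mat_delete (Matrix.mat n n (\<lambda>(i,j). C i j)) i j"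
      by (intro eq_matI) (auto simp: mat_delete_def)
    then show "cofactor ?A i j = fcof n C i j" by (simp add: cofactor_def fcof_def)
  qed
  finally show ?thesis .
qed

text \<open>Jacobi's formula. Differentiating the \<open>i\<close>-th factor of each Leibniz product
  amounts to replacing row \<open>i\<close> by its derivative; Laplace expansion along that row
  produces the cofactors.\<close>

lemma fdet_has_derivative:
  assumes "\<And>i j. i < n \<Longrightarrow> j < n \<Longrightarrow> ((\<lambda>t. C t i j) has_real_derivative C' i j) (at t)"
  shows "((\<lambda>t. fdet n (C t)) has_real_derivative (\<Sum>i<n. \<Sum>j<n. C' i j * fcof n (C t) i j)) (at t)"
proof -
  have "((\<lambda>t. fdet n (C t)) has_real_derivative
     (\<Sum>p | p permutes {0..<n}. signof p * (\<Sum>i\<in>{0..<n}. C' i (p i) * (\<Prod>k\<in>{0..<n} - {i}. C t k (p k))))) (at t)"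
    unfolding fdet_expand
    by (intro DERIV_sum DERIV_cmult has_field_derivative_prod assms) (auto dest: permutes_in_image)
  moreover have "(\<Sum>p | p permutes {0..<n}. signof p * (\<Sum>i\<in>{0..<n}. C' i (p i) * (\<Prod>k\<in>{0..<n} - {i}. C t k (p k))))
     = (\<Sum>i<n. \<Sum>j<n. C' i j * fcof n (C t) i j)"
  proof -
    have "(\<Sum>p | p permutes {0..<n}. signof p * (\<Sum>i\<in>{0..<n}. C' i (p i) * (\<Prod>k\<in>{0..<n} - {i}. C t k (p k))))
       = (\<Sum>i\<in>{0..<n}. \<Sum>p | p permutes {0..<n}. signof p * (C' i (p i) * (\<Prod>k\<in>{0..<n} - {i}. C t k (p k))))"
      unfolding sum_distrib_left by (rule sum.swap)
    also have "\<dots> = (\<Sum>i\<in>{0..<n}. fdet n (\<lambda>k j. if k = i then C' i j else C t k j))"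
      unfolding fdet_expand
    proof (intro sum.cong refl arg_cong2[where f = "(*)"])
      fix i p assume i: "i \<in> {0..<n}"
      show "C' i (p i) * (\<Prod>k\<in>{0..<n} - {i}. C t k (p k)) = (\<Prod>k = 0..<n. if k = i then C' i (p k) else C t k (p k))"
        using i by (subst (2) prod.remove[of _ i]) (auto intro!: prod.cong)
    qed
    also have "\<dots> = (\<Sum>i<n. \<Sum>j<n. C' i j * fcof n (C t) i j)"
      unfolding lessThan_atLeast0 by (intro sum.cong refl) (subst fdet_laplace_row, auto simp: lessThan_atLeast0)
    finally show ?thesis .
  qed
  ultimately show ?thesis by simp
qed

lemma mat_minus_id:
  "Matrix.mat n n (\<lambda>(i,j). (if i = j then 1 else 0) - K i j) = 1\<^sub>m n - Matrix.mat n n (\<lambda>(i,j). K i j)"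
  by (intro eq_matI) auto

lemma fdet_sylvester:
  "fdet m (\<lambda>i j. (if i = j then 1 else 0) - (\<Sum>k<n. B i k * B' k j))
   = fdet n (\<lambda>i j. (if i = j then 1 else 0) - (\<Sum>k<m. B' i k * B k j))"
proof -
  let ?B = "Matrix.mat m n (\<lambda>(i,j). B i j)" and ?B' = "Matrix.mat n m (\<lambda>(i,j). B' i j)"
  have 1: "?B * ?B' = Matrix.mat m m (\<lambda>(i,j). \<Sum>k<n. B i k * B' k j)"
    by (intro eq_matI) (auto simp: scalar_prod_def lessThan_atLeast0)
  have 2: "?B' * ?B = Matrix.mat n n (\<lambda>(i,j). \<Sum>k<m. B' i k * B k j)"
    by (intro eq_matI) (auto simp: scalar_prod_def lessThan_atLeast0)
  show ?thesis unfolding fdet_def mat_minus_id 1[symmetric] 2[symmetric]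
    by (intro det_sylvester) auto
qed

lemma fdet_mult:
  "fdet n (\<lambda>i j. \<Sum>k<n. C i k * C' k j) = fdet n C * fdet n C'"
proof -
  let ?B = "Matrix.mat n n (\<lambda>(i,j). C i j)" and ?B' = "Matrix.mat n n (\<lambda>(i,j). C' i j)"
  have "?B * ?B' = Matrix.mat n n (\<lambda>(i,j). \<Sum>k<n. C i k * C' k j)"
    by (intro eq_matI) (auto simp: scalar_prod_def lessThan_atLeast0)
  then show ?thesis unfolding fdet_def by (metis det_mult mat_carrier)
qed

lemma fdet_id_minus_rank_one:
  "fdet n (\<lambda>i j. (if i = j then 1 else 0) - g i * x j) = 1 - (\<Sum>i<n. x i * g i)"
proof -
  have "fdet n (\<lambda>i j. (if i = j then 1 else 0) - g i * x j)
      = fdet n (\<lambda>i j. (if i = j then 1 else 0) - (\<Sum>k<(1::nat). g i * x j))" by simp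
  also have "\<dots> = fdet 1 (\<lambda>i j. (if i = j then 1 else 0) - (\<Sum>k<n. x k * g k))"
    by (rule fdet_sylvester)
  also have "\<dots> = 1 - (\<Sum>i<n. x i * g i)"
    unfolding fdet_def by (subst det_single) auto
  finally show ?thesis .
qed

text \<open>No invertibility is involved because the column C g lies in the range of
  \<open>C\<close>: the matrix factors as C (1 - g x^T).\<close>

lemma fdet_minus_range_rank_one:
  "fdet n (\<lambda>i j. C i j - (\<Sum>k<n. C i k * g k) * x j) = fdet n C * (1 - (\<Sum>i<n. x i * g i))"
proof -
  have "fdet n (\<lambda>i j. C i j - (\<Sum>k<n. C i k * g k) * x j)
      = fdet n (\<lambda>i j. \<Sum>k<n. C i k * ((if k = j then 1 else 0) - g k * x j))"
  proof (rule fdet_cong)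
    fix i j assume "i < n" "j < n"
    have "(\<Sum>k<n. C i k * ((if k = j then 1 else 0) - g k * x j))
       = (\<Sum>k<n. (if k = j then C i k else 0) - C i k * g k * x j)"
      by (intro sum.cong) (auto simp: algebra_simps)
    then show "C i j - (\<Sum>k<n. C i k * g k) * x j = (\<Sum>k<n. C i k * ((if k = j then 1 else 0) - g k * x j))"
      using \<open>j < n\<close> by (simp add: sum_subtractf sum_delta_lt sum_distrib_right)
  qed
  then show ?thesis unfolding fdet_mult fdet_id_minus_rank_one .
qed

lemma adj_identities:
  assumes "i < n" "j < n"
  shows "(\<Sum>k<n. C i k * fcof n C j k) = (if i = j then fdet n C else 0)"
    and "(\<Sum>k<n. fcof n C k i * C k j) = (if i = j then fdet n C else 0)"
proof -
  let ?A = "Matrix.mat n n (\<lambda>(i,j). C i j)"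
  have A: "?A \<in> carrier_mat n n" by simp
  have "(\<Sum>k<n. C i k * fcof n C j k) = (?A * adj_mat ?A) $$ (i,j)"
    using assms by (simp add: adj_mat_def scalar_prod_def fcof_def lessThan_atLeast0)
  then show "(\<Sum>k<n. C i k * fcof n C j k) = (if i = j then fdet n C else 0)"
    unfolding adj_mat(2)[OF A] using assms by (simp add: fdet_def)
  have "(\<Sum>k<n. fcof n C k i * C k j) = (adj_mat ?A * ?A) $$ (i,j)"
    using assms by (simp add: adj_mat_def scalar_prod_def fcof_def lessThan_atLeast0)
  then show "(\<Sum>k<n. fcof n C k i * C k j) = (if i = j then fdet n C else 0)"
    unfolding adj_mat(3)[OF A] using assms by (simp add: fdet_def)
qed

text \<open>From adj(C) C = det(C) 1. This is how a solution \<open>g\<close> of C g = y replaces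
  the inverse of \<open>C\<close>.\<close>

lemma adjform_range:
  "adjform n C x (\<lambda>i. \<Sum>k<n. C i k * g k) = fdet n C * (\<Sum>i<n. x i * g i)"
proof -
  have "adjform n C x (\<lambda>i. \<Sum>k<n. C i k * g k) = (\<Sum>i<n. \<Sum>j<n. \<Sum>k<n. x j * g k * (fcof n C i j * C i k))"
    unfolding adjform_def by (simp add: sum_distrib_left sum_distrib_right mult_ac)
  also have "\<dots> = (\<Sum>j<n. \<Sum>k<n. \<Sum>i<n. x j * g k * (fcof n C i j * C i k))"
  proof -
    have "(\<Sum>j<n. \<Sum>k<n. \<Sum>i<n. x j * g k * (fcof n C i j * C i k))
        = (\<Sum>j<n. \<Sum>i<n. \<Sum>k<n. x j * g k * (fcof n C i j * C i k))"
      by (intro sum.cong refl sum.swap)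
    then show ?thesis by (subst sum.swap) simp
  qed
  also have "\<dots> = (\<Sum>j<n. \<Sum>k<n. x j * g k * (if j = k then fdet n C else 0))"
    by (intro sum.cong refl) (simp add: sum_distrib_left[symmetric] adj_identities(2))
  also have "\<dots> = (\<Sum>j<n. \<Sum>k<n. if k = j then x j * g k * fdet n C else 0)"
    by (intro sum.cong) auto
  also have "\<dots> = fdet n C * (\<Sum>i<n. x i * g i)"
    by (simp add: sum_delta_lt sum_distrib_left mult_ac)
  finally show ?thesis .
qed

lemma fdet_minus_rank_one_nonsing:
  assumes "fdet n C \<noteq> 0"
  shows "fdet n (\<lambda>i j. C i j - y i * x j) = fdet n C - adjform n C x y"
proof -
  \<comment> \<open>Cramer's rule: this \<open>g\<close> solves C g = y, so that the previous two
    lemmas apply.\<close>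
  define g where "g k = (\<Sum>j<n. fcof n C j k * y j) / fdet n C" for k
  have Cg: "(\<Sum>k<n. C i k * g k) = y i" if "i < n" for i
  proof -
    have "(\<Sum>k<n. C i k * g k) = (\<Sum>k<n. \<Sum>j<n. C i k * fcof n C j k * y j) / fdet n C"
      by (simp add: g_def sum_divide_distrib sum_distrib_left mult_ac)
    also have "(\<Sum>k<n. \<Sum>j<n. C i k * fcof n C j k * y j) = (\<Sum>j<n. (\<Sum>k<n. C i k * fcof n C j k) * y j)"
      by (subst sum.swap) (simp add: sum_distrib_right)
    also have "\<dots> = (\<Sum>j<n. if j = i then fdet n C * y j else 0)"
      using that by (intro sum.cong) (auto simp: adj_identities)
    finally show ?thesis using that assms by (simp add: sum_delta_lt)
  qed
  have "fdet n (\<lambda>i j. C i j - y i * x j) = fdet n (\<lambda>i j. C i j - (\<Sum>k<n. C i k * g k) * x j)"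
    by (intro fdet_cong) (simp add: Cg)
  also have "\<dots> = fdet n C - adjform n C x (\<lambda>i. \<Sum>k<n. C i k * g k)"
    unfolding fdet_minus_range_rank_one adjform_range by (simp add: algebra_simps)
  also have "adjform n C x (\<lambda>i. \<Sum>k<n. C i k * g k) = adjform n C x y"
    unfolding adjform_def by (intro sum.cong refl) (simp add: Cg)
  finally show ?thesis .
qed

text \<open>A shift by \<open>t\<close> is singular only if \<open>- t\<close> is a root of the
  characteristic polynomial, which is monic and hence nonzero.\<close>

lemma finite_singular_shifts: "finite {t. fdet n (\<lambda>i j. C i j + (if i = j then t else 0)) = 0}"
proof -
  let ?A = "Matrix.mat n n (\<lambda>(i,j). C i j)"
  have A: "?A \<in> carrier_mat n n" by simp
  have "char_poly ?A \<noteq> 0" using degree_monic_char_poly[OF A] by auto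
  then have "finite {x. poly (char_poly ?A) x = 0}" by (rule poly_roots_finite)
  then have "finite (uminus ` {x. poly (char_poly ?A) x = 0})" by (rule finite_imageI)
  moreover have "{t. fdet n (\<lambda>i j. C i j + (if i = j then t else 0)) = 0} \<subseteq> uminus ` {x. poly (char_poly ?A) x = 0}"
  proof
    fix t assume "t \<in> {t. fdet n (\<lambda>i j. C i j + (if i = j then t else 0)) = 0}"
    moreover have "Matrix.mat n n (\<lambda>(i,j). C i j + (if i = j then t else 0)) = char_matrix ?A (- t)"
      by (intro eq_matI) (auto simp: char_matrix_def)
    ultimately have "poly (char_poly ?A) (- t) = 0"
      using eigenvalue_root_char_poly[OF A] eigenvalue_det[OF A] by (simp add: fdet_def)
    then show "t \<in> uminus ` {x. poly (char_poly ?A) x = 0}"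
      by (intro image_eqI[of _ _ "- t"]) auto
  qed
  ultimately show ?thesis by (rule finite_subset[rotated])
qed

lemma fdet_tendsto:
  assumes "\<And>i j. i < n \<Longrightarrow> j < n \<Longrightarrow> ((\<lambda>t. C t i j) \<longlongrightarrow> C0 i j) F"
  shows "((\<lambda>t. fdet n (C t)) \<longlongrightarrow> fdet n C0) F"
  unfolding fdet_expand
  by (intro tendsto_sum tendsto_mult tendsto_const tendsto_prod assms) (auto dest: permutes_in_image)

text \<open>Cofactors are themselves determinants with one row replaced by a unit vector, so they
  inherit continuity from \<open>fdet_tendsto\<close>.\<close>

lemma fcof_eq_fdet:
  assumes "i < n" "j < n"
  shows "fcof n C i j = fdet n (\<lambda>k l. if k = i then (if l = j then 1 else 0) else C k l)"
proof -
  have "(\<Sum>l<n. (if l = j then 1 else 0) * fcof n C i l) = (\<Sum>l<n. if l = j then fcof n C i l else 0)"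
    by (intro sum.cong) auto
  then show ?thesis using assms by (subst fdet_laplace_row) (auto simp: sum_delta_lt)
qed

lemma fcof_tendsto:
  assumes "\<And>i j. i < n \<Longrightarrow> j < n \<Longrightarrow> ((\<lambda>t. C t i j) \<longlongrightarrow> C0 i j) F" "i < n" "j < n"
  shows "((\<lambda>t. fcof n (C t) i j) \<longlongrightarrow> fcof n C0 i j) F"
  unfolding fcof_eq_fdet[OF assms(2,3)]
  by (intro fdet_tendsto) (auto intro!: assms)

text \<open>The nonsingular case extends by continuity, since $C + tI$ is singular for finitely many $t$ only.\<close>
lemma fdet_minus_rank_one:
  "fdet n (\<lambda>i j. C i j - y i * x j) = fdet n C - adjform n C x y"
proof -
  define Ct where "Ct t i j = C i j + (if i = j then t else 0)" for t and i j :: nat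
  have Ct: "((\<lambda>t. Ct t i j) \<longlongrightarrow> C i j) (at 0)" for i j
    unfolding Ct_def by (cases "i = j") (auto intro!: tendsto_eq_intros)
  have ev: "\<forall>\<^sub>F t in at 0. fdet n (Ct t) \<noteq> 0"
  proof -
    have "\<forall>\<^sub>F t in at 0. t \<notin> {t. fdet n (Ct t) = 0}"
      unfolding Ct_def using islimpt_finite[OF finite_singular_shifts] unfolding islimpt_iff_eventually by blast
    then show ?thesis by simp
  qed
  have 1: "((\<lambda>t. fdet n (\<lambda>i j. Ct t i j - y i * x j)) \<longlongrightarrow> fdet n (\<lambda>i j. C i j - y i * x j)) (at 0)"
    by (intro fdet_tendsto tendsto_diff Ct tendsto_const)
  have 2: "((\<lambda>t. fdet n (Ct t) - adjform n (Ct t) x y) \<longlongrightarrow> fdet n C - adjform n C x y) (at 0)"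
    unfolding adjform_def
    by (intro tendsto_diff fdet_tendsto Ct tendsto_sum tendsto_mult tendsto_const fcof_tendsto) auto
  have "((\<lambda>t. fdet n (\<lambda>i j. Ct t i j - y i * x j)) \<longlongrightarrow> fdet n C - adjform n C x y) (at 0)"
    by (rule Lim_transform_eventually[OF 2]) (use ev in eventually_elim, simp add: fdet_minus_rank_one_nonsing)
  then show ?thesis using 1 tendsto_unique[OF _ 1] by simp
qed

lemma adjform_add_right: "adjform n C x (\<lambda>i. y i + z i) = adjform n C x y + adjform n C x z"
  unfolding adjform_def by (simp add: algebra_simps sum.distrib)

lemma adjform_scale: "adjform n C (\<lambda>i. a * x i) (\<lambda>i. b * y i) = a * b * adjform n C x y"
  unfolding adjform_def by (simp add: sum_distrib_left mult_ac)

lemma adjform_cong: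
  "(\<And>i. i < n \<Longrightarrow> x i = x' i) \<Longrightarrow> (\<And>i. i < n \<Longrightarrow> y i = y' i) \<Longrightarrow> adjform n C x y = adjform n C x' y'"
  unfolding adjform_def by (intro sum.cong) auto

lemma fdet_sq_le: "(fdet n C)\<^sup>2 \<le> (\<Prod>j<n. \<Sum>i<n. (C i j)\<^sup>2)"
  using hadamard_inequality[of "Matrix.mat n n (\<lambda>(i,j). C i j)" n] by (simp add: fdet_def)

section \<open>Bounds for contractions that do not depend on the size\<close>

definition contraction :: "nat \<Rightarrow> (nat \<Rightarrow> nat \<Rightarrow> real) \<Rightarrow> bool" where
  "contraction n C \<longleftrightarrow> (\<forall>x. (\<Sum>i<n. (\<Sum>j<n. C i j * x j)\<^sup>2) \<le> (\<Sum>i<n. (x i)\<^sup>2))"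

lemma contraction_column:
  assumes "contraction n C" "j < n"
  shows "(\<Sum>i<n. (C i j)\<^sup>2) \<le> 1"
proof -
  have "(\<Sum>i<n. (\<Sum>k<n. C i k * (if k = j then 1 else 0))\<^sup>2) \<le> (\<Sum>i<n. (if i = j then 1 else 0)\<^sup>2)"
    by (rule assms(1)[unfolded contraction_def, rule_format])
  moreover have "(\<Sum>k<n. C i k * (if k = j then 1 else 0)) = C i j" for i
  proof -
    have "(\<Sum>k<n. C i k * (if k = j then 1 else 0)) = (\<Sum>k<n. if k = j then C i k else 0)"
      by (intro sum.cong) auto
    then show ?thesis using assms(2) by (simp add: sum_delta_lt)
  qed
  moreover have "(\<Sum>i<n. (if i = j then 1 else 0)\<^sup>2) = (1::real)"
  proof -
    have "(\<Sum>i<n. (if i = j then 1 else 0)\<^sup>2) = (\<Sum>i<n. if i = j then 1 else (0::real))"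
      by (intro sum.cong) auto
    then show ?thesis using assms(2) by (simp add: sum_delta_lt)
  qed
  ultimately show ?thesis by simp
qed

lemma abs_fdet_le_1:
  assumes "contraction n C"
  shows "\<bar>fdet n C\<bar> \<le> 1"
proof -
  have "(fdet n C)\<^sup>2 \<le> (\<Prod>j<n. \<Sum>i<n. (C i j)\<^sup>2)" by (rule fdet_sq_le)
  also have "\<dots> \<le> (\<Prod>j<n. 1)"
    by (intro prod_mono conjI sum_nonneg contraction_column[OF assms]) auto
  finally show ?thesis by (simp add: abs_le_square_iff[of _ 1, simplified])
qed

text \<open>The adjugate form is det(C) - det(C - y x^T). The first determinant is at most 1 in
  modulus. For the second, column \<open>j\<close> has squared norm at most 1 + 2 x_j^2 + v_j^2 with
  v = C y (symmetry of \<open>C\<close> is used here), and 1 + a \<le> exp a turns Hadamard's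
  product into the exponential of a bounded sum.\<close>

lemma adjform_bound_unit:
  assumes C: "contraction n C" and sym: "\<And>i j. C i j = C j i"
    and x: "(\<Sum>i<n. (x i)\<^sup>2) = 1" and y: "(\<Sum>i<n. (y i)\<^sup>2) = 1"
  shows "\<bar>adjform n C x y\<bar> \<le> 7"
proof -
  define v where "v j = (\<Sum>i<n. C j i * y i)" for j
  have v: "(\<Sum>j<n. (v j)\<^sup>2) \<le> 1" using C y unfolding contraction_def v_def by metis
  have col: "(\<Sum>i<n. (C i j - y i * x j)\<^sup>2) \<le> exp (2 * (x j)\<^sup>2 + (v j)\<^sup>2)" if j: "j < n" for j
  proof -
    have "(\<Sum>i<n. (C i j - y i * x j)\<^sup>2) = (\<Sum>i<n. (C i j)\<^sup>2 - 2 * x j * (C j i * y i) + (x j)\<^sup>2 * (y i)\<^sup>2)"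
      by (intro sum.cong) (auto simp: power2_eq_square algebra_simps sym[of j])
    also have "\<dots> = (\<Sum>i<n. (C i j)\<^sup>2) - 2 * x j * v j + (x j)\<^sup>2 * (\<Sum>i<n. (y i)\<^sup>2)"
      by (simp add: sum.distrib sum_subtractf sum_distrib_left v_def)
    also have "\<dots> \<le> 1 + (x j)\<^sup>2 - 2 * x j * v j" using contraction_column[OF C j] y by simp
    also have "\<dots> \<le> 1 + (2 * (x j)\<^sup>2 + (v j)\<^sup>2)"
      using sum_power2_ge_zero[of "x j + v j" 0] by (simp add: power2_eq_square algebra_simps)
    also have "\<dots> \<le> exp (2 * (x j)\<^sup>2 + (v j)\<^sup>2)" by (rule exp_ge_add_one_self)
    finally show ?thesis .
  qed
  have "(fdet n (\<lambda>i j. C i j - y i * x j))\<^sup>2 \<le> (\<Prod>j<n. \<Sum>i<n. (C i j - y i * x j)\<^sup>2)"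
    by (rule fdet_sq_le)
  also have "\<dots> \<le> (\<Prod>j<n. exp (2 * (x j)\<^sup>2 + (v j)\<^sup>2))"
    by (intro prod_mono conjI sum_nonneg col) auto
  also have "\<dots> = exp (2 * (\<Sum>j<n. (x j)\<^sup>2) + (\<Sum>j<n. (v j)\<^sup>2))"
    by (simp add: exp_sum[symmetric] sum.distrib sum_distrib_left)
  \<comment> \<open>The norms of \<open>x\<close> and \<open>v\<close> contribute 2 + 1. Since exp 3
    \<le> 27 \<le> 36, the determinant is at most 6, and adding the bound 1 for det(C) gives
    7.\<close>
  also have "\<dots> \<le> exp 3" using x v by simp
  also have "\<dots> = exp (1::real) ^ 3" by (simp flip: exp_of_nat_mult)
  also have "\<dots> \<le> 3 ^ 3" by (intro power_mono exp_le) auto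
  also have "\<dots> \<le> 6\<^sup>2" by simp
  finally have "\<bar>fdet n (\<lambda>i j. C i j - y i * x j)\<bar> \<le> 6" by (simp add: abs_le_square_iff[of _ 6, simplified])
  then show ?thesis using abs_fdet_le_1[OF C] unfolding fdet_minus_rank_one by linarith
qed

lemma adjform_bound:
  assumes C: "contraction n C" and sym: "\<And>i j. C i j = C j i"
  shows "\<bar>adjform n C x y\<bar> \<le> 7 * L2_set x {..<n} * L2_set y {..<n}"
proof (cases "L2_set x {..<n} = 0 \<or> L2_set y {..<n} = 0")
  case True
  then have "(\<forall>i<n. x i = 0) \<or> (\<forall>i<n. y i = 0)" by (auto simp: L2_set_eq_0_iff)
  then have "adjform n C x y = 0" unfolding adjform_def by (auto intro!: sum.neutral)
  then show ?thesis by (simp add: L2_set_nonneg)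
next
  case False
  define a b where "a = L2_set x {..<n}" and "b = L2_set y {..<n}"
  have pos: "a > 0" "b > 0" using False L2_set_nonneg unfolding a_def b_def by (metis less_eq_real_def)+
  have sq: "(\<Sum>i<n. (x i)\<^sup>2) = a\<^sup>2" "(\<Sum>i<n. (y i)\<^sup>2) = b\<^sup>2"
    unfolding a_def b_def L2_set_def by (simp_all add: sum_nonneg)
  have "\<bar>adjform n C (\<lambda>i. (1/a) * x i) (\<lambda>i. (1/b) * y i)\<bar> \<le> 7"
    by (rule adjform_bound_unit[OF C sym]) (use sq pos in \<open>simp_all add: power_divide flip: sum_divide_distrib\<close>)
  then show ?thesis using pos unfolding adjform_scale a_def[symmetric] b_def[symmetric]
    by (simp add: abs_mult field_simps)
qed

definition defect :: "('b \<Rightarrow> nat \<Rightarrow> real) \<Rightarrow> 'b set \<Rightarrow> nat \<Rightarrow> nat \<Rightarrow> real" where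
  "defect F A i j = (if i = j then 1 else 0) - (\<Sum>c\<in>A. F c i * F c j)"

lemma defect_sym: "defect F A i j = defect F A j i"
  by (simp add: defect_def mult.commute)

lemma sum_defect: "k < n \<Longrightarrow> (\<Sum>j<n. defect F A k j * x j) = x k - (\<Sum>c\<in>A. F c k * (\<Sum>j<n. F c j * x j))"
proof -
  assume k: "k < n"
  have "(\<Sum>j<n. defect F A k j * x j) = (\<Sum>j<n. (if j = k then x j else 0) - (\<Sum>c\<in>A. F c k * (F c j * x j)))"
    by (intro sum.cong) (auto simp: defect_def algebra_simps sum_distrib_left sum_distrib_right)
  also have "\<dots> = x k - (\<Sum>c\<in>A. F c k * (\<Sum>j<n. F c j * x j))"
    using k by (simp add: sum_subtractf sum_delta_lt sum_distrib_left sum.swap[of _ A])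
  finally show ?thesis .
qed

text \<open>Write u for the vector of pairings of x with the F_c. The image has squared norm |x|^2 -
  2 |u|^2 + |sum u_c F_c|^2, and the assumption bounds the last term by |u|^2.\<close>

lemma contraction_defect:
  assumes F: "\<And>u. (\<Sum>k<n. (\<Sum>c\<in>A. u c * F c k)\<^sup>2) \<le> (\<Sum>c\<in>A. (u c)\<^sup>2)"
  shows "contraction n (defect F A)"
  unfolding contraction_def
proof
  fix x :: "nat \<Rightarrow> real"
  define u where "u c = (\<Sum>j<n. F c j * x j)" for c
  have "(\<Sum>k<n. (\<Sum>j<n. defect F A k j * x j)\<^sup>2) = (\<Sum>k<n. (x k - (\<Sum>c\<in>A. u c * F c k))\<^sup>2)"
  proof (intro sum.cong refl)
    fix k assume "k \<in> {..<n}"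
    then have "(\<Sum>j<n. defect F A k j * x j) = x k - (\<Sum>c\<in>A. F c k * u c)"
      by (simp add: sum_defect u_def)
    then show "(\<Sum>j<n. defect F A k j * x j)\<^sup>2 = (x k - (\<Sum>c\<in>A. u c * F c k))\<^sup>2"
      by (simp add: mult.commute)
  qed
  also have "\<dots> = (\<Sum>k<n. (x k)\<^sup>2 - 2 * (\<Sum>c\<in>A. u c * (F c k * x k)) + (\<Sum>c\<in>A. u c * F c k)\<^sup>2)"
    by (intro sum.cong refl) (simp add: power2_eq_square algebra_simps sum_distrib_left)
  also have "\<dots> = (\<Sum>k<n. (x k)\<^sup>2) - 2 * (\<Sum>k<n. \<Sum>c\<in>A. u c * (F c k * x k)) + (\<Sum>k<n. (\<Sum>c\<in>A. u c * F c k)\<^sup>2)"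
    by (simp add: sum.distrib sum_subtractf sum_distrib_left)
  also have "(\<Sum>k<n. \<Sum>c\<in>A. u c * (F c k * x k)) = (\<Sum>c\<in>A. (u c)\<^sup>2)"
    by (subst sum.swap) (simp add: u_def power2_eq_square sum_distrib_left)
  also have "(\<Sum>k<n. (x k)\<^sup>2) - 2 * (\<Sum>c\<in>A. (u c)\<^sup>2) + (\<Sum>k<n. (\<Sum>c\<in>A. u c * F c k)\<^sup>2) \<le> (\<Sum>k<n. (x k)\<^sup>2)"
    using F[of u] sum_nonneg[of A "\<lambda>c. (u c)\<^sup>2"] by simp
  finally show "(\<Sum>i<n. (\<Sum>j<n. defect F A i j * x j)\<^sup>2) \<le> (\<Sum>i<n. (x i)\<^sup>2)" .
qed

section \<open>Fredholm determinants\<close>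

definition fredholm_coeff :: "nat \<Rightarrow> ('a \<Rightarrow> 'a \<Rightarrow> real) \<Rightarrow> 'a set \<Rightarrow> real" where
  "fredholm_coeff k K A = (\<Sum>\<^sub>\<infinity>x \<in> PiE {..<k} (\<lambda>_. A). fdet k (\<lambda>i j. K (x i) (x j)))"

lemma fredholm_det_coeff:
  "fredholm_det_1m K A = (\<Sum>k. (-1)^k / fact k * fredholm_coeff k K A)"
  unfolding fredholm_det_1m_def fredholm_coeff_def fdet_expand lessThan_atLeast0 by simp

lemma fredholm_coeff_reindex:
  assumes h: "bij_betw h B A"
  shows "fredholm_coeff k K A = fredholm_coeff k (\<lambda>i j. K (h i) (h j)) B"
proof -
  let ?g = "inv_into B h"
  have hA: "h b \<in> A" "?g (h b) = b" if "b \<in> B" for b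
    using h that by (auto simp: bij_betw_def)
  have gA: "?g a \<in> B" "h (?g a) = a" if "a \<in> A" for a
    using h that by (auto simp: bij_betw_def inv_into_into f_inv_into_f)
  show ?thesis
    unfolding fredholm_coeff_def
    by (rule infsum_reindex_bij_witness[where i = "\<lambda>x. restrict (\<lambda>i. h (x i)) {..<k}"
           and j = "\<lambda>x. restrict (\<lambda>i. ?g (x i)) {..<k}"])
      (auto simp: PiE_def extensional_def fun_eq_iff hA gA Pi_def intro!: fdet_cong)
qed

section \<open>Principal minors and Fredholm determinants of finite rank\<close>

lemma fdet_identical_rows:
  assumes "i < n" "j < n" "i \<noteq> j" "\<And>k. k < n \<Longrightarrow> C i k = C j k"
  shows "fdet n C = 0"
  unfolding fdet_def using assms by (intro det_identical_rows[of _ n i j]) (auto simp: row_def intro!: eq_vecI)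

text \<open>A principal minor written with permutations of \<open>S\<close> itself, so that no
  enumeration of \<open>S\<close> has to be chosen.\<close>

definition minor :: "(nat \<Rightarrow> nat \<Rightarrow> real) \<Rightarrow> nat set \<Rightarrow> real" where
  "minor K S = (\<Sum>p | p permutes S. of_int (sign p) * (\<Prod>i\<in>S. K i (p i)))"

text \<open>Transport along the enumeration \<open>x\<close> is a sign-preserving bijection between
  permutations of the positions and permutations of \<open>S\<close>.\<close>

lemma fdet_minor:
  assumes x: "bij_betw x {..<k} S"
  shows "fdet k (\<lambda>i j. K (x i) (x j)) = minor K S"
proof -
  let ?h = "map_permutation {..<k} x" and ?g = "map_permutation S (inv_into {..<k} x)"
  have inj: "inj_on x {..<k}" and im: "x ` {..<k} = S" using x by (auto simp: bij_betw_def)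
  have x': "bij_betw (inv_into {..<k} x) S {..<k}" by (rule bij_betw_inv_into[OF x])
  have inv1: "inv_into {..<k} x (x i) = i" if "i < k" for i using inj that by simp
  have inv2: "x (inv_into {..<k} x s) = s" "inv_into {..<k} x s < k" if "s \<in> S" for s
    using that im inj by (auto simp: f_inv_into_f)
  have gh: "?g (?h p) = p" if p: "p permutes {..<k}" for p
  proof
    fix i show "?g (?h p) i = p i"
    proof (cases "i < k")
      case True
      have "?g (?h p) (inv_into {..<k} x (x i)) = inv_into {..<k} x (?h p (x i))"
        using x' True im by (intro map_permutation_apply) (auto simp: bij_betw_def)
      then show ?thesis
        using True p by (simp add: inv1 map_permutation_apply[OF inj] permutes_in_image[OF p, unfolded lessThan_iff])
    next
      case False
      have "?g (?h p) permutes {..<k}" by (intro map_permutation_permutes[OF x'] map_permutation_permutes[OF x] p)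
      then show ?thesis using False p by (simp add: permutes_def)
    qed
  qed
  have hg: "?h (?g q) = q" if q: "q permutes S" for q
  proof
    fix s show "?h (?g q) s = q s"
    proof (cases "s \<in> S")
      case True
      have "?h (?g q) (x (inv_into {..<k} x s)) = x (?g q (inv_into {..<k} x s))"
        using inj True inv2 by (intro map_permutation_apply) auto
      also have "?g q (inv_into {..<k} x s) = inv_into {..<k} x (q s)"
        using x' True by (intro map_permutation_apply) (auto simp: bij_betw_def)
      finally show ?thesis using True q by (simp add: inv2 permutes_in_image[OF q])
    next
      case False
      have "?h (?g q) permutes S" by (intro map_permutation_permutes[OF x'] map_permutation_permutes[OF x] q)
      then show ?thesis using False q by (simp add: permutes_def)
    qed
  qed
  show ?thesis
    unfolding minor_def fdet_expand atLeast0LessThan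
  proof (rule sum.reindex_bij_witness[where i = ?g and j = ?h])
    fix p assume p: "p \<in> {p. p permutes {..<k}}"
    then show "?g (?h p) = p" by (simp add: gh)
    show "?h p \<in> {p. p permutes S}" using p map_permutation_permutes[OF x] by simp
    have "(\<Prod>i\<in>S. K i (?h p i)) = (\<Prod>i<k. K (x i) (?h p (x i)))"
      using inj by (simp flip: im add: prod.reindex)
    also have "\<dots> = (\<Prod>i<k. K (x i) (x (p i)))"
      by (intro prod.cong refl) (simp add: map_permutation_apply[OF inj])
    finally show "of_int (sign (?h p)) * (\<Prod>i\<in>S. K i (?h p i)) = of_int (sign p) * (\<Prod>i<k. K (x i) (x (p i)))"
      using p sign_map_permutation[OF inj] by simp
  next
    fix q assume q: "q \<in> {p. p permutes S}"
    then show "?h (?g q) = q" by (simp add: hg)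
    show "?g q \<in> {p. p permutes {..<k}}" using q map_permutation_permutes[OF x'] by simp
  qed
qed

text \<open>Composition with one fixed enumeration \<open>e\<close> matches these tuples with
  permutations. The count cancels the factor 1/k! of the Fredholm series.\<close>

lemma card_bijections:
  assumes "finite S" "card S = k"
  shows "card {x \<in> PiE {..<k} (\<lambda>_. S). bij_betw x {..<k} S} = fact k"
proof -
  obtain e where e: "bij_betw e {..<k} S"
    using assms by (metis atLeast0LessThan ex_bij_betw_nat_finite)
  let ?g = "inv_into {..<k} e"
  have inv1: "?g (e i) = i" "e i \<in> S" if "i < k" for i using e that by (auto simp: bij_betw_def)
  have inv2: "e (?g s) = s" "?g s < k" if "s \<in> S" for s
    using that e by (auto simp: bij_betw_def f_inv_into_f dest: inv_into_into[of s e "{..<k}"])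
  have "bij_betw (\<lambda>p. restrict (e \<circ> p) {..<k}) {p. p permutes {..<k}} {x \<in> PiE {..<k} (\<lambda>_. S). bij_betw x {..<k} S}"
  proof (rule bij_betw_byWitness[where f' = "\<lambda>x i. if i < k then ?g (x i) else i"])
    have pi: "p i < k \<longleftrightarrow> i < k" if "p permutes {..<k}" for p i using permutes_in_image[OF that] by simp
    show "\<forall>p\<in>{p. p permutes {..<k}}. (\<lambda>i. if i < k then ?g (restrict (e \<circ> p) {..<k} i) else i) = p"
      by (auto simp: fun_eq_iff inv1 pi permutes_def)
    show "(\<lambda>p. restrict (e \<circ> p) {..<k}) ` {p. p permutes {..<k}} \<subseteq> {x \<in> PiE {..<k} (\<lambda>_. S). bij_betw x {..<k} S}"
    proof
      fix x assume "x \<in> (\<lambda>p. restrict (e \<circ> p) {..<k}) ` {p. p permutes {..<k}}"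
      then obtain p where p: "p permutes {..<k}" and x: "x = restrict (e \<circ> p) {..<k}" by auto
      have "x \<in> PiE {..<k} (\<lambda>_. S)" unfolding x by (auto simp: inv1 pi[OF p])
      moreover have "bij_betw (e \<circ> p) {..<k} S" using permutes_imp_bij[OF p] e by (rule bij_betw_trans)
      then have "bij_betw x {..<k} S" unfolding x
        by (subst bij_betw_cong[of _ _ "e \<circ> p"]) auto
      ultimately show "x \<in> {x \<in> PiE {..<k} (\<lambda>_. S). bij_betw x {..<k} S}" by simp
    qed
    show "\<forall>x\<in>{x \<in> PiE {..<k} (\<lambda>_. S). bij_betw x {..<k} S}.
        restrict (e \<circ> (\<lambda>i. if i < k then ?g (x i) else i)) {..<k} = x"
      by (auto simp: fun_eq_iff restrict_def inv2 PiE_def Pi_def extensional_def)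
    show "(\<lambda>x i. if i < k then ?g (x i) else i) ` {x \<in> PiE {..<k} (\<lambda>_. S). bij_betw x {..<k} S}
        \<subseteq> {p. p permutes {..<k}}"
    proof
      fix p assume "p \<in> (\<lambda>x i. if i < k then ?g (x i) else i) ` {x \<in> PiE {..<k} (\<lambda>_. S). bij_betw x {..<k} S}"
      then obtain x where x: "bij_betw x {..<k} S" and p: "p = (\<lambda>i. if i < k then ?g (x i) else i)" by auto
      have "bij_betw (?g \<circ> x) {..<k} {..<k}" by (rule bij_betw_trans[OF x bij_betw_inv_into[OF e]])
      then have "bij_betw p {..<k} {..<k}"
        unfolding p by (subst bij_betw_cong[of _ _ "?g \<circ> x"]) auto
      then have "p permutes {..<k}" by (rule bij_imp_permutes) (auto simp: p)
      then show "p \<in> {p. p permutes {..<k}}" by simp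
    qed
  qed
  then have "card {x \<in> PiE {..<k} (\<lambda>_. S). bij_betw x {..<k} S} = card {p. p permutes {..<k}}"
    by (simp add: bij_betw_same_card)
  then show ?thesis by (simp add: card_permutations)
qed

text \<open>A tuple with an entry beyond \<open>N\<close> gives a zero row, a tuple with a
  repetition gives two equal rows. The surviving tuples are grouped by their image \<open>S\<close>,
  and all enumerations of one \<open>S\<close> contribute the same minor.\<close>

lemma fredholm_coeff_finite:
  assumes supp: "\<And>i j. i \<ge> N \<Longrightarrow> K i j = 0"
  shows "fredholm_coeff k K UNIV = fact k * (\<Sum>S | S \<subseteq> {..<N} \<and> card S = k. minor K S)"
proof -
  let ?X = "PiE {..<k} (\<lambda>_. {..<N})"
  let ?d = "\<lambda>x. fdet k (\<lambda>i j. K (x i) (x j))"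
  let ?B = "\<lambda>S. {x \<in> PiE {..<k} (\<lambda>_. S). bij_betw x {..<k} S}"
  have zero: "?d x = 0" if "x \<in> PiE {..<k} (\<lambda>_. UNIV) - ?X" for x
  proof -
    have "\<exists>i<k. x i \<ge> N" using that by (force simp: PiE_def Pi_def extensional_def)
    then obtain i where i: "i < k" "x i \<ge> N" by blast
    then show ?thesis
      using fdet_laplace_row[of i k "\<lambda>_. 0" "\<lambda>i j. K (x i) (x j)"]
      by (subst fdet_cong[of k _ "\<lambda>l j. if l = i then 0 else K (x l) (x j)"]) (auto simp: supp)
  qed
  have fX: "finite ?X" by (intro finite_PiE) auto
  have "fredholm_coeff k K UNIV = infsum ?d ?X"
    unfolding fredholm_coeff_def by (rule infsum_cong_neutral) (use zero in \<open>auto simp: PiE_def Pi_def\<close>)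
  also have "\<dots> = sum ?d ?X" using fX by simp
  also have "\<dots> = sum ?d (\<Union>S\<in>{S. S \<subseteq> {..<N} \<and> card S = k}. ?B S)"
  proof (rule sum.mono_neutral_right[OF fX])
    show "(\<Union>S\<in>{S. S \<subseteq> {..<N} \<and> card S = k}. ?B S) \<subseteq> ?X"
    proof (intro UN_least)
      fix S assume "S \<in> {S. S \<subseteq> {..<N} \<and> card S = k}"
      then have "PiE {..<k} (\<lambda>_. S) \<subseteq> ?X" by (intro PiE_mono) auto
      then show "?B S \<subseteq> ?X" by blast
    qed
    show "\<forall>x\<in>?X - (\<Union>S\<in>{S. S \<subseteq> {..<N} \<and> card S = k}. ?B S). ?d x = 0"
    proof
    fix x assume "x \<in> ?X - (\<Union>S\<in>{S. S \<subseteq> {..<N} \<and> card S = k}. ?B S)"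
    then have x: "x \<in> ?X" "x \<notin> (\<Union>S\<in>{S. S \<subseteq> {..<N} \<and> card S = k}. ?B S)" by blast+
    have "\<not> inj_on x {..<k}"
    proof
      assume inj: "inj_on x {..<k}"
      have "x ` {..<k} \<in> {S. S \<subseteq> {..<N} \<and> card S = k}" using x(1) inj by (auto simp: card_image)
      moreover have "x \<in> ?B (x ` {..<k})" using x(1) inj by (auto simp: PiE_def bij_betw_def)
      ultimately show False using x(2) by blast
    qed
    then obtain i j where "i < k" "j < k" "i \<noteq> j" "x i = x j" by (auto simp: inj_on_def)
    then show "?d x = 0" by (intro fdet_identical_rows[of i k j]) auto
    qed
  qed
  also have "\<dots> = (\<Sum>S | S \<subseteq> {..<N} \<and> card S = k. sum ?d (?B S))"
  proof (rule sum.UNION_disjoint)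
    show "finite {S. S \<subseteq> {..<N} \<and> card S = k}" by simp
    show "\<forall>S\<in>{S. S \<subseteq> {..<N} \<and> card S = k}. finite (?B S)"
    proof
      fix S assume "S \<in> {S. S \<subseteq> {..<N} \<and> card S = k}"
      then have "finite S" using finite_subset[of S "{..<N}"] by simp
      then have "finite (PiE {..<k} (\<lambda>_. S))" by (intro finite_PiE) auto
      then show "finite (?B S)" by simp
    qed
    show "\<forall>S\<in>{S. S \<subseteq> {..<N} \<and> card S = k}. \<forall>T\<in>{S. S \<subseteq> {..<N} \<and> card S = k}. S \<noteq> T \<longrightarrow> ?B S \<inter> ?B T = {}"
      by (auto simp: bij_betw_def)
  qed
  also have "\<dots> = (\<Sum>S | S \<subseteq> {..<N} \<and> card S = k. fact k * minor K S)"
  proof (intro sum.cong refl)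
    fix S assume "S \<in> {S. S \<subseteq> {..<N} \<and> card S = k}"
    then have S: "finite S" "card S = k" by (auto intro: finite_subset[of _ "{..<N}"])
    have "sum ?d (?B S) = (\<Sum>x\<in>?B S. minor K S)" by (intro sum.cong refl fdet_minor) auto
    also have "\<dots> = fact k * minor K S" by (simp add: card_bijections[OF S])
    finally show "sum ?d (?B S) = fact k * minor K S" .
  qed
  finally show ?thesis by (simp add: sum_distrib_left)
qed

text \<open>In each Leibniz product the set \<open>S\<close> records the factors from which -K is
  taken. The identity factors outside \<open>S\<close> vanish unless the permutation fixes the
  complement, so permutations of \<open>S\<close> remain.\<close>

lemma fdet_id_minus:
  "fdet N (\<lambda>i j. (if i = j then 1 else 0) - K i j) = (\<Sum>S\<in>Pow {..<N}. (-1) ^ card S * minor K S)"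
proof -
  let ?I = "\<lambda>i j :: nat. (if i = j then 1 else 0 :: real)"
  have "fdet N (\<lambda>i j. ?I i j - K i j)
    = (\<Sum>p | p permutes {..<N}. \<Sum>S\<in>Pow {..<N}. signof p * ((-1) ^ card S * (\<Prod>i\<in>S. K i (p i)) * (\<Prod>i\<in>{..<N} - S. ?I i (p i))))"
    unfolding fdet_expand atLeast0LessThan by (subst prod_diff_conv_sum) (simp_all add: sum_distrib_left)
  also have "\<dots> = (\<Sum>S\<in>Pow {..<N}. \<Sum>p | p permutes {..<N}. signof p * ((-1) ^ card S * (\<Prod>i\<in>S. K i (p i)) * (\<Prod>i\<in>{..<N} - S. ?I i (p i))))"
    by (rule sum.swap)
  also have "\<dots> = (\<Sum>S\<in>Pow {..<N}. (-1) ^ card S * minor K S)"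
  proof (intro sum.cong refl)
    fix S assume S: "S \<in> Pow {..<N}"
    have "(\<Sum>p | p permutes {..<N}. signof p * ((-1) ^ card S * (\<Prod>i\<in>S. K i (p i)) * (\<Prod>i\<in>{..<N} - S. ?I i (p i))))
        = (\<Sum>p | p permutes S. signof p * ((-1) ^ card S * (\<Prod>i\<in>S. K i (p i)) * (\<Prod>i\<in>{..<N} - S. ?I i (p i))))"
    proof (rule sum.mono_neutral_right)
      show "finite {p. p permutes {..<N}}" by (simp add: finite_permutations)
      show "{p. p permutes S} \<subseteq> {p. p permutes {..<N}}" using S by (auto intro: permutes_subset)
      show "\<forall>p\<in>{p. p permutes {..<N}} - {p. p permutes S}.
         signof p * ((-1) ^ card S * (\<Prod>i\<in>S. K i (p i)) * (\<Prod>i\<in>{..<N} - S. ?I i (p i))) = 0"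
      proof
        fix p assume p: "p \<in> {p. p permutes {..<N}} - {p. p permutes S}"
        have "\<exists>i\<in>{..<N} - S. i \<noteq> p i"
        proof (rule ccontr)
          assume "\<not> (\<exists>i\<in>{..<N} - S. i \<noteq> p i)"
          then have "p permutes S" using p S permutes_superset[of p "{..<N}" S] by auto
          then show False using p by simp
        qed
        then have "(\<Prod>i\<in>{..<N} - S. ?I i (p i)) = 0" by (intro prod_zero) auto
        then show "signof p * ((-1) ^ card S * (\<Prod>i\<in>S. K i (p i)) * (\<Prod>i\<in>{..<N} - S. ?I i (p i))) = 0" by simp
      qed
    qed
    also have "\<dots> = (\<Sum>p | p permutes S. (-1) ^ card S * (signof p * (\<Prod>i\<in>S. K i (p i))))"
    proof (intro sum.cong refl)
      fix p assume "p \<in> {p. p permutes S}"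
      then have "(\<Prod>i\<in>{..<N} - S. ?I i (p i)) = 1" by (intro prod.neutral) (auto simp: permutes_def)
      then show "signof p * ((-1) ^ card S * (\<Prod>i\<in>S. K i (p i)) * (\<Prod>i\<in>{..<N} - S. ?I i (p i)))
        = (-1) ^ card S * (signof p * (\<Prod>i\<in>S. K i (p i)))" by simp
    qed
    finally show "(\<Sum>p | p permutes {..<N}. signof p * ((-1) ^ card S * (\<Prod>i\<in>S. K i (p i)) * (\<Prod>i\<in>{..<N} - S. ?I i (p i))))
      = (-1) ^ card S * minor K S" by (simp add: minor_def sum_distrib_left)
  qed
  finally show ?thesis .
qed

text \<open>Both sides are the alternating sum of all principal minors, once sorted by the size of
  \<open>S\<close>. This links the Fredholm series to ordinary determinants of truncations.\<close>

lemma fredholm_det_finite: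
  assumes supp: "\<And>i j. i \<ge> N \<Longrightarrow> K i j = 0"
  shows "fredholm_det_1m K UNIV = fdet N (\<lambda>i j. (if i = j then 1 else 0) - K i j)"
proof -
  let ?P = "\<lambda>k. {S. S \<subseteq> {..<N} \<and> card S = k}"
  have "fredholm_det_1m K UNIV = (\<Sum>k. (-1)^k * (\<Sum>S\<in>?P k. minor K S))"
    unfolding fredholm_det_coeff by (simp add: fredholm_coeff_finite[OF supp])
  also have "\<dots> = (\<Sum>k\<le>N. (-1)^k * (\<Sum>S\<in>?P k. minor K S))"
  proof (rule suminf_finite)
    fix k assume "k \<notin> {..N}"
    have "?P k = {}" 
    proof -
      have "card S \<le> N" if "S \<subseteq> {..<N}" for S using card_mono[OF _ that] by simp
      then show ?thesis using \<open>k \<notin> {..N}\<close> by auto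
    qed
    then show "(-1)^k * (\<Sum>S\<in>?P k. minor K S) = 0" by (simp only: sum.empty mult_zero_right)
  qed simp
  also have "\<dots> = (\<Sum>k\<le>N. \<Sum>S\<in>?P k. (-1) ^ card S * minor K S)"
    by (simp add: sum_distrib_left)
  also have "\<dots> = (\<Sum>k\<le>N. \<Sum>S\<in>{S\<in>Pow {..<N}. card S = k}. (-1) ^ card S * minor K S)"
    by simp
  also have "\<dots> = (\<Sum>S\<in>Pow {..<N}. (-1) ^ card S * minor K S)"
    by (rule sum.group) (auto dest: card_mono[rotated])
  finally show ?thesis by (simp add: fdet_id_minus)
qed

section \<open>Dominated convergence for Fredholm series\<close>

lemma summable_on_dominated:
  fixes f :: "'a \<Rightarrow> real"
  assumes "g summable_on A" "\<And>x. x \<in> A \<Longrightarrow> \<bar>f x\<bar> \<le> g x"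
  shows "f summable_on A"
proof -
  have "(\<lambda>x. norm (f x)) summable_on A"
    by (rule Infinite_Sum.abs_summable_on_comparison_test'[OF assms(1)]) (use assms(2) in auto)
  then show ?thesis by (rule abs_summable_summable)
qed

lemma infsum_tendsto_dominated:
  fixes f :: "nat \<Rightarrow> 'a \<Rightarrow> real"
  assumes g: "g summable_on A"
    and bound: "\<And>n x. x \<in> A \<Longrightarrow> \<bar>f n x\<bar> \<le> g x"
    and lim: "\<And>x. x \<in> A \<Longrightarrow> (\<lambda>n. f n x) \<longlonglongrightarrow> f0 x"
  shows "(\<lambda>n. infsum (f n) A) \<longlonglongrightarrow> infsum f0 A"
proof (rule LIMSEQ_I)
  fix \<epsilon> :: real assume \<epsilon>: "\<epsilon> > 0"
  have g0: "g x \<ge> 0" if "x \<in> A" for x using bound[OF that, of 0] by linarith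
  have bound0: "\<bar>f0 x\<bar> \<le> g x" if "x \<in> A" for x
    using LIMSEQ_le_const2[OF tendsto_rabs[OF lim[OF that]]] bound[OF that] by blast
  have fs: "f n summable_on A" for n
    by (rule summable_on_dominated[OF g]) (use bound in auto)
  have f0s: "f0 summable_on A"
    by (rule summable_on_dominated[OF g]) (use bound0 in auto)
  \<comment> \<open>\<open>F\<close> carries the sum of \<open>g\<close> up to \<epsilon>/4, so it
    serves every \<open>f n\<close> and \<open>f0\<close> simultaneously.\<close>
  obtain F where F: "finite F" "F \<subseteq> A" "dist (sum g F) (infsum g A) \<le> \<epsilon> / 4"
    using infsum_finite_approximation[OF g, of "\<epsilon>/4"] \<epsilon> by auto
  have split: "infsum h A = sum h F + infsum h (A - F)" if "h summable_on A" for h :: "'a \<Rightarrow> real"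
  proof -
    have "infsum h (F \<union> (A - F)) = infsum h F + infsum h (A - F)"
      using that F by (intro infsum_Un_disjoint) (auto intro: summable_on_subset_banach)
    then show ?thesis using F by (simp add: Un_absorb1)
  qed
  have tail: "\<bar>infsum h (A - F)\<bar> \<le> \<epsilon> / 4" if h: "\<And>x. x \<in> A \<Longrightarrow> \<bar>h x\<bar> \<le> g x" for h
  proof -
    have "\<bar>infsum h (A - F)\<bar> \<le> infsum g (A - F)"
    proof -
      have gs: "g summable_on (A - F)" by (rule summable_on_subset_banach[OF g]) auto
      have hs: "h summable_on (A - F)"
        by (rule summable_on_dominated[OF gs]) (use h in auto)
      have "infsum h (A - F) \<le> infsum g (A - F)"
        by (rule infsum_mono[OF hs gs]) (use h in \<open>force simp: abs_le_iff\<close>)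
      moreover have "infsum (\<lambda>x. - h x) (A - F) \<le> infsum g (A - F)"
        by (rule infsum_mono[OF _ gs]) (use h hs in \<open>force simp: abs_le_iff summable_on_uminus\<close>)+
      ultimately show ?thesis by (simp add: infsum_uminus)
    qed
    also have "\<dots> \<le> \<epsilon> / 4" using F(3) split[OF g] by (simp add: dist_real_def)
    finally show ?thesis .
  qed
  have "(\<lambda>n. sum (f n) F) \<longlonglongrightarrow> sum f0 F" using F by (intro tendsto_sum lim) auto
  then obtain N where N: "\<And>n. n \<ge> N \<Longrightarrow> \<bar>sum (f n) F - sum f0 F\<bar> < \<epsilon> / 4"
    using LIMSEQ_D[of _ _ "\<epsilon>/4"] \<epsilon> by fastforce
  show "\<exists>no. \<forall>n\<ge>no. norm (infsum (f n) A - infsum f0 A) < \<epsilon>"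
  proof (intro exI allI impI)
    fix n assume "n \<ge> N"
    then have "\<bar>sum (f n) F - sum f0 F\<bar> < \<epsilon> / 4" by (rule N)
    moreover have "\<bar>infsum (f n) (A - F)\<bar> \<le> \<epsilon> / 4" by (rule tail[OF bound])
    moreover have "\<bar>infsum f0 (A - F)\<bar> \<le> \<epsilon> / 4" by (rule tail[OF bound0])
    ultimately show "norm (infsum (f n) A - infsum f0 A) < \<epsilon>"
      using \<epsilon> unfolding split[OF fs] split[OF f0s] real_norm_def by linarith
  qed
qed

text \<open>Each index occurs once as a row and once as a column in every Leibniz product, so the
  factors \<kappa> come out squared. What remains has entries of modulus at most 1, for which
  Hadamard's inequality gives the square root of k^k.\<close>

lemma abs_minor_le:
  assumes K: "\<And>i j. i < k \<Longrightarrow> j < k \<Longrightarrow> \<bar>K i j\<bar> \<le> \<kappa> i * \<kappa> j" and \<kappa>: "\<And>i. \<kappa> i \<ge> 0"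
  shows "\<bar>fdet k K\<bar> \<le> sqrt (real k ^ k) * (\<Prod>i<k. (\<kappa> i)\<^sup>2)"
proof -
  \<comment> \<open>Where \<kappa> vanishes, \<open>R\<close> is 0 by the convention for division;
    this is consistent because the hypothesis then forces \<open>K i j\<close> = 0.\<close>
  define R where "R i j = K i j / (\<kappa> i * \<kappa> j)" for i j
  have KR: "K i j = \<kappa> i * (\<kappa> j * R i j)" if "i < k" "j < k" for i j
    using K[OF that] by (cases "\<kappa> i = 0 \<or> \<kappa> j = 0") (auto simp: R_def)
  have R1: "(R i j)\<^sup>2 \<le> 1" if "i < k" "j < k" for i j
  proof -
    have "\<bar>R i j\<bar> \<le> 1"
    proof (cases "\<kappa> i * \<kappa> j = 0")
      case False
      then have "\<kappa> i * \<kappa> j > 0" using \<kappa>[of i] \<kappa>[of j] by (simp add: less_le)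
      then show ?thesis using K[OF that] by (simp add: R_def abs_divide abs_of_pos)
    qed (auto simp: R_def)
    then show ?thesis by (simp add: abs_square_le_1)
  qed
  have "fdet k K = (\<Sum>p | p permutes {0..<k}. (\<Prod>i = 0..<k. (\<kappa> i)\<^sup>2) * (signof p * (\<Prod>i = 0..<k. R i (p i))))"
    unfolding fdet_expand
  proof (intro sum.cong refl)
    fix p assume p: "p \<in> {p. p permutes {0..<k}}"
    have "(\<Prod>i = 0..<k. K i (p i)) = (\<Prod>i = 0..<k. \<kappa> i * (\<kappa> (p i) * R i (p i)))"
    proof (intro prod.cong refl KR)
      fix i assume "i \<in> {0..<k}"
      then show "i < k" "p i < k" using p permutes_in_image[of p "{0..<k}" i] by auto
    qed
    also have "\<dots> = (\<Prod>i = 0..<k. \<kappa> i) * ((\<Prod>i = 0..<k. \<kappa> (p i)) * (\<Prod>i = 0..<k. R i (p i)))"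
      by (simp add: prod.distrib)
    also have "(\<Prod>i = 0..<k. \<kappa> (p i)) = (\<Prod>i = 0..<k. \<kappa> i)"
      using p by (intro prod.permute[symmetric, unfolded o_def]) simp
    finally show "signof p * (\<Prod>i = 0..<k. K i (p i)) = (\<Prod>i = 0..<k. (\<kappa> i)\<^sup>2) * (signof p * (\<Prod>i = 0..<k. R i (p i)))"
      by (simp add: prod.distrib power2_eq_square)
  qed
  also have "\<dots> = (\<Prod>i<k. (\<kappa> i)\<^sup>2) * fdet k R"
    unfolding fdet_expand by (simp add: sum_distrib_left atLeast0LessThan)
  finally have eq: "fdet k K = (\<Prod>i<k. (\<kappa> i)\<^sup>2) * fdet k R" .
  have "(fdet k R)\<^sup>2 \<le> (\<Prod>j<k. \<Sum>i<k. (R i j)\<^sup>2)" by (rule fdet_sq_le)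
  also have "\<dots> \<le> (\<Prod>j<k. real k)"
  proof (intro prod_mono conjI sum_nonneg)
    fix j assume "j \<in> {..<k}"
    then have "(\<Sum>i<k. (R i j)\<^sup>2) \<le> (\<Sum>i<k. 1)" by (intro sum_mono R1) auto
    then show "(\<Sum>i<k. (R i j)\<^sup>2) \<le> real k" by simp
  qed auto
  finally have "\<bar>fdet k R\<bar> \<le> sqrt (real k ^ k)"
    by (intro real_le_rsqrt) simp
  moreover have "(\<Prod>i<k. (\<kappa> i)\<^sup>2) \<ge> 0" by (intro prod_nonneg) auto
  ultimately show ?thesis unfolding eq
    by (subst mult.commute) (simp add: abs_mult mult_right_mono del: prod_power_distrib)
qed

text \<open>A finite set of tuples lies in the cube over the finite set \<open>B\<close> of all its
  entries, and over a cube the sum of products is a product of sums.\<close>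

lemma summable_on_prod_PiE:
  fixes w :: "'a \<Rightarrow> real"
  assumes w: "w summable_on A" and w0: "\<And>a. a \<in> A \<Longrightarrow> w a \<ge> 0"
  shows "(\<lambda>x. \<Prod>i<k. w (x i)) summable_on PiE {..<k} (\<lambda>_. A)"
    and "infsum (\<lambda>x. \<Prod>i<k. w (x i)) (PiE {..<k} (\<lambda>_. A)) \<le> infsum w A ^ k"
proof -
  let ?P = "PiE {..<k} (\<lambda>_. A)"
  have le: "(\<Sum>x\<in>S. \<Prod>i<k. w (x i)) \<le> infsum w A ^ k" if S: "finite S" "S \<subseteq> ?P" for S
  proof -
    define B where "B = (\<Union>x\<in>S. x ` {..<k})"
    have B: "finite B" "B \<subseteq> A" using S by (auto simp: B_def)
    have SB: "S \<subseteq> PiE {..<k} (\<lambda>_. B)" 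
    proof
      fix x assume x: "x \<in> S"
      then have "x \<in> ?P" using S(2) by blast
      then show "x \<in> PiE {..<k} (\<lambda>_. B)" using x by (auto simp: B_def PiE_iff)
    qed
    have "(\<Sum>x\<in>S. \<Prod>i<k. w (x i)) \<le> (\<Sum>x\<in>PiE {..<k} (\<lambda>_. B). \<Prod>i<k. w (x i))"
    proof (rule sum_mono2[OF _ SB])
      show "finite (PiE {..<k} (\<lambda>_. B))" using B by (intro finite_PiE) auto
    qed (use B w0 in \<open>auto intro!: prod_nonneg simp: PiE_def Pi_def\<close>)
    also have "\<dots> = (\<Prod>i<k. \<Sum>b\<in>B. w b)" using B by (subst prod_sum_PiE) auto
    also have "\<dots> \<le> infsum w A ^ k"
      using finite_sum_le_infsum[OF w B] B w0 by (auto intro!: power_mono sum_nonneg)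
    finally show ?thesis .
  qed
  show s: "(\<lambda>x. \<Prod>i<k. w (x i)) summable_on ?P"
    by (rule nonneg_bdd_above_summable_on) (use w0 le in \<open>auto intro!: prod_nonneg bdd_aboveI simp: PiE_def Pi_def\<close>)
  show "infsum (\<lambda>x. \<Prod>i<k. w (x i)) ?P \<le> infsum w A ^ k"
    by (rule infsum_le_finite_sums[OF s le])
qed

text \<open>The term of index \<open>k\<close> in the series of exp(k), a substitute for Stirling's
  formula.\<close>

lemma power_self_le_exp_fact: "real k ^ k \<le> exp 1 ^ k * fact k"
proof -
  have "(\<Sum>i\<in>{k}. real k ^ i /\<^sub>R fact i) \<le> exp (real k)"
    unfolding exp_def by (rule sum_le_suminf[OF summable_exp_generic]) auto
  then have "real k ^ k / fact k \<le> exp 1 ^ k"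
    by (simp add: divide_inverse mult.commute flip: exp_of_nat_mult)
  then show ?thesis by (simp add: divide_le_eq)
qed

lemma summable_hadamard_bound:
  assumes "T \<ge> 0"
  shows "summable (\<lambda>k. sqrt (real k ^ k) * T ^ k / fact k)"
proof -
  \<comment> \<open>By the previous lemma the terms are at most (sqrt(e) T)^k / sqrt(k!). The added
    1 keeps \<open>c\<close> positive when \<open>T\<close> = 0.\<close>
  define c where "c = sqrt (exp 1) * T + 1"
  have c: "c > 0" using assms by (simp add: c_def add_nonneg_pos)
  have s: "summable (\<lambda>k. c ^ k / sqrt (fact k))"
  proof (rule summable_ratio_test[of "1/2" "nat \<lceil>4 * c\<^sup>2\<rceil>"])
    \<comment> \<open>From this threshold on the quotient of consecutive terms, c / sqrt(n+1), is at
      most 1/2.\<close>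
    fix n assume n: "n \<ge> nat \<lceil>4 * c\<^sup>2\<rceil>"
    then have "4 * c\<^sup>2 \<le> real (Suc n)" by linarith
    then have "2 * c \<le> sqrt (real (Suc n))" by (intro real_le_rsqrt) (simp add: power2_eq_square)
    then have "c / sqrt (real (Suc n)) \<le> 1/2" by (simp add: field_simps)
    then have "(c / sqrt (real (Suc n))) * (c ^ n / sqrt (fact n)) \<le> 1/2 * (c ^ n / sqrt (fact n))"
      using c by (intro mult_right_mono) auto
    moreover have "c ^ Suc n / sqrt (fact (Suc n)) = (c / sqrt (real (Suc n))) * (c ^ n / sqrt (fact n))"
      by (simp add: real_sqrt_mult)
    ultimately show "norm (c ^ Suc n / sqrt (fact (Suc n))) \<le> 1/2 * norm (c ^ n / sqrt (fact n))"
      using c by simp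
  qed auto
  show ?thesis
  proof (rule summable_comparison_test'[OF s])
    fix k :: nat
    have "sqrt (real k ^ k) \<le> sqrt (exp 1 ^ k * fact k)"
      by (intro real_sqrt_le_mono power_self_le_exp_fact)
    also have "\<dots> = sqrt (exp 1) ^ k * sqrt (fact k)" by (simp add: real_sqrt_mult real_sqrt_power)
    finally have "sqrt (real k ^ k) * T ^ k / fact k \<le> sqrt (exp 1) ^ k * sqrt (fact k) * T ^ k / fact k"
      using assms by (intro divide_right_mono mult_right_mono) auto
    also have "\<dots> = (sqrt (exp 1) * T) ^ k / sqrt (fact k)"
    proof -
      have "fact k = sqrt (fact k) * (sqrt (fact k) :: real)" by simp
      then show ?thesis by (simp add: power_mult_distrib field_simps)
    qed
    also have "\<dots> \<le> c ^ k / sqrt (fact k)"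
      using assms by (intro divide_right_mono power_mono) (auto simp: c_def)
    finally show "norm (sqrt (real k ^ k) * T ^ k / fact k) \<le> c ^ k / sqrt (fact k)"
      using assms by simp
  qed
qed

text \<open>Dominated convergence at two levels: over tuples for each coefficient, then Tannery's
  theorem over the order \<open>k\<close>. The product bound is the one that Cauchy--Schwarz
  provides for Gram kernels, where the sum of \<kappa>^2 is the trace.\<close>

lemma fredholm_det_tendsto:
  fixes K :: "nat \<Rightarrow> 'a \<Rightarrow> 'a \<Rightarrow> real"
  assumes bound: "\<And>n a b. a \<in> A \<Longrightarrow> b \<in> A \<Longrightarrow> \<bar>K n a b\<bar> \<le> \<kappa> a * \<kappa> b"
    and \<kappa>: "\<And>a. \<kappa> a \<ge> 0" "(\<lambda>a. (\<kappa> a)\<^sup>2) summable_on A"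
    and lim: "\<And>a b. a \<in> A \<Longrightarrow> b \<in> A \<Longrightarrow> (\<lambda>n. K n a b) \<longlonglongrightarrow> K0 a b"
  shows "(\<lambda>n. fredholm_det_1m (K n) A) \<longlonglongrightarrow> fredholm_det_1m K0 A"
proof -
  define T where "T = infsum (\<lambda>a. (\<kappa> a)\<^sup>2) A"
  have T: "T \<ge> 0" by (simp add: T_def infsum_nonneg)
  let ?P = "\<lambda>k. PiE {..<k} (\<lambda>_. A)"
  let ?g = "\<lambda>k x. sqrt (real k ^ k) * (\<Prod>i<k. (\<kappa> (x i))\<^sup>2)"
  have gs: "?g k summable_on ?P k" for k
    by (intro summable_on_cmult_right summable_on_prod_PiE[OF \<kappa>(2)]) auto
  have dtb: "\<bar>fdet k (\<lambda>i j. K n (x i) (x j))\<bar> \<le> ?g k x" if "x \<in> ?P k" for k n x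
    by (rule abs_minor_le[where \<kappa> = "\<lambda>i. \<kappa> (x i)"]) (use that \<kappa> in \<open>auto intro!: bound\<close>)
  have lim_coeff: "(\<lambda>n. fredholm_coeff k (K n) A) \<longlonglongrightarrow> fredholm_coeff k K0 A" for k
    unfolding fredholm_coeff_def
    by (rule infsum_tendsto_dominated[OF gs]) (auto intro!: dtb fdet_tendsto lim)
  have coeff: "\<bar>fredholm_coeff k (K n) A\<bar> \<le> sqrt (real k ^ k) * T ^ k" for k n
  proof -
    have "\<bar>fredholm_coeff k (K n) A\<bar> \<le> infsum (?g k) (?P k)"
      unfolding fredholm_coeff_def real_norm_def[symmetric]
      by (rule norm_infsum_le[OF has_sum_infsum has_sum_infsum[OF gs]])
        (auto intro!: dtb summable_on_dominated[OF gs])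
    also have "\<dots> = sqrt (real k ^ k) * infsum (\<lambda>x. \<Prod>i<k. (\<kappa> (x i))\<^sup>2) (?P k)"
      by (rule infsum_cmult_right') 
    also have "\<dots> \<le> sqrt (real k ^ k) * T ^ k"
      unfolding T_def by (intro mult_left_mono summable_on_prod_PiE[OF \<kappa>(2)]) auto
    finally show ?thesis .
  qed
  have "((\<lambda>n. \<Sum>k. (-1)^k / fact k * fredholm_coeff k (K n) A) \<longlongrightarrow> (\<Sum>k. (-1)^k / fact k * fredholm_coeff k K0 A)) sequentially"
  proof (rule conjunct2[OF conjunct2[OF tannerys_theorem]])
    show "((\<lambda>n. (-1)^k / fact k * fredholm_coeff k (K n) A) \<longlongrightarrow> (-1)^k / fact k * fredholm_coeff k K0 A) sequentially" for k
      by (intro tendsto_mult tendsto_const lim_coeff)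
    show "\<forall>\<^sub>F (k, n) in at_top \<times>\<^sub>F sequentially.
        norm ((-1)^k / fact k * fredholm_coeff k (K n) A) \<le> sqrt (real k ^ k) * T ^ k / fact k"
      by (rule always_eventually) (use coeff in \<open>auto simp: abs_mult divide_right_mono\<close>)
    show "summable (\<lambda>k. sqrt (real k ^ k) * T ^ k / fact k)" by (rule summable_hadamard_bound[OF T])
  qed auto
  then show ?thesis unfolding fredholm_det_coeff .
qed

section \<open>Bessel functions of integer order\<close>

definition bessel_coeff :: "nat \<Rightarrow> nat \<Rightarrow> real" where
  "bessel_coeff N m = (-1)^m / (fact m * fact (m + N))"

text \<open>J_N(2t) is t^N times this series at u = t^2. Splitting off the power leaves an entire
  function whose derivative is, up to sign, a shift of \<open>N\<close>.\<close>

definition bessel_series :: "nat \<Rightarrow> real \<Rightarrow> real" where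
  "bessel_series N u = (\<Sum>m. bessel_coeff N m * u^m)"

lemma abs_bessel_coeff_le: "\<bar>bessel_coeff N m\<bar> \<le> 1 / fact N * (1 / fact m)"
proof -
  have "(fact m * fact N :: real) \<le> fact m * fact (m + N)"
    by (intro mult_left_mono fact_mono) auto
  then show ?thesis by (simp add: bessel_coeff_def abs_mult divide_simps mult.commute)
qed

lemma abs_bessel_series_term_le: "\<bar>bessel_coeff N m * u^m\<bar> \<le> 1 / fact N * (\<bar>u\<bar>^m / fact m)"
  using mult_right_mono[OF abs_bessel_coeff_le[of N m], of "\<bar>u\<bar>^m"] by (simp add: abs_mult power_abs)

lemma exp_series: "(\<lambda>m. (x::real)^m / fact m) sums exp x"
  using exp_converges[of x] by (simp add: scaleR_conv_of_real divide_inverse mult.commute)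

lemma bessel_series_summable: "summable (\<lambda>m. bessel_coeff N m * u^m)"
  by (rule summable_comparison_test'[OF summable_mult[OF sums_summable[OF exp_series[of "\<bar>u\<bar>"]], of "1 / fact N"], where N = 0])
    (use abs_bessel_series_term_le in simp)

lemma bessel_series_sums: "(\<lambda>m. bessel_coeff N m * u^m) sums bessel_series N u"
  unfolding bessel_series_def by (rule summable_sums[OF bessel_series_summable])

lemma abs_bessel_series_le: "\<bar>bessel_series N u\<bar> \<le> exp \<bar>u\<bar> / fact N"
proof -
  have s: "(\<lambda>m. 1 / fact N * (\<bar>u\<bar>^m / fact m)) sums (1 / fact N * exp \<bar>u\<bar>)"
    by (intro sums_mult exp_series)
  have "norm (bessel_series N u) \<le> (\<Sum>m. 1 / fact N * (\<bar>u\<bar>^m / fact m))"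
    unfolding bessel_series_def by (rule norm_suminf_le[OF _ sums_summable[OF s]]) (use abs_bessel_series_term_le in simp)
  then show ?thesis using sums_unique[OF s] by simp
qed

lemma bessel_series_has_derivative: "(bessel_series N has_real_derivative - bessel_series (Suc N) u) (at u)"
proof -
  have "diffs (bessel_coeff N) m = - bessel_coeff (Suc N) m" for m
  proof -
    have f: "fact (Suc m) = real (Suc m) * fact m" "Suc m + N = m + Suc N" by simp_all
    show ?thesis unfolding diffs_def bessel_coeff_def f by (simp del: of_nat_Suc add: divide_simps)
  qed
  then have "(\<Sum>m. diffs (bessel_coeff N) m * u^m) = - bessel_series (Suc N) u"
    using sums_unique[OF sums_minus[OF bessel_series_sums[of "Suc N" u]]] by simp
  then show ?thesis
    using termdiffs_strong_converges_everywhere[of "bessel_coeff N" u] bessel_series_summable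
    by (simp add: bessel_series_def[abs_def])
qed

lemma bessel_series_recurrence: "bessel_series N u + u * bessel_series (Suc (Suc N)) u = real (Suc N) * bessel_series (Suc N) u"
proof -
  have 1: "(\<lambda>m. if m = 0 then 0 else bessel_coeff (Suc (Suc N)) (m - 1) * u^m) sums (u * bessel_series (Suc (Suc N)) u)"
  proof -
    have "(\<lambda>m. u * (bessel_coeff (Suc (Suc N)) m * u^m)) sums (u * bessel_series (Suc (Suc N)) u)"
      by (intro sums_mult bessel_series_sums)
    then have "(\<lambda>m. (\<lambda>m. if m = 0 then 0 else bessel_coeff (Suc (Suc N)) (m - 1) * u^m) (Suc m)) sums (u * bessel_series (Suc (Suc N)) u)"
      by (simp add: mult_ac)
    from sums_Suc[OF this] show ?thesis by simp
  qed
  have "bessel_coeff N m * u^m + (if m = 0 then 0 else bessel_coeff (Suc (Suc N)) (m - 1) * u^m)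
      = real (Suc N) * (bessel_coeff (Suc N) m * u^m)" for m
  proof (cases m)
    case (Suc l)
    have "bessel_coeff N m + bessel_coeff (Suc (Suc N)) l = real (Suc N) * bessel_coeff (Suc N) m"
    proof -
      have f: "fact (Suc l + Suc N) = (real l + real N + 2) * fact (Suc l + N)"
              "fact (Suc l) = (real l + 1) * fact l" "fact (l + Suc (Suc N)) = (fact (Suc l + Suc N) :: real)"
        by (simp_all add: algebra_simps)
      show ?thesis unfolding bessel_coeff_def Suc f by (simp add: divide_simps) (simp add: algebra_simps)
    qed
    then show ?thesis using Suc by (simp flip: distrib_right mult.assoc)
  next
    case 0
    have "real (Suc N) * bessel_coeff (Suc N) 0 = bessel_coeff N 0" by (simp add: bessel_coeff_def del: of_nat_Suc)
    then show ?thesis using 0 by simp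
  qed
  then have "(\<lambda>m. real (Suc N) * (bessel_coeff (Suc N) m * u^m)) sums (bessel_series N u + u * bessel_series (Suc (Suc N)) u)"
    using sums_add[OF bessel_series_sums[of N u] 1] by simp
  then show ?thesis using sums_mult[OF bessel_series_sums[of "Suc N" u], of "real (Suc N)"] by (rule sums_unique2)
qed

text \<open>J_n(2t). The doubled argument removes the factors 1/2 and 2 from the differential and
  three-term relations, and it is the argument used by the kernel.\<close>

definition bessel :: "int \<Rightarrow> real \<Rightarrow> real" where
  "bessel n t = besselJ_int n (2 * t)"

lemma bessel_nat: "bessel (int N) t = t ^ N * bessel_series N (t\<^sup>2)"
proof -
  have "(\<lambda>m. (-1)^m / (fact m * fact (m + N)) * t^(2*m + N)) sums (t ^ N * bessel_series N (t\<^sup>2))"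
  proof -
    have "t^(2*m + N) = t ^ N * (t\<^sup>2)^m" for m
      unfolding power_add power_mult by (rule mult.commute)
    then show ?thesis using sums_mult[OF bessel_series_sums[of N "t\<^sup>2"], of "t ^ N"]
      by (simp only: bessel_coeff_def mult_ac)
  qed
  then show ?thesis by (simp add: bessel_def besselJ_int_def sums_iff)
qed

lemma bessel_minus_nat: "bessel (- int N) t = (-1)^N * bessel (int N) t"
  by (cases "N = 0") (auto simp: bessel_def besselJ_int_def)

lemma int_sign_cases:
  obtains N where "n = int N" | N where "n = - int N" "N > 0"
  by (cases n rule: int_cases2) auto

lemma bessel_has_derivative: "(bessel n has_real_derivative bessel (n - 1) t - bessel (n + 1) t) (at t)"
proof -
  have nat: "(bessel (int N) has_real_derivative bessel (int N - 1) t - bessel (int N + 1) t) (at t)" for N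
  proof (cases N)
    case 0
    have "((\<lambda>t. bessel_series 0 (t\<^sup>2)) has_real_derivative (- bessel_series 1 (t\<^sup>2) * (2 * t))) (at t)"
      by (rule DERIV_chain2[OF bessel_series_has_derivative[of 0, folded One_nat_def]]) (auto intro!: derivative_eq_intros)
    moreover have "bessel (-1) t = - bessel 1 t" using bessel_minus_nat[of 1 t] by simp
    moreover have "bessel 1 t = t * bessel_series 1 (t\<^sup>2)" using bessel_nat[of 1 t] by simp
    moreover have "bessel 0 = (\<lambda>t. bessel_series 0 (t\<^sup>2))" using bessel_nat[of 0] by auto
    ultimately show ?thesis using 0 by (simp add: mult_ac)
  next
    case (Suc M)
    have eq: "bessel (int N) = (\<lambda>t. t ^ Suc M * bessel_series (Suc M) (t\<^sup>2))" using Suc by (intro ext) (simp only: bessel_nat)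
    have "(bessel (int N) has_real_derivative (real (Suc M) * t ^ M * bessel_series (Suc M) (t\<^sup>2)
        + (- bessel_series (Suc (Suc M)) (t\<^sup>2) * (2 * t)) * t ^ Suc M)) (at t)"
      unfolding eq
      by (rule derivative_eq_intros refl DERIV_chain2[OF bessel_series_has_derivative[of "Suc M"], where g = "\<lambda>t. t\<^sup>2"])+ simp
    also have "real (Suc M) * t ^ M * bessel_series (Suc M) (t\<^sup>2) + (- bessel_series (Suc (Suc M)) (t\<^sup>2) * (2 * t)) * t ^ Suc M
       = t ^ M * (real (Suc M) * bessel_series (Suc M) (t\<^sup>2)) - 2 * (t ^ Suc (Suc M) * bessel_series (Suc (Suc M)) (t\<^sup>2))"
      by (simp add: algebra_simps)
    \<comment> \<open>With N = M + 1, the series recurrence splits the first term into J_(N-1) +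
      J_(N+1); subtracting 2 J_(N+1) leaves the claimed difference.\<close>
    also have "\<dots> = bessel (int M) t - bessel (int (Suc (Suc M))) t"
      unfolding bessel_series_recurrence[symmetric] bessel_nat by (simp add: algebra_simps power2_eq_square)
    finally show ?thesis using Suc by (simp add: add.commute)
  qed
  show ?thesis
  proof (cases n rule: int_sign_cases)
    case (2 N)
    then obtain M where M: "N = Suc M" by (cases N) auto
    have eq: "bessel n = (\<lambda>t. (-1)^N * bessel (int N) t)" using 2 by (intro ext) (simp only: bessel_minus_nat)
    have "(bessel n has_real_derivative (-1)^N * (bessel (int N - 1) t - bessel (int N + 1) t)) (at t)"
      unfolding eq by (intro DERIV_cmult nat)
    moreover have "n - 1 = - int (Suc (Suc M))" "n + 1 = - int M" "int N - 1 = int M" "int N + 1 = int (Suc (Suc M))"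
      using 2 M by auto
    ultimately show ?thesis by (simp only: bessel_minus_nat M) (simp add: algebra_simps)
  qed (use nat in simp)
qed

lemma bessel_recurrence: "of_int n * bessel n t = t * (bessel (n - 1) t + bessel (n + 1) t)"
proof -
  have pos: "of_int (int (Suc M)) * bessel (int (Suc M)) t = t * (bessel (int M) t + bessel (int (Suc (Suc M))) t)" for M
  proof -
    have "of_int (int (Suc M)) * bessel (int (Suc M)) t = t ^ Suc M * (bessel_series M (t\<^sup>2) + t\<^sup>2 * bessel_series (Suc (Suc M)) (t\<^sup>2))"
      unfolding bessel_series_recurrence bessel_nat of_int_of_nat_eq by (simp only: mult_ac)
    then show ?thesis unfolding bessel_nat by (simp add: algebra_simps power2_eq_square)
  qed
  show ?thesis
  proof (cases n rule: int_sign_cases)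
    case (1 N)
    show ?thesis
    proof (cases N)
      case 0
      then show ?thesis using 1 bessel_minus_nat[of 1 t] by simp
    next
      case (Suc M)
      then show ?thesis using 1 pos[of M] by (simp add: add.commute)
    qed
  next
    case (2 N)
    then obtain M where M: "N = Suc M" by (cases N) auto
    have "n - 1 = - int (Suc (Suc M))" "n + 1 = - int M" "n = - int (Suc M)"
      using 2 M by auto
    moreover have "(-1)^M * (of_int (int (Suc M)) * bessel (int (Suc M)) t)
        = (-1)^M * (t * (bessel (int M) t + bessel (int (Suc (Suc M))) t))" by (simp only: pos)
    ultimately show ?thesis by (simp only: bessel_minus_nat) (simp add: algebra_simps)
  qed
qed

lemma abs_bessel_le: "\<bar>bessel n t\<bar> \<le> exp (t\<^sup>2) * (\<bar>t\<bar> ^ nat \<bar>n\<bar> / fact (nat \<bar>n\<bar>))"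
proof -
  have nat: "\<bar>bessel (int N) t\<bar> \<le> exp (t\<^sup>2) * (\<bar>t\<bar> ^ N / fact N)" for N
  proof -
    have "\<bar>t\<bar> ^ N * \<bar>bessel_series N (t\<^sup>2)\<bar> \<le> \<bar>t\<bar> ^ N * (exp \<bar>t\<^sup>2\<bar> / fact N)"
      by (intro mult_left_mono abs_bessel_series_le) auto
    then show ?thesis by (simp add: bessel_nat abs_mult power_abs mult_ac)
  qed
  show ?thesis
    by (cases n rule: int_sign_cases) (use nat in \<open>auto simp: bessel_minus_nat abs_mult\<close>)
qed

lemma summable_on_int:
  fixes h :: "nat \<Rightarrow> real"
  assumes "summable h" "\<And>m. h m \<ge> 0"
  shows "(\<lambda>n::int. h (nat \<bar>n\<bar>)) summable_on UNIV"
proof -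
  have h: "h summable_on UNIV"
    by (rule norm_summable_imp_summable_on) (use assms in simp)
  have 1: "(\<lambda>n::int. h (nat \<bar>n\<bar>)) summable_on (range int)"
    by (subst summable_on_reindex) (use h in \<open>auto simp: o_def\<close>)
  have 2: "(\<lambda>n::int. h (nat \<bar>n\<bar>)) summable_on (range (\<lambda>m. - int m))"
    by (subst summable_on_reindex) (use h in \<open>auto simp: o_def inj_def\<close>)
  have "(\<lambda>n::int. h (nat \<bar>n\<bar>)) summable_on (range int \<union> (range (\<lambda>m. - int m)))"
    by (rule summable_on_union[OF 1 2])
  moreover have "range int \<union> (range (\<lambda>m. - int m)) = UNIV"
  proof -
    have "n \<in> range int \<union> (range (\<lambda>m. - int m))" for n by (cases n rule: int_cases2) auto
    then show ?thesis by blast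
  qed
  ultimately show ?thesis by simp
qed

text \<open>The half-open interval from -N to N - 1 codes exactly the half-integers of modulus below
  N, that is, the lattice points enclosed by the circle |z| = N.\<close>

lemma has_sum_int_interval:
  fixes f :: "int \<Rightarrow> 'a::topological_comm_monoid_add"
  assumes "(f has_sum S) UNIV"
  shows "(\<lambda>N. \<Sum>k = - int N..<int N. f k) \<longlonglongrightarrow> S"
proof -
  have "filterlim (\<lambda>N. {- int N..<int N}) (finite_subsets_at_top UNIV) sequentially"
    unfolding filterlim_finite_subsets_at_top
  proof (intro allI impI)
    fix X :: "int set" assume X: "finite X \<and> X \<subseteq> UNIV"
    have "\<forall>\<^sub>F N in sequentially. X \<subseteq> {- int N..<int N}"
    proof -
      have "\<forall>\<^sub>F N in sequentially. \<forall>x\<in>X. x \<in> {- int N..<int N}"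
      proof (rule eventually_ball_finite)
        show "\<forall>x\<in>X. \<forall>\<^sub>F N in sequentially. x \<in> {- int N..<int N}"
        proof
          fix x assume "x \<in> X"
          show "\<forall>\<^sub>F N in sequentially. x \<in> {- int N..<int N}"
            using eventually_gt_at_top[of "nat \<bar>x\<bar>"] by eventually_elim auto
        qed
      qed (use X in auto)
      then show ?thesis by eventually_elim auto
    qed
    then show "\<forall>\<^sub>F N in sequentially. finite {- int N..<int N} \<and> X \<subseteq> {- int N..<int N} \<and> {- int N..<int N} \<subseteq> UNIV"
      by simp
  qed
  with assms show ?thesis unfolding has_sum_def by (rule filterlim_compose)
qed

text \<open>Up to the factor exp(R^2) this dominates J_n(2t) uniformly for |t| \<le> R; it is
  summable over all orders.\<close>

definition bessel_majorant :: "real \<Rightarrow> int \<Rightarrow> real" where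
  "bessel_majorant R n = R ^ nat \<bar>n\<bar> / fact (nat \<bar>n\<bar>)"

lemma bessel_majorant_summable: "R \<ge> 0 \<Longrightarrow> bessel_majorant R summable_on UNIV"
  unfolding bessel_majorant_def
  by (rule summable_on_int[of "\<lambda>m. R ^ m / fact m"]) (use sums_summable[OF exp_series] in auto)

lemma bessel_majorant_nonneg: "R \<ge> 0 \<Longrightarrow> bessel_majorant R n \<ge> 0"
  by (simp add: bessel_majorant_def)

lemma abs_bessel_le_majorant:
  assumes "\<bar>t\<bar> \<le> R"
  shows "\<bar>bessel n t\<bar> \<le> exp (R\<^sup>2) * bessel_majorant R n"
proof -
  have R: "R \<ge> 0" using assms by linarith
  have "\<bar>bessel n t\<bar> \<le> exp (t\<^sup>2) * (\<bar>t\<bar> ^ nat \<bar>n\<bar> / fact (nat \<bar>n\<bar>))" by (rule abs_bessel_le)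
  also have "\<dots> \<le> exp (R\<^sup>2) * (R ^ nat \<bar>n\<bar> / fact (nat \<bar>n\<bar>))"
    using assms R by (intro mult_mono divide_right_mono power_mono) (auto simp: abs_le_square_iff[symmetric])
  finally show ?thesis by (simp add: bessel_majorant_def)
qed

lemma bessel_majorant_le_exp: "R \<ge> 0 \<Longrightarrow> bessel_majorant R n \<le> exp R"
proof -
  assume R: "R \<ge> 0"
  have "(\<Sum>m\<in>{nat \<bar>n\<bar>}. R ^ m / fact m) \<le> (\<Sum>m. R ^ m / fact m)"
    by (rule sum_le_suminf) (use R sums_summable[OF exp_series] in auto)
  then show ?thesis using sums_unique[OF exp_series[of R]] by (simp add: bessel_majorant_def)
qed

text \<open>One of the two factors is estimated by the constant \<open>exp R\<close>, so that the
  bound stays linear in the majorant.\<close>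

lemma bessel_sq_le:
  assumes "\<bar>t\<bar> \<le> R"
  shows "(bessel n t)\<^sup>2 \<le> (exp (R\<^sup>2))\<^sup>2 * exp R * bessel_majorant R n"
proof -
  have R: "R \<ge> 0" using assms by linarith
  have "(bessel n t)\<^sup>2 \<le> (exp (R\<^sup>2) * bessel_majorant R n)\<^sup>2"
    using abs_bessel_le_majorant[OF assms, of n] by (metis abs_ge_zero power2_abs power_mono)
  also have "\<dots> = (exp (R\<^sup>2))\<^sup>2 * bessel_majorant R n * bessel_majorant R n" by (simp add: power2_eq_square)
  also have "\<dots> \<le> (exp (R\<^sup>2))\<^sup>2 * exp R * bessel_majorant R n"
    by (intro mult_right_mono mult_left_mono bessel_majorant_le_exp R bessel_majorant_nonneg) auto
  finally show ?thesis .
qed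

lemma bessel_prod_summable:
  "(\<lambda>k. bessel (c + k) t * bessel (d + k) t) summable_on UNIV"
proof -
  let ?R = "\<bar>t\<bar>"
  let ?g = "\<lambda>n. exp (?R\<^sup>2) * exp ?R * (exp (?R\<^sup>2) * bessel_majorant ?R n)"
  have "(\<lambda>n. bessel n t * bessel (d - c + n) t) summable_on UNIV"
  proof (rule abs_summable_summable, rule Infinite_Sum.abs_summable_on_comparison_test'[where g = ?g])
    show "?g summable_on UNIV" by (intro summable_on_cmult_right bessel_majorant_summable) auto
    fix n :: int
    have "\<bar>bessel n t\<bar> \<le> exp (?R\<^sup>2) * bessel_majorant ?R n" by (rule abs_bessel_le_majorant) simp
    note b1 = this
    have b2: "\<bar>bessel (d - c + n) t\<bar> \<le> exp (?R\<^sup>2) * exp ?R"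
    proof -
      have "exp (?R\<^sup>2) * bessel_majorant ?R (d - c + n) \<le> exp (?R\<^sup>2) * exp ?R" by (intro mult_left_mono bessel_majorant_le_exp) auto
      then show ?thesis using abs_bessel_le_majorant[of t ?R "d - c + n"] by linarith
    qed
    show "norm (bessel n t * bessel (d - c + n) t) \<le> ?g n"
    proof -
      have "\<bar>bessel n t\<bar> * \<bar>bessel (d - c + n) t\<bar> \<le> (exp (?R\<^sup>2) * bessel_majorant ?R n) * (exp (?R\<^sup>2) * exp ?R)"
        using b1 b2 by (intro mult_mono) (auto simp: bessel_majorant_nonneg)
      then show ?thesis by (simp add: abs_mult mult_ac)
    qed
  qed
  then have "((\<lambda>n. bessel n t * bessel (d - c + n) t) \<circ> (\<lambda>k. c + k)) summable_on UNIV"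
    by (subst summable_on_reindex[symmetric]) (auto simp: inj_def surj_def intro!: exI[of _ "_ - c"])
  then show ?thesis by (simp add: o_def algebra_simps)
qed

section \<open>Orthonormality of the shifted Bessel sequences\<close>

lemma bessel_0: "bessel n 0 = (if n = 0 then 1 else 0)"
proof -
  have "bessel_series 0 0 = 1" unfolding bessel_series_def powser_zero by (simp add: bessel_coeff_def)
  then have "bessel (int N) 0 = (if N = 0 then 1 else 0)" for N by (simp add: bessel_nat)
  then show ?thesis by (cases n rule: int_sign_cases) (auto simp: bessel_minus_nat)
qed

lemma sum_telescope_int:
  fixes u :: "int \<Rightarrow> 'a::ab_group_add"
  shows "(\<Sum>n = a..<a + int N. u n - u (n + 1)) = u a - u (a + int N)"
proof (induction N)
  case (Suc N)
  have "{a..<a + int (Suc N)} = insert (a + int N) {a..<a + int N}" by auto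
  then show ?case using Suc by (simp add: algebra_simps)
qed simp

lemma bessel_majorant_tendsto: "R \<ge> 0 \<Longrightarrow> (\<lambda>N. bessel_majorant R (int N)) \<longlonglongrightarrow> 0"
  unfolding bessel_majorant_def using summable_LIMSEQ_zero[OF sums_summable[OF exp_series[of R]]] by simp

text \<open>At argument 0 the sum is trivial because J_n(0) is 1 for n = 0 and 0 otherwise. The
  derivative of the sum over [-N, N) telescopes to boundary products that tend to 0 uniformly on
  [-R, R], so the limit does not depend on \<open>t\<close>.\<close>

lemma bessel_orthonormal_shift: "((\<lambda>n. bessel n t * bessel (n + k) t) has_sum (if k = 0 then 1 else 0)) UNIV"
proof -
  define R where "R = \<bar>t\<bar>"
  have R: "R \<ge> 0" by (simp add: R_def)
  define S where "S N x = (\<Sum>n = - int N..<int N. bessel n x * bessel (n + k) x)" for N x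
  define C where "C = exp (R\<^sup>2) * exp R"
  \<comment> \<open>Bounds the derivative of \<open>S N\<close> on [-R, R]: every boundary product
    has one factor of order N - 1, N or N + 1 in modulus, estimated by the majorant, and another
    estimated by \<open>C\<close>.\<close>
  define \<epsilon> where "\<epsilon> N = C * exp (R\<^sup>2) * (bessel_majorant R (int (Suc N)) + 3 * bessel_majorant R (int N) + bessel_majorant R (int (N - 1)))" for N
  have le_C: "\<bar>bessel n x\<bar> \<le> C" if "\<bar>x\<bar> \<le> R" for n x
  proof -
    have "exp (R\<^sup>2) * bessel_majorant R n \<le> exp (R\<^sup>2) * exp R" by (intro mult_left_mono bessel_majorant_le_exp R) auto
    then show ?thesis using abs_bessel_le_majorant[OF that, of n] unfolding C_def by linarith
  qed
  have der: "(S N has_real_derivative (bessel (- int N - 1) x * bessel (- int N + k) x - bessel (int N - 1) x * bessel (int N + k) x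
       + (bessel (- int N) x * bessel (- int N + k - 1) x - bessel (int N) x * bessel (int N + k - 1) x))) (at x)" for N x
  proof -
    let ?u = "\<lambda>n. bessel (n - 1) x * bessel (n + k) x" and ?v = "\<lambda>n. bessel n x * bessel (n + k - 1) x"
    have "(S N has_real_derivative (\<Sum>n = - int N..<int N. bessel n x * (bessel (n + k - 1) x - bessel (n + k + 1) x)
          + (bessel (n - 1) x - bessel (n + 1) x) * bessel (n + k) x)) (at x)"
      unfolding S_def by (intro DERIV_sum DERIV_mult' bessel_has_derivative)
    also have "(\<Sum>n = - int N..<int N. bessel n x * (bessel (n + k - 1) x - bessel (n + k + 1) x)
          + (bessel (n - 1) x - bessel (n + 1) x) * bessel (n + k) x)
       = (\<Sum>n = - int N..<- int N + int (2 * N). ?u n - ?u (n + 1)) + (\<Sum>n = - int N..<- int N + int (2 * N). ?v n - ?v (n + 1))"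
      by (simp add: algebra_simps flip: sum.distrib)
    also have "\<dots> = (?u (- int N) - ?u (int N)) + (?v (- int N) - ?v (int N))"
      unfolding sum_telescope_int[where u = ?u] sum_telescope_int[where u = ?v] by simp
    finally show ?thesis .
  qed
  have bound: "\<bar>S N t - S N 0\<bar> \<le> \<epsilon> N * R" if "N \<ge> 1" for N
  proof -
    let ?d = "\<lambda>x. bessel (- int N - 1) x * bessel (- int N + k) x - bessel (int N - 1) x * bessel (int N + k) x
       + (bessel (- int N) x * bessel (- int N + k - 1) x - bessel (int N) x * bessel (int N + k - 1) x)"
    have d: "\<bar>?d x\<bar> \<le> \<epsilon> N" if x: "\<bar>x\<bar> \<le> R" for x
    proof -
      define q where "q m = exp (R\<^sup>2) * bessel_majorant R m * C" for m
      have p: "\<bar>bessel m x * bessel l x\<bar> \<le> q m" for m l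
        unfolding abs_mult q_def by (intro mult_mono abs_bessel_le_majorant[OF x] le_C[OF x]) (auto simp: bessel_majorant_nonneg[OF R])
      have w: "bessel_majorant R (- int N - 1) = bessel_majorant R (int (Suc N))" "bessel_majorant R (int N - 1) = bessel_majorant R (int (N - 1))" "bessel_majorant R (- int N) = bessel_majorant R (int N)"
      proof -
        have "nat \<bar>- int N - 1\<bar> = Suc N" "nat \<bar>int N - 1\<bar> = N - 1" using \<open>N \<ge> 1\<close> by linarith+
        then show "bessel_majorant R (- int N - 1) = bessel_majorant R (int (Suc N))" "bessel_majorant R (int N - 1) = bessel_majorant R (int (N - 1))" "bessel_majorant R (- int N) = bessel_majorant R (int N)"
          by (simp_all add: bessel_majorant_def)
      qed
      have "\<epsilon> N = q (- int N - 1) + q (- int N) + 2 * q (int N) + q (int N - 1)"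
        unfolding q_def \<epsilon>_def w by (simp add: algebra_simps)
      moreover have "q (int N) \<ge> 0" unfolding q_def C_def by (simp add: bessel_majorant_nonneg[OF R])
      ultimately show ?thesis
        using p[of "- int N - 1" "- int N + k"] p[of "int N - 1" "int N + k"]
          p[of "- int N" "- int N + k - 1"] p[of "int N" "int N + k - 1"] by linarith
    qed
    have "norm (S N t - S N 0) \<le> \<epsilon> N * norm (t - 0)"
    proof (rule field_differentiable_bound[where S = "{-R..R}" and f' = ?d])
      show "convex {-R..R}" by simp
      show "(S N has_field_derivative ?d x) (at x within {-R..R})" if "x \<in> {-R..R}" for x
        by (rule has_field_derivative_at_within[OF der])
      show "norm (?d x) \<le> \<epsilon> N" if "x \<in> {-R..R}" for x using d[of x] that by auto
    qed (auto simp: R_def)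
    then show ?thesis by (simp add: R_def)
  qed
  have \<epsilon>: "\<epsilon> \<longlonglongrightarrow> 0"
  proof -
    have "(\<lambda>N. bessel_majorant R (int (N - 1))) \<longlonglongrightarrow> 0"
      using bessel_majorant_tendsto[OF R] LIMSEQ_offset[of "\<lambda>N. bessel_majorant R (int (N - 1))" 1] by simp
    moreover have "(\<lambda>N. bessel_majorant R (int (Suc N))) \<longlonglongrightarrow> 0" using LIMSEQ_Suc[OF bessel_majorant_tendsto[OF R]] .
    ultimately have "(\<lambda>N. C * exp (R\<^sup>2) * (bessel_majorant R (int (Suc N)) + 3 * bessel_majorant R (int N) + bessel_majorant R (int (N - 1)))) \<longlonglongrightarrow> C * exp (R\<^sup>2) * (0 + 3 * 0 + 0)"
      by (intro tendsto_intros bessel_majorant_tendsto[OF R])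
    then show ?thesis by (simp add: \<epsilon>_def[abs_def])
  qed
  have S0: "S N 0 = (if k = 0 then 1 else 0)" if "N \<ge> 1" for N
  proof -
    have "S N 0 = (\<Sum>n = - int N..<int N. if n = 0 then (if k = 0 then 1 else 0) else 0)"
      unfolding S_def by (intro sum.cong) (auto simp: bessel_0)
    then show ?thesis using that by (simp add: sum.delta)
  qed
  have sm: "(\<lambda>n. bessel n t * bessel (n + k) t) summable_on UNIV"
    using bessel_prod_summable[of 0 t k] by (simp add: add.commute)
  then obtain s where s: "((\<lambda>n. bessel n t * bessel (n + k) t) has_sum s) UNIV" by (auto simp: summable_on_def)
  have "(\<lambda>N. S N t) \<longlonglongrightarrow> s" unfolding S_def by (rule has_sum_int_interval[OF s])
  moreover have "(\<lambda>N. S N t) \<longlonglongrightarrow> (if k = 0 then 1 else 0)"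
  proof (rule Lim_transform[OF tendsto_const[of "if k = 0 then 1 else 0 :: real"]])
    have "(\<lambda>N. \<epsilon> N * R) \<longlonglongrightarrow> 0" using tendsto_mult_right[OF \<epsilon>, of R] by simp
    then show "(\<lambda>N. S N t - (if k = 0 then 1 else 0)) \<longlonglongrightarrow> 0"
      by (rule Lim_null_comparison[rotated])
        (use bound S0 in \<open>auto simp: eventually_sequentially intro!: exI[of _ 1]\<close>)
  qed
  ultimately have "s = (if k = 0 then 1 else 0)" by (rule LIMSEQ_unique)
  then show ?thesis using s by simp
qed

lemma bessel_orthonormal: "((\<lambda>k. bessel (c + k) t * bessel (d + k) t) has_sum (if c = d then 1 else 0)) UNIV"
proof -
  have "bij_betw (\<lambda>k::int. c + k) UNIV UNIV" by (rule bij_plus)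
  then have "((\<lambda>k. (\<lambda>n. bessel n t * bessel (n + (d - c)) t) (c + k)) has_sum (if d - c = 0 then 1 else 0)) UNIV"
    using has_sum_reindex_bij_betw[of "\<lambda>k. c + k" UNIV UNIV "\<lambda>n. bessel n t * bessel (n + (d - c)) t"]
      bessel_orthonormal_shift[of t "d - c"] by simp
  then show ?thesis by (simp add: algebra_simps eq_commute)
qed

lemma has_sum_sum:
  assumes "\<And>i. i \<in> I \<Longrightarrow> (f i has_sum S i) A"
  shows "((\<lambda>x. \<Sum>i\<in>I. f i x) has_sum (\<Sum>i\<in>I. S i :: 'a::{topological_comm_monoid_add})) A"
  using assms by (induction I rule: infinite_finite_induct) (auto intro!: has_sum_add)

lemma bessel_isometry:
  assumes "finite A"
  shows "((\<lambda>k. (\<Sum>c\<in>A. u c * bessel (c + k) t)\<^sup>2) has_sum (\<Sum>c\<in>A. (u c)\<^sup>2)) UNIV"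
proof -
  have "((\<lambda>k. \<Sum>c\<in>A. \<Sum>d\<in>A. u c * u d * (bessel (c + k) t * bessel (d + k) t)) has_sum
         (\<Sum>c\<in>A. \<Sum>d\<in>A. u c * u d * (if c = d then 1 else 0))) UNIV"
    by (intro has_sum_sum has_sum_cmult_right bessel_orthonormal)
  moreover have "(\<Sum>c\<in>A. \<Sum>d\<in>A. u c * u d * (if c = d then 1 else 0)) = (\<Sum>c\<in>A. (u c)\<^sup>2)"
  proof (intro sum.cong refl)
    fix c assume "c \<in> A"
    have "(\<Sum>d\<in>A. u c * u d * (if c = d then 1 else 0)) = (\<Sum>d\<in>A. if c = d then u c * u d else 0)"
      by (intro sum.cong) auto
    then show "(\<Sum>d\<in>A. u c * u d * (if c = d then 1 else 0)) = (u c)\<^sup>2"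
      using assms \<open>c \<in> A\<close> by (simp add: power2_eq_square)
  qed
  ultimately show ?thesis by (simp add: power2_eq_square sum_product mult_ac)
qed

section \<open>Truncated determinants\<close>

lemma fdet_transpose: "fdet n (\<lambda>i j. C j i) = fdet n C"
proof -
  have "Matrix.mat n n (\<lambda>(i,j). C j i) = transpose_mat (Matrix.mat n n (\<lambda>(i,j). C i j))"
    by (intro eq_matI) auto
  then show ?thesis unfolding fdet_def by (simp add: det_transpose[of _ n])
qed

text \<open>Read off from the rank-one formula: transposing a symmetric \<open>C\<close> minus y x^T
  exchanges \<open>x\<close> and \<open>y\<close>.\<close>

lemma adjform_commute:
  assumes "\<And>i j. C i j = C j i"
  shows "adjform n C x y = adjform n C y x"
proof -
  have "fdet n (\<lambda>i j. C i j - y i * x j) = fdet n (\<lambda>i j. C j i - y j * x i)"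
    by (rule fdet_transpose[symmetric])
  also have "\<dots> = fdet n (\<lambda>i j. C i j - x i * y j)"
    by (intro fdet_cong) (simp add: assms[of _ _] mult.commute)
  finally show ?thesis unfolding fdet_minus_rank_one by simp
qed

text \<open>The vector statement reduces to the scalar one by pairing with the increment y = v(t) -
  v(s) itself, which gives |y|^2 \<le> |y| B |t - s|.\<close>

lemma L2_set_mean_value:
  assumes der: "\<And>s i. i < n \<Longrightarrow> ((\<lambda>s. v s i) has_real_derivative v' s i) (at s)"
    and bound: "\<And>s. L2_set (v' s) {..<n} \<le> B"
  shows "L2_set (\<lambda>i. v t i - v s i) {..<n} \<le> B * \<bar>t - s\<bar>"
proof -
  define y where "y i = v t i - v s i" for i
  let ?N = "L2_set y {..<n}"
  have "((\<lambda>r. \<Sum>i<n. y i * v r i) has_real_derivative (\<Sum>i<n. y i * v' r i)) (at r within UNIV)" for r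
    by (auto intro!: DERIV_sum DERIV_cmult der)
  moreover have "norm (\<Sum>i<n. y i * v' r i) \<le> ?N * B" for r
  proof -
    have "\<bar>\<Sum>i<n. y i * v' r i\<bar> \<le> (\<Sum>i<n. \<bar>y i\<bar> * \<bar>v' r i\<bar>)"
      by (rule order_trans[OF sum_abs]) (simp add: abs_mult)
    also have "\<dots> \<le> ?N * L2_set (v' r) {..<n}" by (rule L2_set_mult_ineq)
    also have "\<dots> \<le> ?N * B" by (intro mult_left_mono bound L2_set_nonneg)
    finally show ?thesis by simp
  qed
  ultimately have "norm ((\<Sum>i<n. y i * v t i) - (\<Sum>i<n. y i * v s i)) \<le> ?N * B * norm (t - s)"
    by (intro field_differentiable_bound[where S = UNIV and f' = "\<lambda>r. \<Sum>i<n. y i * v' r i"]) auto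
  moreover have "(\<Sum>i<n. y i * v t i) - (\<Sum>i<n. y i * v s i) = ?N\<^sup>2"
    by (simp add: L2_set_def sum_nonneg flip: sum_subtractf right_diff_distrib)
      (simp add: y_def power2_eq_square)
  ultimately have *: "?N * ?N \<le> ?N * (B * \<bar>t - s\<bar>)" by (simp add: power2_eq_square mult.assoc)
  have "0 \<le> B" using bound[of 0] L2_set_nonneg[of "v' 0" "{..<n}"] by linarith
  then have "?N \<le> B * \<bar>t - s\<bar>" using * L2_set_nonneg[of y "{..<n}"]
    by (cases "?N = 0") (auto simp: mult_le_cancel_left)
  moreover have "(\<lambda>i. v t i - v s i) = y" by (simp add: y_def fun_eq_iff)
  ultimately show ?thesis by simp
qed

section \<open>Bessel vectors and the truncated matrices\<close>

definition weight :: "(int \<Rightarrow> real) \<Rightarrow> bool" where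
  "weight p \<longleftrightarrow> (\<forall>k. 0 \<le> p k \<and> p k \<le> 1)"

text \<open>Half-integers are coded by integers: \<open>bvec p t c k\<close> is $f_{c - 1/2}(k + 1/2)$ at $L = t$, with
  \<open>p k\<close> in the place of $\sigma(k + 1/2)$.\<close>
definition bvec :: "(int \<Rightarrow> real) \<Rightarrow> real \<Rightarrow> int \<Rightarrow> int \<Rightarrow> real" where
  "bvec p t c k = sqrt (p k) * bessel (c + k) t"

definition trunc_vec :: "nat \<Rightarrow> (int \<Rightarrow> real) \<Rightarrow> nat \<Rightarrow> real" where
  "trunc_vec n g i = g (int i - int n)"

abbreviation tbvec :: "(int \<Rightarrow> real) \<Rightarrow> nat \<Rightarrow> real \<Rightarrow> int \<Rightarrow> nat \<Rightarrow> real" where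
  "tbvec p n t c \<equiv> trunc_vec n (bvec p t c)"

lemma sum_trunc_vec: "(\<Sum>i<2*n. h (int i - int n)) = (\<Sum>k = - int n..<int n. h k)"
  by (rule sum.reindex_bij_witness[where i = "\<lambda>k. nat (k + int n)" and j = "\<lambda>i. int i - int n"]) auto

text \<open>Without weights and over all \<open>k\<close> this is an equality, by orthonormality.
  The factor sqrt p \<le> 1 and the restriction to \<open>B\<close> only decrease the norm.\<close>

lemma bvec_synthesis_le:
  assumes p: "weight p" and fin: "finite A" "finite B"
  shows "(\<Sum>k\<in>B. (\<Sum>c\<in>A. u c * bvec p t c k)\<^sup>2) \<le> (\<Sum>c\<in>A. (u c)\<^sup>2)"
proof -
  let ?g = "\<lambda>k. (\<Sum>c\<in>A. u c * bessel (c + k) t)\<^sup>2"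
  have "(\<Sum>k\<in>B. (\<Sum>c\<in>A. u c * bvec p t c k)\<^sup>2) \<le> (\<Sum>k\<in>B. ?g k)"
  proof (rule sum_mono)
    fix k
    have "(\<Sum>c\<in>A. u c * bvec p t c k) = sqrt (p k) * (\<Sum>c\<in>A. u c * bessel (c + k) t)"
      by (simp add: bvec_def sum_distrib_left mult_ac)
    then have "(\<Sum>c\<in>A. u c * bvec p t c k)\<^sup>2 = p k * ?g k"
      using p by (simp add: power_mult_distrib weight_def)
    then show "(\<Sum>c\<in>A. u c * bvec p t c k)\<^sup>2 \<le> ?g k"
      using p mult_right_mono[of "p k" 1 "?g k"] by (simp add: weight_def)
  qed
  also have "\<dots> \<le> (\<Sum>c\<in>A. (u c)\<^sup>2)"
  proof -
    have "?g summable_on UNIV" "infsum ?g UNIV = (\<Sum>c\<in>A. (u c)\<^sup>2)"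
      using bessel_isometry[OF fin(1), of u t] by (auto simp: has_sum_iff)
    then show ?thesis using finite_sum_le_infsum[of ?g UNIV B] fin by auto
  qed
  finally show ?thesis .
qed

text \<open>Pairing with the vectors is adjoint to synthesis, so it is contractive too;
  \<open>eq\<close> and Cauchy--Schwarz make the duality explicit.\<close>

lemma bvec_analysis_le:
  assumes p: "weight p" and fin: "finite A" "finite B"
  shows "(\<Sum>c\<in>A. (\<Sum>k\<in>B. bvec p t c k * y k)\<^sup>2) \<le> (\<Sum>k\<in>B. (y k)\<^sup>2)"
proof -
  define u where "u c = (\<Sum>k\<in>B. bvec p t c k * y k)" for c
  define U where "U = (\<Sum>c\<in>A. (u c)\<^sup>2)"
  have U0: "U \<ge> 0" by (simp add: U_def sum_nonneg)
  have "U = (\<Sum>c\<in>A. \<Sum>k\<in>B. u c * (bvec p t c k * y k))"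
    by (simp add: U_def power2_eq_square u_def sum_distrib_left)
  also have "\<dots> = (\<Sum>k\<in>B. (\<Sum>c\<in>A. u c * bvec p t c k) * y k)"
    by (subst sum.swap) (simp add: sum_distrib_right mult.assoc)
  finally have eq: "U = (\<Sum>k\<in>B. (\<Sum>c\<in>A. u c * bvec p t c k) * y k)" .
  have "U\<^sup>2 \<le> (\<Sum>k\<in>B. (\<Sum>c\<in>A. u c * bvec p t c k)\<^sup>2) * (\<Sum>k\<in>B. (y k)\<^sup>2)"
    unfolding eq by (rule Cauchy_Schwarz_ineq_sum)
  also have "\<dots> \<le> U * (\<Sum>k\<in>B. (y k)\<^sup>2)"
    unfolding U_def by (intro mult_right_mono bvec_synthesis_le p fin sum_nonneg) auto
  finally have "U * U \<le> U * (\<Sum>k\<in>B. (y k)\<^sup>2)" by (simp add: power2_eq_square)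
  then have "U \<le> (\<Sum>k\<in>B. (y k)\<^sup>2)"
    using U0 by (cases "U = 0") (auto simp: sum_nonneg)
  then show ?thesis by (simp add: U_def u_def)
qed

lemma bvec_norm_le: "weight p \<Longrightarrow> finite B \<Longrightarrow> (\<Sum>k\<in>B. (bvec p t c k)\<^sup>2) \<le> 1"
  using bvec_synthesis_le[of p "{c}" B "\<lambda>_. 1" t] by simp

lemma L2_trunc_vec: "L2_set (trunc_vec n g) {..<2*n} = sqrt (\<Sum>k = - int n..<int n. (g k)\<^sup>2)"
  unfolding L2_set_def trunc_vec_def by (simp add: sum_trunc_vec[of "\<lambda>k. (g k)\<^sup>2"])

lemma L2_tbvec_le_1: "weight p \<Longrightarrow> L2_set (tbvec p n t c) {..<2*n} \<le> 1"
  by (simp add: L2_trunc_vec bvec_norm_le)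

lemma tbvec_has_derivative:
  "((\<lambda>t. tbvec p n t c i) has_real_derivative tbvec p n t (c - 1) i - tbvec p n t (c + 1) i) (at t)"
proof -
  let ?k = "int i - int n"
  have "((\<lambda>t. sqrt (p ?k) * bessel (c + ?k) t) has_real_derivative
      sqrt (p ?k) * (bessel (c + ?k - 1) t - bessel (c + ?k + 1) t)) (at t)"
    by (intro DERIV_cmult bessel_has_derivative)
  moreover have "c + ?k - 1 = c - 1 + ?k" "c + ?k + 1 = c + 1 + ?k" by auto
  ultimately show ?thesis unfolding trunc_vec_def bvec_def by (simp only: right_diff_distrib)
qed

text \<open>The cutoffs are $-n \<le> k < n$ and $S < c \<le> 3n$: on this window the vector at the upper end
  $c = 3n$ only involves Bessel functions of order at least $2n$, so the boundary term of the
  telescoping sum below is negligible.\<close>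
definition trunc_mat :: "(int \<Rightarrow> real) \<Rightarrow> nat \<Rightarrow> int \<Rightarrow> real \<Rightarrow> nat \<Rightarrow> nat \<Rightarrow> real" where
  "trunc_mat p n S t = defect (tbvec p n t) {S<..3 * int n}"

lemma contraction_trunc_mat: "weight p \<Longrightarrow> contraction (2*n) (trunc_mat p n S t)"
  unfolding trunc_mat_def
proof (rule contraction_defect)
  fix u assume "weight p"
  have "(\<Sum>k<2*n. (\<Sum>c\<in>{S<..3 * int n}. u c * tbvec p n t c k)\<^sup>2)
      = (\<Sum>k = - int n..<int n. (\<Sum>c\<in>{S<..3 * int n}. u c * bvec p t c k)\<^sup>2)"
    unfolding trunc_vec_def by (rule sum_trunc_vec)
  also have "\<dots> \<le> (\<Sum>c\<in>{S<..3 * int n}. (u c)\<^sup>2)"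
    by (rule bvec_synthesis_le[OF \<open>weight p\<close>]) auto
  finally show "(\<Sum>k<2*n. (\<Sum>c\<in>{S<..3 * int n}. u c * tbvec p n t c k)\<^sup>2) \<le> (\<Sum>c\<in>{S<..3 * int n}. (u c)\<^sup>2)" .
qed

lemma trunc_mat_sym: "trunc_mat p n S t i j = trunc_mat p n S t j i"
  unfolding trunc_mat_def by (rule defect_sym)

lemma adjform_trunc_mat_bound:
  "weight p \<Longrightarrow> \<bar>adjform (2*n) (trunc_mat p n S t) x y\<bar> \<le> 7 * L2_set x {..<2*n} * L2_set y {..<2*n}"
  by (intro adjform_bound contraction_trunc_mat trunc_mat_sym)

definition trunc_det :: "(int \<Rightarrow> real) \<Rightarrow> nat \<Rightarrow> int \<Rightarrow> real \<Rightarrow> real" where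
  "trunc_det p n S t = fdet (2*n) (trunc_mat p n S t)"

lemma sum_telescope_Ioc:
  fixes u :: "int \<Rightarrow> 'a::ab_group_add"
  assumes "a \<le> b"
  shows "(\<Sum>c\<in>{a<..b}. u (c - 1) - u c) = u a - u b"
  using assms
proof (induction b rule: int_ge_induct)
  case (step b)
  have "{a<..b + 1} = insert (b + 1) {a<..b}" using step by auto
  then show ?case using step by (simp add: algebra_simps)
qed simp

text \<open>With f_c' = f_(c-1) - f_(c+1), the derivative of f_c f_c^T is u(c-1) - u(c) for u(c) =
  f_c f_(c+1)^T + f_(c+1) f_c^T, so only the two ends of the window remain.\<close>

lemma synthesis_has_derivative:
  assumes "S \<le> T"
  shows "((\<lambda>t. \<Sum>c\<in>{S<..T}. tbvec p n t c i * tbvec p n t c j) has_real_derivative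
     (tbvec p n t S i * tbvec p n t (S + 1) j + tbvec p n t (S + 1) i * tbvec p n t S j)
     - (tbvec p n t T i * tbvec p n t (T + 1) j + tbvec p n t (T + 1) i * tbvec p n t T j)) (at t)"
proof -
  let ?F = "tbvec p n t"
  let ?u = "\<lambda>c. ?F c i * ?F (c + 1) j + ?F (c + 1) i * ?F c j"
  have "((\<lambda>t. \<Sum>c\<in>{S<..T}. tbvec p n t c i * tbvec p n t c j) has_real_derivative
     (\<Sum>c\<in>{S<..T}. ?F c i * (?F (c - 1) j - ?F (c + 1) j) + (?F (c - 1) i - ?F (c + 1) i) * ?F c j)) (at t)"
    by (intro DERIV_sum DERIV_mult' tbvec_has_derivative)
  also have "(\<Sum>c\<in>{S<..T}. ?F c i * (?F (c - 1) j - ?F (c + 1) j) + (?F (c - 1) i - ?F (c + 1) i) * ?F c j)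
     = (\<Sum>c\<in>{S<..T}. ?u (c - 1) - ?u c)"
    by (intro sum.cong) (auto simp: algebra_simps)
  also have "\<dots> = ?u S - ?u T" by (rule sum_telescope_Ioc[OF assms])
  finally show ?thesis .
qed

text \<open>Jacobi's formula applied to the two boundary terms. The factors 2 come from symmetry,
  and the second summand belongs to the upper end of the window.\<close>

definition trunc_det' :: "(int \<Rightarrow> real) \<Rightarrow> nat \<Rightarrow> int \<Rightarrow> real \<Rightarrow> real" where
  "trunc_det' p n S t = - 2 * adjform (2*n) (trunc_mat p n S t) (tbvec p n t (S + 1)) (tbvec p n t S)
     + 2 * adjform (2*n) (trunc_mat p n S t) (tbvec p n t (3 * int n + 1)) (tbvec p n t (3 * int n))"

lemma trunc_det_has_derivative:
  assumes S: "S \<le> 3 * int n"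
  shows "(trunc_det p n S has_real_derivative trunc_det' p n S t) (at t)"
proof -
  let ?T = "3 * int n" and ?F = "tbvec p n t" and ?C = "trunc_mat p n S t"
  let ?d = "\<lambda>i j. - ((?F S i * ?F (S + 1) j + ?F (S + 1) i * ?F S j) - (?F ?T i * ?F (?T + 1) j + ?F (?T + 1) i * ?F ?T j))"
  have "((\<lambda>t. trunc_mat p n S t i j) has_real_derivative ?d i j) (at t)" for i j
    using DERIV_diff[OF DERIV_const[of "if i = j then 1 else 0"] synthesis_has_derivative[OF S]]
    unfolding trunc_mat_def defect_def by simp
  then have "((\<lambda>t. fdet (2*n) (trunc_mat p n S t)) has_real_derivative (\<Sum>i<2*n. \<Sum>j<2*n. ?d i j * fcof (2*n) ?C i j)) (at t)"
    by (intro fdet_has_derivative)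
  moreover have "(\<Sum>i<2*n. \<Sum>j<2*n. ?d i j * fcof (2*n) ?C i j)
     = - adjform (2*n) ?C (?F (S + 1)) (?F S) - adjform (2*n) ?C (?F S) (?F (S + 1))
       + adjform (2*n) ?C (?F (?T + 1)) (?F ?T) + adjform (2*n) ?C (?F ?T) (?F (?T + 1))"
    unfolding adjform_def by (simp add: algebra_simps sum.distrib sum_subtractf sum_negf)
  moreover have "\<dots> = trunc_det' p n S t"
    unfolding trunc_det'_def
    by (simp add: adjform_commute[of ?C _ "?F S" "?F (S + 1)", OF trunc_mat_sym]
        adjform_commute[of ?C _ "?F ?T" "?F (?T + 1)", OF trunc_mat_sym])
  ultimately show ?thesis unfolding trunc_det_def[abs_def] by simp
qed

lemma has_sum_Ioc:
  fixes f :: "int \<Rightarrow> 'a::topological_comm_monoid_add"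
  assumes "(f has_sum x) {S<..}"
  shows "(\<lambda>n. \<Sum>c\<in>{S<..3 * int n}. f c) \<longlonglongrightarrow> x"
proof -
  have "filterlim (\<lambda>n. {S<..3 * int n}) (finite_subsets_at_top {S<..}) sequentially"
    unfolding filterlim_finite_subsets_at_top
  proof (intro allI impI)
    fix X :: "int set" assume X: "finite X \<and> X \<subseteq> {S<..}"
    have "\<forall>\<^sub>F n in sequentially. \<forall>x\<in>X. x \<le> 3 * int n"
    proof (rule eventually_ball_finite)
      show "\<forall>x\<in>X. \<forall>\<^sub>F n in sequentially. x \<le> 3 * int n"
      proof
        fix x assume "x \<in> X"
        show "\<forall>\<^sub>F n in sequentially. x \<le> 3 * int n"
          using eventually_ge_at_top[of "nat \<bar>x\<bar>"] by eventually_elim auto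
      qed
    qed (use X in auto)
    then show "\<forall>\<^sub>F n in sequentially. finite {S<..3 * int n} \<and> X \<subseteq> {S<..3 * int n} \<and> {S<..3 * int n} \<subseteq> {S<..}"
      by eventually_elim (use X in auto)
  qed
  with assms show ?thesis unfolding has_sum_def by (rule filterlim_compose)
qed

section \<open>The resolvent equation and its truncations\<close>

definition coef :: "(int \<Rightarrow> real) \<Rightarrow> real \<Rightarrow> (int \<Rightarrow> real) \<Rightarrow> nat \<Rightarrow> int \<Rightarrow> real" where
  "coef p t G n c = (\<Sum>k = - int n..<int n. bvec p t c k * G k)"

lemma coef_trunc_vec: "coef p t G n c = (\<Sum>i<2*n. tbvec p n t c i * trunc_vec n G i)"
  unfolding coef_def trunc_vec_def by (rule sum_trunc_vec[symmetric])

text \<open>\<open>g c\<close> is the pairing of the \<open>c\<close>-th Bessel vector with \<open>G\<close>, and the last condition says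
  $(1 - M) G = \tau f_S$ for $M = \sum_{c > S} f_c f_c^T$.\<close>
definition resolvent_eq :: "(int \<Rightarrow> real) \<Rightarrow> real \<Rightarrow> int \<Rightarrow> real \<Rightarrow> (int \<Rightarrow> real) \<Rightarrow> (int \<Rightarrow> real) \<Rightarrow> bool" where
  "resolvent_eq p t S \<tau> G g \<longleftrightarrow>
     (\<lambda>k. (G k)\<^sup>2) summable_on UNIV \<and>
     (\<forall>c. (\<lambda>n. coef p t G n c) \<longlonglongrightarrow> g c) \<and>
     (\<forall>k. ((\<lambda>c. g c * bvec p t c k) has_sum (G k - \<tau> * bvec p t S k)) {S<..})"

text \<open>The error committed when the resolvent equation is cut to the window: \<open>G\<close>
  enters only through its coordinates in [-n, n), and the sum over \<open>c\<close> stops at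
  3n.\<close>

definition resid :: "(int \<Rightarrow> real) \<Rightarrow> real \<Rightarrow> int \<Rightarrow> real \<Rightarrow> (int \<Rightarrow> real) \<Rightarrow> nat \<Rightarrow> int \<Rightarrow> real" where
  "resid p t S \<tau> G n k = G k - \<tau> * bvec p t S k - (\<Sum>c\<in>{S<..3 * int n}. coef p t G n c * bvec p t c k)"

lemma sum_trunc_mat_G:
  assumes "i < 2 * n"
  shows "(\<Sum>j<2*n. trunc_mat p n S t i j * trunc_vec n G j) = \<tau> * tbvec p n t S i + trunc_vec n (resid p t S \<tau> G n) i"
  unfolding trunc_mat_def sum_defect[OF assms] coef_trunc_vec[symmetric] by (simp add: trunc_vec_def resid_def mult.commute)

text \<open>The residual is itself a synthesis of Bessel vectors. Its coefficients are the errors g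
  - \<open>coef\<close> for c up to 3n and g beyond. Contractivity of synthesis and analysis bounds
  its squared norm by the tail of the norm of \<open>G\<close> plus the tail of the norm of
  \<open>g\<close>.\<close>

lemma resid_tendsto:
  assumes p: "weight p" and res: "resolvent_eq p t S \<tau> G g"
  shows "(\<lambda>n. L2_set (trunc_vec n (resid p t S \<tau> G n)) {..<2*n}) \<longlonglongrightarrow> 0"
proof -
  define V where "V = infsum (\<lambda>k. (G k)\<^sup>2) UNIV"
  define Vn where "Vn n = (\<Sum>k = - int n..<int n. (G k)\<^sup>2)" for n
  have Gs: "(\<lambda>k. (G k)\<^sup>2) summable_on UNIV" and gl: "\<And>c. (\<lambda>n. coef p t G n c) \<longlonglongrightarrow> g c"
    and eq: "\<And>k. ((\<lambda>c. g c * bvec p t c k) has_sum (G k - \<tau> * bvec p t S k)) {S<..}"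
    using res by (auto simp: resolvent_eq_def)
  have Vn_lim: "Vn \<longlonglongrightarrow> V"
    unfolding Vn_def[abs_def] V_def by (rule has_sum_int_interval) (rule has_sum_infsum[OF Gs])
  have Vn_le: "Vn n \<le> V" for n
    unfolding Vn_def V_def by (rule finite_sum_le_infsum[OF Gs]) auto
  \<comment> \<open>The difference of two coefficients pairs the Bessel vector with the part of
    \<open>G\<close> between the two cutoffs, so \<open>bvec_analysis_le\<close> applies to that
    part.\<close>
  have coef_diff: "(\<Sum>c\<in>A. (coef p t G m c - coef p t G n c)\<^sup>2) \<le> V - Vn n" if "m \<ge> n" "finite A" for m n A
  proof -
    let ?B = "{- int m..<int m} - {- int n..<int n}"
    have sub: "{- int n..<int n} \<subseteq> {- int m..<int m}" using that by auto
    have "coef p t G m c - coef p t G n c = (\<Sum>k\<in>?B. bvec p t c k * G k)" for c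
      unfolding coef_def using sub by (subst sum_diff) auto
    then have "(\<Sum>c\<in>A. (coef p t G m c - coef p t G n c)\<^sup>2) \<le> (\<Sum>k\<in>?B. (G k)\<^sup>2)"
      using bvec_analysis_le[OF p that(2), of ?B t G] by simp
    also have "\<dots> = Vn m - Vn n" unfolding Vn_def using sub by (subst sum_diff) auto
    finally show ?thesis using Vn_le[of m] by linarith
  qed
  have g_diff: "(\<Sum>c\<in>A. (g c - coef p t G n c)\<^sup>2) \<le> V - Vn n" if "finite A" for n A
  proof (rule LIMSEQ_le_const2)
    show "(\<lambda>m. \<Sum>c\<in>A. (coef p t G m c - coef p t G n c)\<^sup>2) \<longlonglongrightarrow> (\<Sum>c\<in>A. (g c - coef p t G n c)\<^sup>2)"
      by (intro tendsto_intros gl)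
    show "\<exists>N. \<forall>m\<ge>N. (\<Sum>c\<in>A. (coef p t G m c - coef p t G n c)\<^sup>2) \<le> V - Vn n"
      using coef_diff that by blast
  qed
  \<comment> \<open>For n = 0 the truncated coefficients are empty sums, and the estimate becomes
    Bessel's inequality for \<open>g\<close>.\<close>
  have g_sq: "(\<Sum>c\<in>A. (g c)\<^sup>2) \<le> V" if "finite A" for A
    using g_diff[OF that, of 0] by (simp add: coef_def Vn_def)
  have gs: "(\<lambda>c. (g c)\<^sup>2) summable_on {S<..}"
    by (rule nonneg_bdd_above_summable_on) (use g_sq in \<open>auto intro!: bdd_aboveI\<close>)
  define W where "W = infsum (\<lambda>c. (g c)\<^sup>2) {S<..}"
  define Wn where "Wn n = (\<Sum>c\<in>{S<..3 * int n}. (g c)\<^sup>2)" for n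
  have Wn_lim: "Wn \<longlonglongrightarrow> W"
    unfolding Wn_def[abs_def] W_def by (rule has_sum_Ioc) (rule has_sum_infsum[OF gs])
  have Wn_le: "Wn n \<le> W" for n
    unfolding Wn_def W_def by (rule finite_sum_le_infsum[OF gs]) auto
  have bound: "(\<Sum>k = - int n..<int n. (resid p t S \<tau> G n k)\<^sup>2) \<le> (V - Vn n) + (W - Wn n)" for n
  proof -
    \<comment> \<open>These are the coefficients of the residual. The partial sums
      \<open>s m\<close> converge to it by the resolvent equation, while their norms are bounded
      uniformly in \<open>m\<close>.\<close>
    define u where "u c = g c - (if c \<le> 3 * int n then coef p t G n c else 0)" for c
    define s where "s m k = (\<Sum>c\<in>{S<..3 * int m}. u c * bvec p t c k)" for m k
    have split: "(\<Sum>c\<in>{S<..3 * int m}. h c) = (\<Sum>c\<in>{S<..3 * int n}. h c) + (\<Sum>c\<in>{S<..3 * int m} - {S<..3 * int n}. h c)"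
      if "m \<ge> n" for m and h :: "int \<Rightarrow> real"
      using that by (subst sum.subset_diff[of "{S<..3 * int n}"]) auto
    have le: "(\<Sum>k = - int n..<int n. (s m k)\<^sup>2) \<le> (V - Vn n) + (W - Wn n)" if "m \<ge> n" for m
    proof -
      have "(\<Sum>k = - int n..<int n. (s m k)\<^sup>2) \<le> (\<Sum>c\<in>{S<..3 * int m}. (u c)\<^sup>2)"
        unfolding s_def by (rule bvec_synthesis_le[OF p]) auto
      also have "\<dots> = (\<Sum>c\<in>{S<..3 * int n}. (g c - coef p t G n c)\<^sup>2) + (\<Sum>c\<in>{S<..3 * int m} - {S<..3 * int n}. (g c)\<^sup>2)"
        unfolding split[OF that] by (intro arg_cong2[where f = "(+)"] sum.cong) (auto simp: u_def)
      also have "(\<Sum>c\<in>{S<..3 * int m} - {S<..3 * int n}. (g c)\<^sup>2) = Wn m - Wn n"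
        unfolding Wn_def using split[OF that, of "\<lambda>c. (g c)\<^sup>2"] by simp
      finally show ?thesis using g_diff[of "{S<..3 * int n}" n] Wn_le[of m] by simp
    qed
    have lim: "(\<lambda>m. s m k) \<longlonglongrightarrow> resid p t S \<tau> G n k" for k
    proof -
      have "(\<lambda>m. (\<Sum>c\<in>{S<..3 * int m}. g c * bvec p t c k) - (\<Sum>c\<in>{S<..3 * int n}. coef p t G n c * bvec p t c k))
          \<longlonglongrightarrow> (G k - \<tau> * bvec p t S k) - (\<Sum>c\<in>{S<..3 * int n}. coef p t G n c * bvec p t c k)"
        by (intro tendsto_diff has_sum_Ioc[OF eq] tendsto_const)
      moreover have "\<forall>\<^sub>F m in sequentially. (\<Sum>c\<in>{S<..3 * int m}. g c * bvec p t c k) - (\<Sum>c\<in>{S<..3 * int n}. coef p t G n c * bvec p t c k) = s m k"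
        using eventually_ge_at_top[of n]
      proof eventually_elim
        case (elim m)
        have "s m k = (\<Sum>c\<in>{S<..3 * int m}. g c * bvec p t c k) - (\<Sum>c\<in>{S<..3 * int m}. (if c \<le> 3 * int n then coef p t G n c else 0) * bvec p t c k)"
          unfolding s_def u_def by (simp add: left_diff_distrib sum_subtractf)
        also have "(\<Sum>c\<in>{S<..3 * int m}. (if c \<le> 3 * int n then coef p t G n c else 0) * bvec p t c k)
            = (\<Sum>c\<in>{S<..3 * int n}. coef p t G n c * bvec p t c k)"
          by (rule sum.mono_neutral_cong_right) (use elim in auto)
        finally show ?case by simp
      qed
      ultimately show ?thesis unfolding resid_def by (rule Lim_transform_eventually)
    qed
    show ?thesis
    proof (rule LIMSEQ_le_const2)
      show "(\<lambda>m. \<Sum>k = - int n..<int n. (s m k)\<^sup>2) \<longlonglongrightarrow> (\<Sum>k = - int n..<int n. (resid p t S \<tau> G n k)\<^sup>2)"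
        by (intro tendsto_intros lim)
      show "\<exists>N. \<forall>m\<ge>N. (\<Sum>k = - int n..<int n. (s m k)\<^sup>2) \<le> (V - Vn n) + (W - Wn n)" using le by blast
    qed
  qed
  have "(\<lambda>n. sqrt ((V - Vn n) + (W - Wn n))) \<longlonglongrightarrow> sqrt ((V - V) + (W - W))"
    by (intro tendsto_intros Vn_lim Wn_lim)
  then have "(\<lambda>n. sqrt ((V - Vn n) + (W - Wn n))) \<longlonglongrightarrow> 0" by simp
  then show ?thesis
    by (rule Lim_null_comparison[rotated]) (use bound in \<open>simp add: L2_trunc_vec sum_nonneg\<close>)
qed

text \<open>Apply \<open>adjform_range\<close> to the truncated \<open>G\<close>, whose image under
  the truncated matrix is \<tau> f_S plus the residual.\<close>

lemma adjform_source:
  "\<tau> * adjform (2*n) (trunc_mat p n S t) x (tbvec p n t S) =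
     trunc_det p n S t * (\<Sum>i<2*n. x i * trunc_vec n G i) - adjform (2*n) (trunc_mat p n S t) x (trunc_vec n (resid p t S \<tau> G n))"
proof -
  have "trunc_det p n S t * (\<Sum>i<2*n. x i * trunc_vec n G i) = adjform (2*n) (trunc_mat p n S t) x (\<lambda>i. \<Sum>j<2*n. trunc_mat p n S t i j * trunc_vec n G j)"
    unfolding trunc_det_def adjform_range ..
  also have "\<dots> = adjform (2*n) (trunc_mat p n S t) x (\<lambda>i. \<tau> * tbvec p n t S i + trunc_vec n (resid p t S \<tau> G n) i)"
    by (intro adjform_cong sum_trunc_mat_G) auto
  also have "\<dots> = \<tau> * adjform (2*n) (trunc_mat p n S t) x (tbvec p n t S) + adjform (2*n) (trunc_mat p n S t) x (trunc_vec n (resid p t S \<tau> G n))"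
    unfolding adjform_add_right using adjform_scale[of "2*n" "trunc_mat p n S t" 1 x \<tau> "tbvec p n t S"] by simp
  finally show ?thesis by simp
qed

lemma adjform_source_tendsto:
  assumes p: "weight p" and res: "resolvent_eq p t S \<tau> G g" and q: "(\<lambda>n. trunc_det p n S t) \<longlonglongrightarrow> q"
  shows "(\<lambda>n. \<tau> * adjform (2*n) (trunc_mat p n S t) (tbvec p n t c) (tbvec p n t S)) \<longlonglongrightarrow> q * g c"
proof -
  have "(\<lambda>n. adjform (2*n) (trunc_mat p n S t) (tbvec p n t c) (trunc_vec n (resid p t S \<tau> G n))) \<longlonglongrightarrow> 0"
  proof (rule Lim_null_comparison)
    show "(\<lambda>n. 7 * L2_set (trunc_vec n (resid p t S \<tau> G n)) {..<2*n}) \<longlonglongrightarrow> 0"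
      using tendsto_mult_right[OF resid_tendsto[OF p res], of 7] by simp
    have "\<bar>adjform (2*n) (trunc_mat p n S t) (tbvec p n t c) (trunc_vec n (resid p t S \<tau> G n))\<bar> \<le> 7 * L2_set (trunc_vec n (resid p t S \<tau> G n)) {..<2*n}" for n
      using adjform_trunc_mat_bound[OF p, of n S t "tbvec p n t c" "trunc_vec n (resid p t S \<tau> G n)"]
        mult_right_mono[OF L2_tbvec_le_1[OF p, of n t c], of "7 * L2_set (trunc_vec n (resid p t S \<tau> G n)) {..<2*n}"]
      by (simp add: L2_set_nonneg mult_ac)
    then show "\<forall>\<^sub>F n in sequentially. norm (adjform (2*n) (trunc_mat p n S t) (tbvec p n t c) (trunc_vec n (resid p t S \<tau> G n)))
       \<le> 7 * L2_set (trunc_vec n (resid p t S \<tau> G n)) {..<2*n}" by simp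
  qed
  moreover have "(\<lambda>n. coef p t G n c) \<longlonglongrightarrow> g c" using res by (simp add: resolvent_eq_def)
  ultimately have "(\<lambda>n. trunc_det p n S t * coef p t G n c - adjform (2*n) (trunc_mat p n S t) (tbvec p n t c) (trunc_vec n (resid p t S \<tau> G n))) \<longlonglongrightarrow> q * g c - 0"
    by (intro tendsto_intros q)
  then show ?thesis by (simp add: adjform_source[where G = G] coef_trunc_vec)
qed

lemma trunc_det_pred:
  assumes "S \<le> 3 * int n"
  shows "trunc_det p n (S - 1) t = trunc_det p n S t - adjform (2*n) (trunc_mat p n S t) (tbvec p n t S) (tbvec p n t S)"
proof -
  have "{S - 1<..3 * int n} = insert S {S<..3 * int n}" using assms by auto
  then have "trunc_mat p n (S - 1) t i j = trunc_mat p n S t i j - tbvec p n t S i * tbvec p n t S j" for i j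
    unfolding trunc_mat_def defect_def by simp
  then show ?thesis unfolding trunc_det_def fdet_minus_rank_one[symmetric] by (intro fdet_cong)
qed

lemma trunc_det_pred_tendsto:
  assumes p: "weight p" and res: "resolvent_eq p t S 1 G g" and q: "(\<lambda>n. trunc_det p n S t) \<longlonglongrightarrow> q"
  shows "(\<lambda>n. trunc_det p n (S - 1) t) \<longlonglongrightarrow> q * (1 - g S)"
proof -
  have "(\<lambda>n. trunc_det p n S t - adjform (2*n) (trunc_mat p n S t) (tbvec p n t S) (tbvec p n t S)) \<longlonglongrightarrow> q - q * g S"
    using adjform_source_tendsto[OF p res q, of S] by (intro tendsto_diff q) simp
  moreover have "\<forall>\<^sub>F n in sequentially. trunc_det p n S t - adjform (2*n) (trunc_mat p n S t) (tbvec p n t S) (tbvec p n t S) = trunc_det p n (S - 1) t"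
    using eventually_ge_at_top[of "nat \<bar>S\<bar>"] by eventually_elim (simp add: trunc_det_pred)
  ultimately show ?thesis by (simp add: right_diff_distrib Lim_transform_eventually)
qed

text \<open>For \<tau> = 0 the left side of \<open>adjform_source_tendsto\<close> is identically
  zero. This does the work of injectivity of 1 - M when \<open>q\<close> is nonzero.\<close>

lemma homogeneous_pairing_zero:
  assumes p: "weight p" and res: "resolvent_eq p t S 0 G g" and q: "(\<lambda>n. trunc_det p n S t) \<longlonglongrightarrow> q"
  shows "q * g c = 0"
  using adjform_source_tendsto[OF p res q, of c] by (simp add: LIMSEQ_const_iff)

section \<open>The derivative of the limiting determinant\<close>

lemma boundary_tendsto:
  assumes p: "weight p" and R: "R \<ge> 0"
  obtains \<eta> where "\<eta> \<longlonglongrightarrow> 0" "\<And>n t. \<bar>t\<bar> \<le> R \<Longrightarrow> L2_set (tbvec p n t (3 * int n)) {..<2*n} \<le> \<eta> n"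
proof -
  define s where "s n = (\<Sum>m<n. R ^ m / fact m)" for n
  define C where "C = (exp (R\<^sup>2))\<^sup>2 * exp R"
  \<comment> \<open>On the window the orders 3n + k run from 2n to 4n - 1, so the squared norm is
    controlled by a difference of two partial sums of exp R, uniformly for |t| \<le> R.\<close>
  define \<eta> where "\<eta> n = sqrt (C * (s (4*n) - s (2*n)))" for n
  have s: "s \<longlonglongrightarrow> exp R" using exp_series[of R] unfolding s_def[abs_def] sums_def .
  have s4: "(\<lambda>n. s (4 * n)) \<longlonglongrightarrow> exp R" and s2: "(\<lambda>n. s (2 * n)) \<longlonglongrightarrow> exp R"
    by (rule LIMSEQ_subseq_LIMSEQ[OF s, unfolded o_def]; simp add: strict_mono_def)+
  have "(\<lambda>n. sqrt (C * (s (4*n) - s (2*n)))) \<longlonglongrightarrow> sqrt (C * (exp R - exp R))"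
    by (intro tendsto_intros s4 s2)
  then have lim: "\<eta> \<longlonglongrightarrow> 0" by (simp add: \<eta>_def[abs_def])
  moreover have "L2_set (tbvec p n t (3 * int n)) {..<2*n} \<le> \<eta> n" if t: "\<bar>t\<bar> \<le> R" for n t
  proof -
    have summand: "(bvec p t c k)\<^sup>2 \<le> C * bessel_majorant R (c + k)" for c k
    proof -
      have "(bvec p t c k)\<^sup>2 = p k * (bessel (c + k) t)\<^sup>2" using p by (simp add: bvec_def power_mult_distrib weight_def)
      also have "\<dots> \<le> (bessel (c + k) t)\<^sup>2" using p mult_right_mono[of "p k" 1] by (simp add: weight_def)
      also have "\<dots> \<le> (exp (R\<^sup>2))\<^sup>2 * exp R * bessel_majorant R (c + k)" by (rule bessel_sq_le[OF t])
      finally show ?thesis by (simp add: C_def)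
    qed
    have "(\<Sum>k = - int n..<int n. (bvec p t (3 * int n) k)\<^sup>2) \<le> (\<Sum>k = - int n..<int n. C * bessel_majorant R (3 * int n + k))"
      by (intro sum_mono summand)
    also have "\<dots> = C * (\<Sum>m = 2*n..<4*n. R ^ m / fact m)"
      unfolding sum_distrib_left
      by (rule sum.reindex_bij_witness[where i = "\<lambda>m. int m - 3 * int n" and j = "\<lambda>k. nat (k + 3 * int n)"])
        (auto simp: bessel_majorant_def algebra_simps)
    also have "(\<Sum>m = 2*n..<4*n. R ^ m / fact m) = s (4*n) - s (2*n)"
      unfolding s_def using sum_diff_nat_ivl[of 0 "2*n" "4*n" "\<lambda>m. R ^ m / fact m"] by (simp add: atLeast0LessThan)
    finally show ?thesis by (simp add: L2_trunc_vec \<eta>_def)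
  qed
  ultimately show ?thesis using that by blast
qed

lemma abs_inner_le: "\<bar>\<Sum>i<n. x i * y i\<bar> \<le> L2_set x {..<n} * L2_set y {..<n}"
  using L2_set_mult_ineq[of x y "{..<n}"] sum_abs[of "\<lambda>i. x i * y i" "{..<n}"] by (simp add: abs_mult)

lemma L2_set_minus: "L2_set (\<lambda>i. - x i) A = L2_set x A"
  by (simp add: L2_set_def)

lemma L2_set_scale: "L2_set (\<lambda>i. a * x i) A = \<bar>a\<bar> * L2_set x A"
  by (simp add: L2_set_def power_mult_distrib real_sqrt_mult flip: sum_distrib_left)

text \<open>Both adjugate forms in \<open>trunc_det'\<close> involve vectors of norm at most 1 and
  are bounded by 7, whence 28 = 2 * 7 + 2 * 7 for every \<open>n\<close>.\<close>

lemma trunc_det_Lipschitz: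
  assumes p: "weight p" and S: "S \<le> 3 * int n"
  shows "\<bar>trunc_det p n S t - trunc_det p n S s\<bar> \<le> 28 * \<bar>t - s\<bar>"
proof -
  have adj: "\<bar>adjform (2*n) (trunc_mat p n S r) (tbvec p n r c) (tbvec p n r d)\<bar> \<le> 7" for r c d
    using adjform_trunc_mat_bound[OF p, of n S r "tbvec p n r c" "tbvec p n r d"]
      mult_mono[OF L2_tbvec_le_1[OF p, of n r c] L2_tbvec_le_1[OF p, of n r d]] by (simp add: L2_set_nonneg)
  have "\<bar>trunc_det' p n S r\<bar> \<le> 28" for r
    unfolding trunc_det'_def using adj[of r "S + 1" S] adj[of r "3 * int n + 1" "3 * int n"] by linarith
  then have "norm (trunc_det p n S t - trunc_det p n S s) \<le> 28 * norm (t - s)"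
    by (intro field_differentiable_bound[where S = UNIV and f' = "trunc_det' p n S"])
      (auto intro: trunc_det_has_derivative[OF S])
  then show ?thesis by simp
qed

text \<open>\<open>G\<close> solves the equation at \<open>s\<close>, hence approximately at
  \<open>t\<close>: the error \<open>w\<close> has norm at most 2h + |resid| + 4vh with h = |t - s|.
  An adjugate form costs a factor 7 and is doubled, giving 28h + 56vh plus 14 times the residual.
  The product of determinant and coefficient moves by 30vh, doubled to 60vh; together 116v + 28. The
  upper boundary term is kept separate.\<close>

lemma trunc_det'_close:
  assumes p: "weight p" and S: "S \<le> 3 * int n" and v: "L2_set (trunc_vec n G) {..<2*n} \<le> v"
  shows "\<bar>trunc_det' p n S t + 2 * trunc_det p n S s * coef p s G n (S + 1)\<bar> \<le>
     (116 * v + 28) * \<bar>t - s\<bar> + 14 * (L2_set (trunc_vec n (resid p s S 1 G n)) {..<2*n} + L2_set (tbvec p n t (3 * int n)) {..<2*n})"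
proof -
  let ?A = "{..<2*n}" and ?G = "trunc_vec n G" and ?T = "3 * int n" and ?C = "trunc_mat p n S t"
  let ?r = "trunc_vec n (resid p s S 1 G n)"
  define h where "h = \<bar>t - s\<bar>"
  have h0: "h \<ge> 0" by (simp add: h_def)
  have v0: "v \<ge> 0" using v L2_set_nonneg[of ?G ?A] by linarith
  have F1: "L2_set (tbvec p n r c) ?A \<le> 1" for r c by (rule L2_tbvec_le_1[OF p])
  have FG: "\<bar>\<Sum>i<2*n. tbvec p n r c i * ?G i\<bar> \<le> v" for r c
    using abs_inner_le[of "tbvec p n r c" ?G "2*n"] mult_mono[OF F1[of r c] v] by (simp add: L2_set_nonneg)
  have dF: "L2_set (\<lambda>i. tbvec p n t c i - tbvec p n s c i) ?A \<le> 2 * h" for c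
    unfolding h_def
  proof (rule L2_set_mean_value[OF tbvec_has_derivative])
    fix r
    have "L2_set (\<lambda>i. tbvec p n r (c - 1) i + - tbvec p n r (c + 1) i) ?A \<le> 1 + 1"
      using L2_set_triangle_ineq[of "tbvec p n r (c - 1)" "\<lambda>i. - tbvec p n r (c + 1) i" ?A] F1[of r "c - 1"] F1[of r "c + 1"]
      unfolding L2_set_minus by linarith
    then show "L2_set (\<lambda>i. tbvec p n r (c - 1) i - tbvec p n r (c + 1) i) ?A \<le> 2" by simp
  qed
  define m where "m r i = (\<Sum>j<2*n. trunc_mat p n S r i j * ?G j)" for r i
  \<comment> \<open>The derivative of the matrix applied to \<open>G\<close> consists of four terms,
    each a vector of norm at most 1 times a pairing of size at most \<open>v\<close>.\<close>
  have dm: "L2_set (\<lambda>i. m t i - m s i) ?A \<le> 4 * v * h"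
    unfolding h_def
  proof (rule L2_set_mean_value)
    fix r i
    let ?F = "tbvec p n r"
    let ?a = "\<lambda>c. \<Sum>j<2*n. ?F c j * ?G j"
    have "((\<lambda>r. m r i) has_real_derivative (\<Sum>j<2*n. (0 - ((?F S i * ?F (S + 1) j + ?F (S + 1) i * ?F S j)
       - (?F ?T i * ?F (?T + 1) j + ?F (?T + 1) i * ?F ?T j))) * ?G j)) (at r)"
      unfolding m_def trunc_mat_def defect_def
      by (intro DERIV_sum DERIV_cmult_right DERIV_diff DERIV_const synthesis_has_derivative[OF S])
    also have "(\<Sum>j<2*n. (0 - ((?F S i * ?F (S + 1) j + ?F (S + 1) i * ?F S j)
       - (?F ?T i * ?F (?T + 1) j + ?F (?T + 1) i * ?F ?T j))) * ?G j)
       = (- ?a (S + 1) * ?F S i + - ?a S * ?F (S + 1) i) + (?a (?T + 1) * ?F ?T i + ?a ?T * ?F (?T + 1) i)"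
      by (simp add: algebra_simps sum.distrib sum_subtractf sum_negf sum_distrib_left)
    finally show "((\<lambda>r. m r i) has_real_derivative
      (- ?a (S + 1) * ?F S i + - ?a S * ?F (S + 1) i) + (?a (?T + 1) * ?F ?T i + ?a ?T * ?F (?T + 1) i)) (at r)" .
  next
    fix r
    let ?F = "tbvec p n r"
    let ?a = "\<lambda>c. \<Sum>j<2*n. ?F c j * ?G j"
    have sc: "L2_set (\<lambda>i. b * ?F c i) ?A \<le> v" if "\<bar>b\<bar> \<le> v" for b c
      unfolding L2_set_scale using mult_mono[OF that F1[of r c]] v0 by (simp add: L2_set_nonneg)
    have "L2_set (\<lambda>i. (- ?a (S + 1) * ?F S i + - ?a S * ?F (S + 1) i) + (?a (?T + 1) * ?F ?T i + ?a ?T * ?F (?T + 1) i)) ?A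
       \<le> (v + v) + (v + v)"
      by (intro order_trans[OF L2_set_triangle_ineq] add_mono sc) (simp_all add: FG)
    then show "L2_set (\<lambda>i. (- ?a (S + 1) * ?F S i + - ?a S * ?F (S + 1) i) + (?a (?T + 1) * ?F ?T i + ?a ?T * ?F (?T + 1) i)) ?A
       \<le> 4 * v" by simp
  qed
  \<comment> \<open>The failure of \<open>G\<close> to solve the equation at \<open>t\<close>: both
    the matrix and the right-hand side have moved since \<open>s\<close>, and the residual at
    \<open>s\<close> remains.\<close>
  define w where "w i = tbvec p n t S i - m t i" for i
  have w: "L2_set w ?A \<le> 2 * h + (L2_set ?r ?A + 4 * v * h)"
  proof -
    have "w i = (tbvec p n t S i - tbvec p n s S i) + (- ?r i + - (m t i - m s i))" if "i < 2*n" for i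
      using sum_trunc_mat_G[OF that, of p S s G 1] unfolding w_def m_def by simp
    then have "L2_set w ?A = L2_set (\<lambda>i. (tbvec p n t S i - tbvec p n s S i) + (- ?r i + - (m t i - m s i))) ?A"
      by (intro L2_set_cong) auto
    also have "\<dots> \<le> 2 * h + (L2_set ?r ?A + 4 * v * h)"
      using dF[of S] dm
      by (intro order_trans[OF L2_set_triangle_ineq] add_mono) (simp_all only: L2_set_minus order_refl)
    finally show ?thesis .
  qed
  have "adjform (2*n) ?C (tbvec p n t (S + 1)) (tbvec p n t S) = adjform (2*n) ?C (tbvec p n t (S + 1)) (\<lambda>i. m t i + w i)"
    by (simp add: w_def)
  also have "\<dots> = trunc_det p n S t * coef p t G n (S + 1) + adjform (2*n) ?C (tbvec p n t (S + 1)) w"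
    unfolding adjform_add_right m_def adjform_range trunc_det_def coef_trunc_vec ..
  finally have main: "adjform (2*n) ?C (tbvec p n t (S + 1)) (tbvec p n t S)
     = trunc_det p n S t * coef p t G n (S + 1) + adjform (2*n) ?C (tbvec p n t (S + 1)) w" .
  have aw: "\<bar>adjform (2*n) ?C (tbvec p n t (S + 1)) w\<bar> \<le> 7 * L2_set w ?A"
    using adjform_trunc_mat_bound[OF p, of n S t "tbvec p n t (S + 1)" w] mult_right_mono[OF F1[of t "S + 1"], of "7 * L2_set w ?A"]
    by (simp add: L2_set_nonneg mult_ac)
  have ab: "\<bar>adjform (2*n) ?C (tbvec p n t (?T + 1)) (tbvec p n t ?T)\<bar> \<le> 7 * L2_set (tbvec p n t ?T) ?A"
    using adjform_trunc_mat_bound[OF p, of n S t "tbvec p n t (?T + 1)" "tbvec p n t ?T"]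
      mult_right_mono[OF F1[of t "?T + 1"], of "7 * L2_set (tbvec p n t ?T) ?A"]
    by (simp add: L2_set_nonneg mult_ac)
  \<comment> \<open>28vh from the Lipschitz bound of the determinant, 2vh from the motion of the
    vector in the pairing.\<close>
  have prod: "\<bar>trunc_det p n S t * coef p t G n (S + 1) - trunc_det p n S s * coef p s G n (S + 1)\<bar> \<le> 30 * v * h"
  proof -
    have "trunc_det p n S t * coef p t G n (S + 1) - trunc_det p n S s * coef p s G n (S + 1)
       = (trunc_det p n S t - trunc_det p n S s) * coef p t G n (S + 1) + trunc_det p n S s * (coef p t G n (S + 1) - coef p s G n (S + 1))"
      by (simp add: algebra_simps)
    moreover have "\<bar>(trunc_det p n S t - trunc_det p n S s) * coef p t G n (S + 1)\<bar> \<le> 28 * h * v"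
      unfolding abs_mult using trunc_det_Lipschitz[OF p S, of t s] FG[of t "S + 1"] h0
      by (intro mult_mono) (simp_all add: h_def coef_trunc_vec)
    moreover have "\<bar>trunc_det p n S s * (coef p t G n (S + 1) - coef p s G n (S + 1))\<bar> \<le> 1 * (2 * h * v)"
      unfolding abs_mult
    proof (intro mult_mono)
      show "\<bar>trunc_det p n S s\<bar> \<le> 1" unfolding trunc_det_def by (rule abs_fdet_le_1[OF contraction_trunc_mat[OF p]])
      have "coef p t G n (S + 1) - coef p s G n (S + 1) = (\<Sum>i<2*n. (tbvec p n t (S + 1) i - tbvec p n s (S + 1) i) * ?G i)"
        unfolding coef_trunc_vec by (simp add: left_diff_distrib sum_subtractf)
      then show "\<bar>coef p t G n (S + 1) - coef p s G n (S + 1)\<bar> \<le> 2 * h * v"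
        using abs_inner_le[of "\<lambda>i. tbvec p n t (S + 1) i - tbvec p n s (S + 1) i" ?G "2*n"]
          mult_mono[OF dF[of "S + 1"] v] h0 by (simp add: L2_set_nonneg)
    qed auto
    ultimately show ?thesis by (simp add: algebra_simps)
  qed
  have "\<bar>trunc_det' p n S t + 2 * (trunc_det p n S s * coef p s G n (S + 1))\<bar> \<le> 2 * (30 * v * h) + 2 * (7 * (2 * h + (L2_set ?r ?A + 4 * v * h)))
     + 2 * (7 * L2_set (tbvec p n t ?T) ?A)"
  proof -
    have aux: "\<bar>- 2 * (P + X) + 2 * Y + 2 * P'\<bar> \<le> 2 * c + 2 * (7 * a') + 2 * b"
      if "\<bar>X\<bar> \<le> 7 * a" "\<bar>Y\<bar> \<le> b" "\<bar>P - P'\<bar> \<le> c" "a \<le> a'" for P P' X Y a a' b c :: real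
    proof (rule abs_leI)
      have "X \<le> 7 * a" "- X \<le> 7 * a" "Y \<le> b" "- Y \<le> b" "P - P' \<le> c" "P' - P \<le> c"
        using that(1-3) by (auto simp: abs_le_iff)
      note facts = this that(4)
      show "- 2 * (P + X) + 2 * Y + 2 * P' \<le> 2 * c + 2 * (7 * a') + 2 * b"
        using facts by (simp add: algebra_simps)
      show "- (- 2 * (P + X) + 2 * Y + 2 * P') \<le> 2 * c + 2 * (7 * a') + 2 * b"
        using facts by (simp add: algebra_simps)
    qed
    show ?thesis unfolding trunc_det'_def main by (rule aux[OF aw ab prod w])
  qed
  then show ?thesis unfolding h_def[symmetric] by (simp add: algebra_simps)
qed

text \<open>For each \<open>n\<close> the mean value inequality leaves an error (K |h| + o(1)) |h|,
  where \<open>K\<close> is free of \<open>n\<close>. Letting n tend to infinity before h tends to 0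
  yields K h^2, which is differentiability.\<close>

lemma limit_has_derivative:
  assumes p: "weight p" and res: "resolvent_eq p s S 1 G g" and q: "\<And>t. (\<lambda>n. trunc_det p n S t) \<longlonglongrightarrow> q t"
  shows "(q has_real_derivative - 2 * q s * g (S + 1)) (at s)"
proof -
  define V where "V = infsum (\<lambda>k. (G k)\<^sup>2) UNIV"
  have Gs: "(\<lambda>k. (G k)\<^sup>2) summable_on UNIV" and gl: "\<And>c. (\<lambda>n. coef p s G n c) \<longlonglongrightarrow> g c"
    using res by (auto simp: resolvent_eq_def)
  have v: "L2_set (trunc_vec n G) {..<2*n} \<le> sqrt V" for n
    unfolding L2_trunc_vec V_def by (intro real_sqrt_le_mono finite_sum_le_infsum[OF Gs]) auto
  define K where "K = 116 * sqrt V + 28"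
  \<comment> \<open>The radius covers every t with |t - s| \<le> 1, the range of increments
    considered.\<close>
  obtain \<eta> where \<eta>: "\<eta> \<longlonglongrightarrow> 0" "\<And>n t. \<bar>t\<bar> \<le> \<bar>s\<bar> + 1 \<Longrightarrow> L2_set (tbvec p n t (3 * int n)) {..<2*n} \<le> \<eta> n"
    using boundary_tendsto[OF p, of "\<bar>s\<bar> + 1"] by auto
  define \<rho> where "\<rho> n = L2_set (trunc_vec n (resid p s S 1 G n)) {..<2*n}" for n
  have \<rho>: "\<rho> \<longlonglongrightarrow> 0" unfolding \<rho>_def[abs_def] by (rule resid_tendsto[OF p res])
  define d where "d n = - 2 * trunc_det p n S s * coef p s G n (S + 1)" for n
  have d: "d \<longlonglongrightarrow> - 2 * q s * g (S + 1)" unfolding d_def[abs_def] by (intro tendsto_intros q gl)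
  have fin: "\<bar>trunc_det p n S (s + h) - trunc_det p n S s - d n * h\<bar> \<le> (K * \<bar>h\<bar> + 14 * (\<rho> n + \<eta> n)) * \<bar>h\<bar>"
    if "S \<le> 3 * int n" "\<bar>h\<bar> \<le> 1" for n h
  proof -
    let ?I = "{s - \<bar>h\<bar>..s + \<bar>h\<bar>}"
    let ?B = "K * \<bar>h\<bar> + 14 * (\<rho> n + \<eta> n)"
    have "norm ((trunc_det p n S (s + h) - d n * (s + h)) - (trunc_det p n S s - d n * s)) \<le> ?B * norm ((s + h) - s)"
    proof (rule field_differentiable_bound[where S = ?I and f' = "\<lambda>t. trunc_det' p n S t - d n"])
      show "convex ?I" by simp
      fix t assume t: "t \<in> ?I"
      show "((\<lambda>t. trunc_det p n S t - d n * t) has_field_derivative trunc_det' p n S t - d n) (at t within ?I)"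
        using DERIV_diff[OF trunc_det_has_derivative[OF that(1), of p t] DERIV_cmult[OF DERIV_ident, of "d n"]]
        by (auto intro: has_field_derivative_at_within)
      have "\<bar>trunc_det' p n S t - d n\<bar> \<le> K * \<bar>t - s\<bar> + 14 * (\<rho> n + L2_set (tbvec p n t (3 * int n)) {..<2*n})"
        using trunc_det'_close[OF p that(1) v, of t s] by (simp add: K_def \<rho>_def d_def)
      also have "\<dots> \<le> ?B"
      proof -
        have V0: "V \<ge> 0" unfolding V_def by (rule infsum_nonneg) simp
        have "K * \<bar>t - s\<bar> \<le> K * \<bar>h\<bar>" using t V0 by (intro mult_left_mono) (auto simp: K_def)
        moreover have "L2_set (tbvec p n t (3 * int n)) {..<2*n} \<le> \<eta> n" using t that(2) by (intro \<eta>(2)) auto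
        ultimately show ?thesis by simp
      qed
      finally show "norm (trunc_det' p n S t - d n) \<le> ?B" by simp
    qed auto
    then show ?thesis by (simp add: algebra_simps)
  qed
  have lim: "\<bar>q (s + h) - q s - (- 2 * q s * g (S + 1)) * h\<bar> \<le> (K * \<bar>h\<bar> + 14 * (0 + 0)) * \<bar>h\<bar>" if "\<bar>h\<bar> \<le> 1" for h
  proof (rule tendsto_le[OF sequentially_bot])
    show "(\<lambda>n. \<bar>trunc_det p n S (s + h) - trunc_det p n S s - d n * h\<bar>) \<longlonglongrightarrow> \<bar>q (s + h) - q s - (- 2 * q s * g (S + 1)) * h\<bar>"
      by (intro tendsto_intros q d)
    show "(\<lambda>n. (K * \<bar>h\<bar> + 14 * (\<rho> n + \<eta> n)) * \<bar>h\<bar>) \<longlonglongrightarrow> (K * \<bar>h\<bar> + 14 * (0 + 0)) * \<bar>h\<bar>"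
      by (intro tendsto_intros \<rho> \<eta>)
    show "\<forall>\<^sub>F n in sequentially. \<bar>trunc_det p n S (s + h) - trunc_det p n S s - d n * h\<bar> \<le> (K * \<bar>h\<bar> + 14 * (\<rho> n + \<eta> n)) * \<bar>h\<bar>"
      using eventually_ge_at_top[of "nat \<bar>S\<bar>"] by eventually_elim (rule fin, use that in auto)
  qed
  have "(\<lambda>h. K * \<bar>h\<bar>) \<midarrow>0\<rightarrow> K * \<bar>0\<bar>" by (intro tendsto_intros)
  then have K0: "(\<lambda>h. K * \<bar>h\<bar>) \<midarrow>0\<rightarrow> 0" by simp
  have "(\<lambda>h. (q (s + h) - q s) / h - (- 2 * q s * g (S + 1))) \<midarrow>0\<rightarrow> 0"
  proof (rule Lim_null_comparison[OF _ K0])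
    have "\<forall>\<^sub>F h in at 0. h \<noteq> 0 \<and> \<bar>h\<bar> \<le> (1::real)"
      unfolding eventually_at by (rule exI[of _ 1]) auto
    then show "\<forall>\<^sub>F h in at 0. norm ((q (s + h) - q s) / h - (- 2 * q s * g (S + 1))) \<le> K * \<bar>h\<bar>"
    proof eventually_elim
      case (elim h)
      have "(q (s + h) - q s) / h - (- 2 * q s * g (S + 1)) = (q (s + h) - q s - (- 2 * q s * g (S + 1)) * h) / h"
        using elim by (simp add: field_simps)
      then show ?case using lim[of h] elim by (simp add: abs_divide divide_le_eq)
    qed
  qed
  then show ?thesis unfolding DERIV_def by (rule LIM_zero_cancel)
qed

section \<open>The determinant as a limit of truncations\<close>

lemma Zp_eq: "Zp = range (\<lambda>k::int. of_int k + 1/2)"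
  unfolding Zp_def by (rule full_SetCompr_eq)

lemma bij_Zp: "bij_betw (\<lambda>k::int. of_int k + 1/2 :: real) UNIV Zp"
  by (rule bij_betw_imageI) (simp_all add: Zp_eq inj_on_def)

lemma J_eq_bessel: "x = real_of_int n \<Longrightarrow> J x (2 * t) = bessel n t"
  by (simp add: J_def bessel_def)

definition half_weight :: "(real \<Rightarrow> real) \<Rightarrow> int \<Rightarrow> real" where
  "half_weight \<sigma> k = \<sigma> (of_int k + 1/2)"

lemma weight_half_weight:
  assumes "\<forall>l\<in>Zp. 0 \<le> \<sigma> l \<and> \<sigma> l \<le> 1"
  shows "weight (half_weight \<sigma>)"
  unfolding weight_def
proof
  fix k :: int
  have "of_int k + 1/2 \<in> Zp" unfolding Zp_eq by blast
  then show "0 \<le> half_weight \<sigma> k \<and> half_weight \<sigma> k \<le> 1" using assms unfolding half_weight_def by blast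
qed

lemma half_weight_summable:
  assumes "\<sigma> summable_on {l\<in>Zp. l < 0}"
  shows "half_weight \<sigma> summable_on {..<0}"
proof -
  have "bij_betw (\<lambda>k::int. of_int k + 1/2 :: real) {..<0} {l\<in>Zp. l < 0}"
    unfolding bij_betw_def
  proof
    show "(\<lambda>k::int. of_int k + 1/2 :: real) ` {..<0} = {l\<in>Zp. l < 0}"
    proof (intro equalityI subsetI)
      fix l assume "l \<in> {l\<in>Zp. l < 0}"
      then obtain k :: int where k: "l = of_int k + 1/2" "l < 0" by (auto simp: Zp_def)
      then have "k < 0" by linarith
      then show "l \<in> (\<lambda>k::int. of_int k + 1/2 :: real) ` {..<0}" using k by auto
    next
      fix l assume "l \<in> (\<lambda>k::int. of_int k + 1/2 :: real) ` {..<0}"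
      then obtain k :: int where k: "l = of_int k + 1/2" "k < 0" by auto
      then have "real_of_int k \<le> -1" by linarith
      then show "l \<in> {l\<in>Zp. l < 0}" using k by (auto simp: Zp_def)
    qed
  qed (auto simp: inj_on_def)
  from summable_on_reindex_bij_betw[OF this, of \<sigma>] assms show ?thesis by (simp add: half_weight_def[abs_def])
qed

text \<open>The kernel K_\<sigma> in integer coordinates, with \<open>c\<close> coding the
  half-integer c - 1/2.\<close>

definition bessel_gram :: "(int \<Rightarrow> real) \<Rightarrow> real \<Rightarrow> int \<Rightarrow> int \<Rightarrow> real" where
  "bessel_gram p t c d = (\<Sum>\<^sub>\<infinity>k. bvec p t c k * bvec p t d k)"

lemma Ksig_eq_bessel_gram:
  assumes "\<forall>l\<in>Zp. 0 \<le> \<sigma> l \<and> \<sigma> l \<le> 1"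
  shows "Ksig \<sigma> t (of_int c - 1/2) (of_int d - 1/2) = bessel_gram (half_weight \<sigma>) t c d"
proof -
  have p: "weight (half_weight \<sigma>)" by (rule weight_half_weight[OF assms])
  have "Ksig \<sigma> t (of_int c - 1/2) (of_int d - 1/2)
     = (\<Sum>\<^sub>\<infinity>k::int. \<sigma> (of_int k + 1/2) * J (of_int c - 1/2 + (of_int k + 1/2)) (2*t) * J (of_int d - 1/2 + (of_int k + 1/2)) (2*t))"
    unfolding Ksig_def by (rule infsum_reindex_bij_betw[OF bij_Zp, symmetric])
  also have "\<dots> = bessel_gram (half_weight \<sigma>) t c d"
    unfolding bessel_gram_def
  proof (rule infsum_cong)
    fix k :: int
    have "J (of_int c - 1/2 + (of_int k + 1/2)) (2*t) = bessel (c + k) t" for c by (rule J_eq_bessel) simp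
    moreover have "sqrt (half_weight \<sigma> k) * sqrt (half_weight \<sigma> k) = \<sigma> (of_int k + 1/2)" using p by (simp add: weight_def half_weight_def)
    ultimately show "\<sigma> (of_int k + 1/2) * J (of_int c - 1/2 + (of_int k + 1/2)) (2*t) * J (of_int d - 1/2 + (of_int k + 1/2)) (2*t)
        = bvec (half_weight \<sigma>) t c k * bvec (half_weight \<sigma>) t d k"
      unfolding bvec_def by (simp add: mult_ac)
  qed
  finally show ?thesis .
qed

lemma abs_mult_le_sum_sq: "\<bar>x * y\<bar> \<le> x\<^sup>2 + y\<^sup>2" for x y :: real
proof -
  have "2 * (\<bar>x\<bar> * \<bar>y\<bar>) \<le> \<bar>x\<bar>\<^sup>2 + \<bar>y\<bar>\<^sup>2"
    using sum_squares_bound[of "\<bar>x\<bar>" "\<bar>y\<bar>"] by (simp add: mult.assoc)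
  moreover have "\<bar>x\<bar> * \<bar>y\<bar> \<ge> 0" by simp
  ultimately show ?thesis unfolding abs_mult power2_abs by linarith
qed

lemma bvec_prod_summable:
  assumes p: "weight p"
  shows "(\<lambda>k. bvec p t c k * bvec p t d k) summable_on UNIV"
proof -
  have b: "(\<lambda>k. (bessel (c + k) t)\<^sup>2) summable_on UNIV" for c
    using bessel_prod_summable[of c t c] by (simp add: power2_eq_square)
  have "(\<lambda>k. (bessel (c + k) t)\<^sup>2 + (bessel (d + k) t)\<^sup>2) summable_on UNIV" by (intro summable_on_add b)
  then show ?thesis
  proof (rule summable_on_dominated)
    fix k
    have f: "(bvec p t c k)\<^sup>2 \<le> (bessel (c + k) t)\<^sup>2" for c
      using p mult_right_mono[of "p k" 1 "(bessel (c + k) t)\<^sup>2"] by (simp add: bvec_def weight_def power_mult_distrib)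
    show "\<bar>bvec p t c k * bvec p t d k\<bar> \<le> (bessel (c + k) t)\<^sup>2 + (bessel (d + k) t)\<^sup>2"
      using f[of c] f[of d] abs_mult_le_sum_sq[of "bvec p t c k" "bvec p t d k"] by linarith
  qed
qed

lemma bvec_pairing_summable:
  assumes p: "weight p" and G: "(\<lambda>k. (G k)\<^sup>2) summable_on UNIV"
  shows "(\<lambda>k. bvec p t c k * G k) summable_on UNIV"
proof (rule summable_on_dominated)
  show "(\<lambda>k. (bvec p t c k)\<^sup>2 + (G k)\<^sup>2) summable_on UNIV"
    using bvec_prod_summable[OF p, of t c c] by (intro summable_on_add G) (simp add: power2_eq_square)
qed (rule abs_mult_le_sum_sq)

text \<open>Because c! k! divides (c+k)!. It decouples the two indices in the trace
  estimate.\<close>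

lemma bessel_majorant_add_le:
  assumes "R \<ge> 0" "c \<ge> 0" "k \<ge> 0"
  shows "bessel_majorant R (c + k) \<le> bessel_majorant R c * bessel_majorant R k"
proof -
  have "(fact (nat c) * fact (nat k) :: nat) \<le> fact (nat c + nat k)"
    by (rule dvd_imp_le[OF fact_fact_dvd_fact]) simp
  then have "(fact (nat c) * fact (nat k) :: real) \<le> fact (nat c + nat k)"
    by (metis of_nat_fact of_nat_le_iff of_nat_mult)
  then show ?thesis
    using assms by (simp add: bessel_majorant_def nat_add_distrib power_add frac_le)
qed

lemma bessel_sq_sum_le: "finite A \<Longrightarrow> (\<Sum>k\<in>A. (bessel (c + k) t)\<^sup>2) \<le> 1"
proof -
  assume A: "finite A"
  have "((\<lambda>k. (bessel (c + k) t)\<^sup>2) has_sum 1) UNIV"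
    using bessel_orthonormal[of c t c] by (simp add: power2_eq_square)
  then show ?thesis using finite_sum_le_infsum[of "\<lambda>k. (bessel (c + k) t)\<^sup>2" UNIV A] A by (auto simp: has_sum_iff)
qed

text \<open>M has finite trace. For k < 0 the sum over \<open>c\<close> is at most 1 and the weights
  are summable; for k \<ge> 0 and S < c < 0 there are finitely many \<open>c\<close>, each
  contributing at most 1; for c, k \<ge> 0 the majorant factorises.\<close>

lemma trace_bound:
  assumes p: "weight p" and ps: "p summable_on {..<0}"
  obtains T where "\<And>A B. finite A \<Longrightarrow> A \<subseteq> {S<..} \<Longrightarrow> finite B \<Longrightarrow> (\<Sum>c\<in>A. \<Sum>k\<in>B. (bvec p t c k)\<^sup>2) \<le> T"
proof -
  define R where "R = \<bar>t\<bar>"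
  define W where "W = infsum (bessel_majorant R) UNIV"
  define C where "C = (exp (R\<^sup>2))\<^sup>2 * exp R"
  have R: "R \<ge> 0" by (simp add: R_def)
  have C: "C \<ge> 0" by (simp add: C_def)
  have sq: "(bessel m t)\<^sup>2 \<le> C * bessel_majorant R m" for m
    unfolding C_def by (rule bessel_sq_le) (simp add: R_def)
  have bsum: "(\<Sum>k\<in>B. bessel_majorant R k) \<le> W" if "finite B" for B
    unfolding W_def using that by (intro finite_sum_le_infsum bessel_majorant_summable R) (auto simp: bessel_majorant_nonneg[OF R])
  have W0: "W \<ge> 0" using bsum[of "{}"] by simp
  have "(\<Sum>c\<in>A. \<Sum>k\<in>B. (bvec p t c k)\<^sup>2) \<le> infsum p {..<0} + (real (card {S<..<0}) + C * (W * W))"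
    if A: "finite A" "A \<subseteq> {S<..}" and B: "finite B" for A B
  proof -
    have f: "(bvec p t c k)\<^sup>2 = p k * (bessel (c + k) t)\<^sup>2" for c k
      using p by (simp add: bvec_def weight_def power_mult_distrib)
    have f1: "(bvec p t c k)\<^sup>2 \<le> (bessel (c + k) t)\<^sup>2" for c k
      unfolding f using p mult_right_mono[of "p k" 1 "(bessel (c + k) t)\<^sup>2"] by (simp add: weight_def)
    let ?B1 = "B \<inter> {..<0}" and ?B2 = "B \<inter> {0..}"
    have "B = ?B1 \<union> ?B2" by auto
    then have "(\<Sum>c\<in>A. \<Sum>k\<in>B. (bvec p t c k)\<^sup>2) = (\<Sum>c\<in>A. (\<Sum>k\<in>?B1. (bvec p t c k)\<^sup>2) + (\<Sum>k\<in>?B2. (bvec p t c k)\<^sup>2))"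
      using B by (intro sum.cong refl) (subst sum.union_disjoint[symmetric], auto)
    also have "\<dots> = (\<Sum>c\<in>A. \<Sum>k\<in>?B1. (bvec p t c k)\<^sup>2) + (\<Sum>c\<in>A. \<Sum>k\<in>?B2. (bvec p t c k)\<^sup>2)" by (rule sum.distrib)
    also have "(\<Sum>c\<in>A. \<Sum>k\<in>?B1. (bvec p t c k)\<^sup>2) \<le> infsum p {..<0}"
    proof -
      have "(\<Sum>c\<in>A. \<Sum>k\<in>?B1. (bvec p t c k)\<^sup>2) = (\<Sum>k\<in>?B1. p k * (\<Sum>c\<in>A. (bessel (k + c) t)\<^sup>2))"
        unfolding f by (subst sum.swap) (simp add: sum_distrib_left add.commute)
      also have "\<dots> \<le> (\<Sum>k\<in>?B1. p k * 1)"
        using p A by (intro sum_mono mult_left_mono bessel_sq_sum_le) (auto simp: weight_def)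
      also have "\<dots> \<le> infsum p {..<0}"
        using p B ps by (simp add: finite_sum_le_infsum weight_def)
      finally show ?thesis .
    qed
    also have "(\<Sum>c\<in>A. \<Sum>k\<in>?B2. (bvec p t c k)\<^sup>2) \<le> real (card {S<..<0}) + C * (W * W)"
    proof -
      let ?A1 = "A \<inter> {..<0}" and ?A2 = "A \<inter> {0..}"
      have A12: "A = ?A1 \<union> ?A2" by auto
      have "(\<Sum>c\<in>A. \<Sum>k\<in>?B2. (bvec p t c k)\<^sup>2) \<le> (\<Sum>c\<in>A. \<Sum>k\<in>?B2. (bessel (c + k) t)\<^sup>2)"
        by (intro sum_mono f1)
      also have "\<dots> = (\<Sum>c\<in>?A1. \<Sum>k\<in>?B2. (bessel (c + k) t)\<^sup>2) + (\<Sum>c\<in>?A2. \<Sum>k\<in>?B2. (bessel (c + k) t)\<^sup>2)"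
        using A by (subst A12) (rule sum.union_disjoint, auto)
      also have "(\<Sum>c\<in>?A1. \<Sum>k\<in>?B2. (bessel (c + k) t)\<^sup>2) \<le> (\<Sum>c\<in>?A1. 1)"
        using B by (intro sum_mono bessel_sq_sum_le) auto
      also have "(\<Sum>c\<in>?A1. 1) \<le> real (card {S<..<0})"
      proof -
        have "card ?A1 \<le> card {S<..<0}" using A by (intro card_mono) auto
        then show ?thesis by simp
      qed
      also have "(\<Sum>c\<in>?A2. \<Sum>k\<in>?B2. (bessel (c + k) t)\<^sup>2) \<le> (\<Sum>c\<in>?A2. \<Sum>k\<in>?B2. C * (bessel_majorant R c * bessel_majorant R k))"
      proof (rule sum_mono, rule sum_mono)
        fix c k assume c: "c \<in> ?A2" and k: "k \<in> ?B2"
        have "bessel_majorant R (c + k) \<le> bessel_majorant R c * bessel_majorant R k" by (rule bessel_majorant_add_le[OF R]) (use c k in auto)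
        then have "C * bessel_majorant R (c + k) \<le> C * (bessel_majorant R c * bessel_majorant R k)" using C by (rule mult_left_mono)
        then show "(bessel (c + k) t)\<^sup>2 \<le> C * (bessel_majorant R c * bessel_majorant R k)" using sq[of "c + k"] by linarith
      qed
      also have "\<dots> = C * ((\<Sum>c\<in>?A2. bessel_majorant R c) * (\<Sum>k\<in>?B2. bessel_majorant R k))"
        unfolding sum_product by (simp only: sum_distrib_left)
      also have "\<dots> \<le> C * (W * W)"
      proof (rule mult_left_mono[OF mult_mono C])
        show "(\<Sum>c\<in>?A2. bessel_majorant R c) \<le> W" "(\<Sum>k\<in>?B2. bessel_majorant R k) \<le> W" using A B by (auto intro: bsum)
        show "0 \<le> (\<Sum>k\<in>?B2. bessel_majorant R k)" by (intro sum_nonneg bessel_majorant_nonneg R)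
      qed (rule W0)
      finally show ?thesis by (simp only: add_mono order_refl)
    qed
    finally show ?thesis by simp
  qed
  then show ?thesis using that by blast
qed

lemma bessel_gram_diag_summable:
  assumes p: "weight p" and ps: "p summable_on {..<0}"
  shows "(\<lambda>c. bessel_gram p t c c) summable_on {S<..}"
proof -
  obtain T where T: "\<And>A B. finite A \<Longrightarrow> A \<subseteq> {S<..} \<Longrightarrow> finite B \<Longrightarrow> (\<Sum>c\<in>A. \<Sum>k\<in>B. (bvec p t c k)\<^sup>2) \<le> T"
    by (rule trace_bound[OF p ps, of S t]) blast
  have le: "(\<Sum>c\<in>A. bessel_gram p t c c) \<le> T" if A: "finite A" "A \<subseteq> {S<..}" for A
  proof -
    have hs: "((\<lambda>k. \<Sum>c\<in>A. bvec p t c k * bvec p t c k) has_sum (\<Sum>c\<in>A. bessel_gram p t c c)) UNIV"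
      unfolding bessel_gram_def by (intro has_sum_sum has_sum_infsum bvec_prod_summable p)
    then have "(\<Sum>c\<in>A. bessel_gram p t c c) = infsum (\<lambda>k. \<Sum>c\<in>A. bvec p t c k * bvec p t c k) UNIV" by (simp add: infsumI)
    also have "\<dots> \<le> T"
    proof (rule infsum_le_finite_sums)
      show "(\<lambda>k. \<Sum>c\<in>A. bvec p t c k * bvec p t c k) summable_on UNIV" using hs by (rule has_sum_imp_summable)
      fix B :: "int set" assume "finite B"
      then show "(\<Sum>k\<in>B. \<Sum>c\<in>A. bvec p t c k * bvec p t c k) \<le> T"
        using T[OF A \<open>finite B\<close>] by (subst sum.swap) (simp only: power2_eq_square)
    qed
    finally show ?thesis .
  qed
  show ?thesis
  proof (rule nonneg_bdd_above_summable_on)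
    show "bessel_gram p t c c \<ge> 0" for c unfolding bessel_gram_def by (rule infsum_nonneg) simp
    show "bdd_above (sum (\<lambda>c. bessel_gram p t c c) ` {F. F \<subseteq> {S<..} \<and> finite F})"
      by (rule bdd_aboveI2[of _ _ T]) (use le in blast)
  qed
qed

text \<open>The Gram kernel of the cut vectors, supported on finitely many \<open>c\<close>,
  converges entrywise and is dominated through Cauchy--Schwarz by the diagonal of the full Gram
  kernel. Its Fredholm determinant is a finite one, which Sylvester's identity carries over to the
  dual index \<open>k\<close>.\<close>

lemma trunc_det_tendsto_fredholm:
  assumes p: "weight p" and ps: "p summable_on {..<0}"
  shows "(\<lambda>n. trunc_det p n S t) \<longlonglongrightarrow> fredholm_det_1m (\<lambda>i j. bessel_gram p t (S + 1 + int i) (S + 1 + int j)) UNIV"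
proof -
  let ?c = "\<lambda>i. S + 1 + int i"
  define K where "K n i j = (if ?c i \<le> 3 * int n \<and> ?c j \<le> 3 * int n
      then \<Sum>k = - int n..<int n. bvec p t (?c i) k * bvec p t (?c j) k else 0)" for n i j
  define \<kappa> where "\<kappa> i = sqrt (bessel_gram p t (?c i) (?c i))" for i
  have diag: "bessel_gram p t c c \<ge> 0" for c unfolding bessel_gram_def by (rule infsum_nonneg) simp
  have partial: "(\<Sum>k\<in>B. (bvec p t c k)\<^sup>2) \<le> bessel_gram p t c c" if "finite B" for B c
    unfolding bessel_gram_def power2_eq_square using that by (intro finite_sum_le_infsum bvec_prod_summable p) auto
  have "(\<lambda>n. fredholm_det_1m (K n) UNIV) \<longlonglongrightarrow> fredholm_det_1m (\<lambda>i j. bessel_gram p t (?c i) (?c j)) UNIV"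
  proof (rule fredholm_det_tendsto)
    fix n i j
    show "\<bar>K n i j\<bar> \<le> \<kappa> i * \<kappa> j"
    proof (cases "?c i \<le> 3 * int n \<and> ?c j \<le> 3 * int n")
      case True
      let ?B = "{- int n..<int n}"
      have "(\<Sum>k\<in>?B. bvec p t (?c i) k * bvec p t (?c j) k)\<^sup>2 \<le> (\<Sum>k\<in>?B. (bvec p t (?c i) k)\<^sup>2) * (\<Sum>k\<in>?B. (bvec p t (?c j) k)\<^sup>2)"
        by (rule Cauchy_Schwarz_ineq_sum)
      also have "\<dots> \<le> bessel_gram p t (?c i) (?c i) * bessel_gram p t (?c j) (?c j)"
        by (intro mult_mono partial diag sum_nonneg) auto
      also have "\<dots> = (\<kappa> i * \<kappa> j)\<^sup>2" by (simp add: \<kappa>_def power_mult_distrib diag)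
      finally have "\<bar>\<Sum>k\<in>?B. bvec p t (?c i) k * bvec p t (?c j) k\<bar> \<le> \<bar>\<kappa> i * \<kappa> j\<bar>"
        by (simp add: abs_le_square_iff)
      then show ?thesis using True diag by (simp add: K_def \<kappa>_def)
    qed (use diag in \<open>auto simp: K_def \<kappa>_def\<close>)
  next
    fix i show "\<kappa> i \<ge> 0" by (simp add: \<kappa>_def diag)
  next
    have "(\<lambda>c. bessel_gram p t c c) summable_on (range ?c)"
      by (rule summable_on_subset_banach[OF bessel_gram_diag_summable[OF p ps, of t S]]) auto
    then have "(\<lambda>i. bessel_gram p t (?c i) (?c i)) summable_on UNIV"
      by (subst (asm) summable_on_reindex) (auto simp: o_def inj_def)
    then show "(\<lambda>i. (\<kappa> i)\<^sup>2) summable_on UNIV" by (simp add: \<kappa>_def diag)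
  next
    fix i j
    have "(\<lambda>n. \<Sum>k = - int n..<int n. bvec p t (?c i) k * bvec p t (?c j) k) \<longlonglongrightarrow> bessel_gram p t (?c i) (?c j)"
      unfolding bessel_gram_def by (intro has_sum_int_interval has_sum_infsum bvec_prod_summable p)
    moreover have "\<forall>\<^sub>F n in sequentially. (\<Sum>k = - int n..<int n. bvec p t (?c i) k * bvec p t (?c j) k) = K n i j"
      using eventually_ge_at_top[of "nat (\<bar>?c i\<bar> + \<bar>?c j\<bar>)"] by eventually_elim (auto simp: K_def)
    ultimately show "(\<lambda>n. K n i j) \<longlonglongrightarrow> bessel_gram p t (?c i) (?c j)" by (rule Lim_transform_eventually)
  qed
  moreover have "fredholm_det_1m (K n) UNIV = trunc_det p n S t" for n
  proof -
    \<comment> \<open>The number of codes \<open>c\<close> with S < c \<le> 3n; \<open>nat\<close>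
      makes it 0 when the window is empty.\<close>
    define N where "N = nat (3 * int n - S)"
    have N: "i < N \<longleftrightarrow> ?c i \<le> 3 * int n" for i unfolding N_def by linarith
    have "fredholm_det_1m (K n) UNIV = fdet N (\<lambda>i j. (if i = j then 1 else 0) - K n i j)"
      by (rule fredholm_det_finite) (use N in \<open>auto simp: K_def not_less[symmetric]\<close>)
    also have "\<dots> = fdet N (\<lambda>i j. (if i = j then 1 else 0) - (\<Sum>k<2*n. tbvec p n t (?c i) k * tbvec p n t (?c j) k))"
    proof (rule fdet_cong)
      fix i j assume "i < N" "j < N"
      then show "(if i = j then 1 else 0) - K n i j = (if i = j then 1 else 0) - (\<Sum>k<2*n. tbvec p n t (?c i) k * tbvec p n t (?c j) k)"
        unfolding trunc_vec_def sum_trunc_vec[of "\<lambda>k. bvec p t (?c i) k * bvec p t (?c j) k"] by (simp add: K_def N)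
    qed
    \<comment> \<open>Passage from the index \<open>c\<close>, of size \<open>N\<close>, to the dual
      index \<open>k\<close>, of size 2n.\<close>
    also have "\<dots> = fdet (2*n) (\<lambda>i j. (if i = j then 1 else 0) - (\<Sum>k<N. tbvec p n t (?c k) i * tbvec p n t (?c k) j))"
      by (rule fdet_sylvester[where B = "\<lambda>i k. tbvec p n t (?c i) k" and B' = "\<lambda>k j. tbvec p n t (?c j) k"])
    also have "\<dots> = trunc_det p n S t"
      unfolding trunc_det_def trunc_mat_def defect_def
    proof (intro fdet_cong arg_cong2[where f = "(-)"] refl)
      fix i j
      show "(\<Sum>k<N. tbvec p n t (?c k) i * tbvec p n t (?c k) j) = (\<Sum>c\<in>{S<..3 * int n}. tbvec p n t c i * tbvec p n t c j)"
        by (rule sum.reindex_bij_witness[where i = "\<lambda>c. nat (c - S - 1)" and j = ?c]) (auto simp: N_def)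
    qed
    finally show ?thesis .
  qed
  ultimately show ?thesis by simp
qed

lemma trunc_det_tendsto_Q:
  assumes \<sigma>: "\<forall>l\<in>Zp. 0 \<le> \<sigma> l \<and> \<sigma> l \<le> 1" and sm: "\<sigma> summable_on {l\<in>Zp. l < 0}"
    and s: "s = of_int S - 1/2"
  shows "(\<lambda>n. trunc_det (half_weight \<sigma>) n S t) \<longlonglongrightarrow> Q \<sigma> t s"
proof -
  \<comment> \<open>The least admissible point s + 1 has code S + 1, in agreement with the strict
    condition c > S on the dual side.\<close>
  let ?h = "\<lambda>i. of_int (S + 1 + int i) - 1/2 :: real"
  have "bij_betw ?h UNIV {a \<in> Zp. a \<ge> s + 1}"
    unfolding bij_betw_def
  proof
    show "inj ?h" by (auto simp: inj_def)
    show "range ?h = {a \<in> Zp. a \<ge> s + 1}"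
    proof (intro equalityI subsetI)
      fix a assume "a \<in> {a \<in> Zp. a \<ge> s + 1}"
      then obtain k :: int where k: "a = of_int k + 1/2" "a \<ge> s + 1" by (auto simp: Zp_def)
      then have "k \<ge> S" using s by linarith
      then have "a = ?h (nat (k - S))" using k by simp
      then show "a \<in> range ?h" by blast
    next
      fix a assume "a \<in> range ?h"
      then obtain i where "a = ?h i" by blast
      then have "a = of_int (S + int i) + 1/2" "a \<ge> s + 1" using s by auto
      then show "a \<in> {a \<in> Zp. a \<ge> s + 1}" unfolding Zp_def by blast
    qed
  qed
  then have "fredholm_det_1m (Ksig \<sigma> t) {a \<in> Zp. a \<ge> s + 1} = fredholm_det_1m (\<lambda>i j. Ksig \<sigma> t (?h i) (?h j)) UNIV"
    unfolding fredholm_det_coeff by (subst fredholm_coeff_reindex) auto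
  then have "Q \<sigma> t s = fredholm_det_1m (\<lambda>i j. bessel_gram (half_weight \<sigma>) t (S + 1 + int i) (S + 1 + int j)) UNIV"
    unfolding Q_def Ksig_eq_bessel_gram[OF \<sigma>] .
  then show ?thesis using trunc_det_tendsto_fredholm[OF weight_half_weight[OF \<sigma>] half_weight_summable[OF sm]] by simp
qed

section \<open>The Riemann--Hilbert problem\<close>

text \<open>The residue theorem on |z| = n against the trivial estimate of the integral; 2 pi
  cancels. Poles are described by local numerators, so a removable point is covered with c p =
  0.\<close>

lemma residue_sum_bound:
  fixes E :: "complex \<Rightarrow> complex"
  assumes n: "n > 0" and nr: "n < R" and fin: "finite pts" and pts: "\<And>p. p \<in> pts \<Longrightarrow> cmod p < n"
    and holo: "E holomorphic_on (ball 0 R - pts)"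
    and pole: "\<And>p. p \<in> pts \<Longrightarrow> \<exists>r>0. \<exists>h. h holomorphic_on ball p r \<and> h p = c p \<and>
                 (\<forall>z\<in>ball p r - {p}. E z = h z / (z - p))"
    and bound: "\<And>z. cmod z = n \<Longrightarrow> cmod (E z) \<le> B"
  shows "cmod (\<Sum>p\<in>pts. c p) \<le> B * n"
proof -
  have res: "residue E p = c p" if p: "p \<in> pts" for p
  proof -
    obtain r h where r: "r > 0" and h: "h holomorphic_on ball p r" "h p = c p"
      and eq: "\<forall>z\<in>ball p r - {p}. E z = h z / (z - p)" using pole[OF p] by blast
    have "residue E p = residue (\<lambda>z. h z / (z - p)) p"
    proof (rule residue_cong)
      have "\<forall>\<^sub>F z in at p. z \<in> ball p r - {p}"
        using r by (intro eventually_at_in_open) auto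
      then show "\<forall>\<^sub>F z in at p. E z = h z / (z - p)" by eventually_elim (use eq in blast)
    qed simp
    also have "\<dots> = h p" by (rule residue_simple[of "ball p r"]) (use r h in auto)
    finally show ?thesis using h by simp
  qed
  have int: "contour_integral (circlepath 0 n) E = 2 * pi * \<i> * (\<Sum>p\<in>pts. winding_number (circlepath 0 n) p * residue E p)"
  proof (rule Residue_theorem[OF _ _ fin holo])
    show "path_image (circlepath 0 n) \<subseteq> ball 0 R - pts" using n nr pts by force
    show "\<forall>z. z \<notin> ball 0 R \<longrightarrow> winding_number (circlepath 0 n) z = 0"
      using n nr by (intro allI impI winding_number_zero_outside[of _ "cball 0 n"]) auto
  qed auto
  have "(\<Sum>p\<in>pts. winding_number (circlepath 0 n) p * residue E p) = (\<Sum>p\<in>pts. c p)"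
    using n pts res by (intro sum.cong) (auto simp: winding_number_circlepath)
  then have int': "contour_integral (circlepath 0 n) E = 2 * pi * \<i> * (\<Sum>p\<in>pts. c p)" using int by simp
  have integrable: "E contour_integrable_on (circlepath 0 n)"
  proof (rule contour_integrable_holomorphic_simple)
    show "E holomorphic_on (ball 0 R - pts)" by (rule holo)
    show "open (ball 0 R - pts)" using fin by (intro open_Diff finite_imp_closed) auto
    show "path_image (circlepath 0 n) \<subseteq> ball 0 R - pts" using n nr pts by force
  qed auto
  have B: "B \<ge> 0"
  proof -
    have "cmod (E (of_real n)) \<le> B" using n by (intro bound) simp
    then show ?thesis using norm_ge_zero order_trans by blast
  qed
  have "cmod (contour_integral (circlepath 0 n) E) \<le> B * (2 * pi * n)"
    by (rule has_contour_integral_bound_circlepath[OF has_contour_integral_integral[OF integrable] B n])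
      (use bound in auto)
  then have "2 * pi * cmod (\<Sum>p\<in>pts. c p) \<le> 2 * pi * (B * n)"
    unfolding int' by (simp add: norm_mult mult_ac)
  then show ?thesis by simp
qed

section \<open>Lattice points and one row of the problem\<close>

definition half_pt :: "int \<Rightarrow> complex" where
  "half_pt m = of_int m + 1/2"

lemma norm_half_pt: "cmod (half_pt m) = \<bar>of_int m + 1/2\<bar>"
proof -
  have "half_pt m = of_real (of_int m + 1/2)" by (simp add: half_pt_def)
  then show ?thesis by (simp only: norm_of_real)
qed

lemma half_pt_less_iff: "cmod (half_pt m) < real n \<longleftrightarrow> m \<in> {- int n..<int n}"
  unfolding norm_half_pt by auto

text \<open>The radius n + 1/4 leaves room around the circle |z| = n without reaching the next
  lattice points, which have modulus n + 1/2.\<close>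

lemma half_pt_less: "cmod (half_pt m) < real n + 1/4 \<longleftrightarrow> m \<in> {- int n..<int n}"
  unfolding norm_half_pt by auto

lemma half_pt_inj: "half_pt m = half_pt l \<longleftrightarrow> m = l"
  by (simp add: half_pt_def)

lemma half_pt_nonzero: "half_pt m \<noteq> 0"
proof -
  have "real_of_int m + 1/2 \<noteq> 0"
  proof
    assume "real_of_int m + 1/2 = 0"
    then have "real_of_int (2 * m + 1) = 0" by simp
    then have "2 * m + 1 = 0" by (simp only: of_int_eq_0_iff)
    then show False by presburger
  qed
  then show ?thesis using norm_half_pt[of m] by auto
qed

lemma inj_half_pt: "inj_on half_pt A" by (simp add: inj_on_def half_pt_inj)

text \<open>One row \<open>(y1, y2)\<close> of the Riemann--Hilbert problem, with $f = (u, v)$, $g = (v, -u)$ and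
  $\kappa = 1 / (1 - M(a,a))$ at the lattice point \<open>half_pt m\<close>; the functions \<open>h1 m\<close>, \<open>h2 m\<close> are the
  regularisations of the row times $I - W/(z-a)$.\<close>
definition rh_row :: "(int \<Rightarrow> complex) \<Rightarrow> (int \<Rightarrow> complex) \<Rightarrow> (int \<Rightarrow> complex) \<Rightarrow> (complex \<Rightarrow> complex) \<Rightarrow> (complex \<Rightarrow> complex)
    \<Rightarrow> (int \<Rightarrow> complex \<Rightarrow> complex) \<Rightarrow> (int \<Rightarrow> complex \<Rightarrow> complex) \<Rightarrow> bool" where
  "rh_row u v \<kappa> y1 y2 h1 h2 \<longleftrightarrow>
     y1 holomorphic_on (- range half_pt) \<and> y2 holomorphic_on (- range half_pt) \<and>
     (\<forall>m. \<exists>r>0. h1 m holomorphic_on ball (half_pt m) r \<and> h2 m holomorphic_on ball (half_pt m) r \<and>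
       (\<forall>z\<in>ball (half_pt m) r - {half_pt m}.
          h1 m z = y1 z - \<kappa> m * v m * (u m * y1 z + v m * y2 z) / (z - half_pt m) \<and>
          h2 m z = y2 z + \<kappa> m * u m * (u m * y1 z + v m * y2 z) / (z - half_pt m)))"

text \<open>The value at \<open>half_pt m\<close> of the regular function u_m y1 + v_m y2, expressed
  through the regularisations because y1 and y2 may have poles there.\<close>

definition rh_val :: "(int \<Rightarrow> complex) \<Rightarrow> (int \<Rightarrow> complex) \<Rightarrow> (int \<Rightarrow> complex \<Rightarrow> complex) \<Rightarrow> (int \<Rightarrow> complex \<Rightarrow> complex) \<Rightarrow> int \<Rightarrow> complex" where
  "rh_val u v h1 h2 m = u m * h1 m (half_pt m) + v m * h2 m (half_pt m)"

text \<open>The combination $\langle f, (y_1, y_2)\rangle$ is regular at its own lattice point since $\langle g, f\rangle = 0$.\<close>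
lemma rh_row_local:
  assumes "rh_row u v \<kappa> y1 y2 h1 h2"
  obtains r where "r > 0" "h1 m holomorphic_on ball (half_pt m) r" "h2 m holomorphic_on ball (half_pt m) r"
    "\<And>z. z \<in> ball (half_pt m) r - {half_pt m} \<Longrightarrow> u m * y1 z + v m * y2 z = u m * h1 m z + v m * h2 m z"
    "\<And>z. z \<in> ball (half_pt m) r - {half_pt m} \<Longrightarrow> y1 z = ((z - half_pt m) * h1 m z + \<kappa> m * v m * (u m * h1 m z + v m * h2 m z)) / (z - half_pt m)"
    "\<And>z. z \<in> ball (half_pt m) r - {half_pt m} \<Longrightarrow> y2 z = ((z - half_pt m) * h2 m z - \<kappa> m * u m * (u m * h1 m z + v m * h2 m z)) / (z - half_pt m)"
proof -
  obtain r where r: "r > 0" "h1 m holomorphic_on ball (half_pt m) r" "h2 m holomorphic_on ball (half_pt m) r"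
    and eq: "\<And>z. z \<in> ball (half_pt m) r - {half_pt m} \<Longrightarrow>
          h1 m z = y1 z - \<kappa> m * v m * (u m * y1 z + v m * y2 z) / (z - half_pt m) \<and>
          h2 m z = y2 z + \<kappa> m * u m * (u m * y1 z + v m * y2 z) / (z - half_pt m)"
    using assms unfolding rh_row_def by blast
  have c: "u m * y1 z + v m * y2 z = u m * h1 m z + v m * h2 m z" if "z \<in> ball (half_pt m) r - {half_pt m}" for z
  proof -
    define t where "t = (u m * y1 z + v m * y2 z) / (z - half_pt m)"
    have a: "h1 m z = y1 z - \<kappa> m * v m * t" and b: "h2 m z = y2 z + \<kappa> m * u m * t"
      using eq[OF that] by (simp_all add: t_def)
    show ?thesis unfolding a b by (simp add: algebra_simps)
  qed
  have "y1 z = ((z - half_pt m) * h1 m z + \<kappa> m * v m * (u m * h1 m z + v m * h2 m z)) / (z - half_pt m)"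
       "y2 z = ((z - half_pt m) * h2 m z - \<kappa> m * u m * (u m * h1 m z + v m * h2 m z)) / (z - half_pt m)"
    if z: "z \<in> ball (half_pt m) r - {half_pt m}" for z
  proof -
    have nz: "z - half_pt m \<noteq> 0" using z by auto
    have "y1 z = h1 m z + \<kappa> m * v m * (u m * h1 m z + v m * h2 m z) / (z - half_pt m)"
      "y2 z = h2 m z - \<kappa> m * u m * (u m * h1 m z + v m * h2 m z) / (z - half_pt m)"
      using eq[OF z] unfolding c[OF z, symmetric] by simp_all
    then show "y1 z = ((z - half_pt m) * h1 m z + \<kappa> m * v m * (u m * h1 m z + v m * h2 m z)) / (z - half_pt m)"
       "y2 z = ((z - half_pt m) * h2 m z - \<kappa> m * u m * (u m * h1 m z + v m * h2 m z)) / (z - half_pt m)"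
      using nz by (simp_all add: add_divide_distrib diff_divide_distrib)
  qed
  then show ?thesis using that[OF r] c by blast
qed

text \<open>The residue of the row (y1, y2) is \<kappa> times \<open>rh_val\<close> times the vector
  g = (v, -u); pairing it with (x, y) gives the stated numerator.\<close>

lemma lin_comb_pole:
  assumes row: "rh_row u v \<kappa> y1 y2 h1 h2"
  obtains r h where "r > 0" "h holomorphic_on ball (half_pt m) r"
    "h (half_pt m) = \<kappa> m * rh_val u v h1 h2 m * (x * v m - y * u m)"
    "\<And>z. z \<in> ball (half_pt m) r - {half_pt m} \<Longrightarrow> x * y1 z + y * y2 z = h z / (z - half_pt m)"
proof -
  obtain r where r: "r > 0" "h1 m holomorphic_on ball (half_pt m) r" "h2 m holomorphic_on ball (half_pt m) r"
    and y: "\<And>z. z \<in> ball (half_pt m) r - {half_pt m} \<Longrightarrow> y1 z = ((z - half_pt m) * h1 m z + \<kappa> m * v m * (u m * h1 m z + v m * h2 m z)) / (z - half_pt m)"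
    "\<And>z. z \<in> ball (half_pt m) r - {half_pt m} \<Longrightarrow> y2 z = ((z - half_pt m) * h2 m z - \<kappa> m * u m * (u m * h1 m z + v m * h2 m z)) / (z - half_pt m)"
    using rh_row_local[OF row, of m] by metis
  define h where "h z = x * ((z - half_pt m) * h1 m z + \<kappa> m * v m * (u m * h1 m z + v m * h2 m z))
     + y * ((z - half_pt m) * h2 m z - \<kappa> m * u m * (u m * h1 m z + v m * h2 m z))" for z
  have "h holomorphic_on ball (half_pt m) r" unfolding h_def by (intro holomorphic_intros r)
  moreover have "h (half_pt m) = \<kappa> m * rh_val u v h1 h2 m * (x * v m - y * u m)"
    by (simp add: h_def rh_val_def algebra_simps)
  moreover have "x * y1 z + y * y2 z = h z / (z - half_pt m)" if "z \<in> ball (half_pt m) r - {half_pt m}" for z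
    unfolding y(1)[OF that] y(2)[OF that] h_def
    by (simp only: add_divide_distrib[symmetric] times_divide_eq_right)
  ultimately show ?thesis using that r(1) by blast
qed

lemma sum_half_pt: "(\<Sum>p\<in>half_pt ` A. f p) = (\<Sum>m\<in>A. f (half_pt m))"
  by (simp add: sum.reindex[OF inj_half_pt])

lemma holomorphic_on_hp_ball:
  assumes "f holomorphic_on (- range half_pt)"
  shows "f holomorphic_on (ball 0 (real n + 1/4) - half_pt ` {- int n..<int n})"
proof (rule holomorphic_on_subset[OF assms])
  show "ball 0 (real n + 1/4) - half_pt ` {- int n..<int n} \<subseteq> - range half_pt"
  proof
    fix z assume z: "z \<in> ball 0 (real n + 1/4) - half_pt ` {- int n..<int n}"
    then have "cmod z < real n + 1/4" by simp
    then have "z \<noteq> half_pt m" for m using half_pt_less[of m n] z by auto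
    then show "z \<in> - range half_pt" by blast
  qed
qed

text \<open>Residues of $z^e (x y_1 + y y_2 - x - \gamma / z)$ on the circle $|z| = n$.\<close>
lemma row_moment_bound:
  assumes row: "rh_row u v \<kappa> y1 y2 h1 h2" and n: "n > 0"
    and bound: "\<And>z. cmod z = real n \<Longrightarrow> cmod (x * y1 z + y * y2 z - x - \<gamma> / z) \<le> B"
  shows "cmod ((\<Sum>m = - int n..<int n. \<kappa> m * rh_val u v h1 h2 m * (x * v m - y * u m) * half_pt m ^ e) - \<gamma> * 0 ^ e) \<le> B * real n ^ e * real n"
proof -
  let ?A = "{- int n..<int n}"
  let ?pts = "insert 0 (half_pt ` ?A)"
  define E where "E z = z ^ e * (x * y1 z + y * y2 z - x - \<gamma> / z)" for z
  \<comment> \<open>The only residue at 0 is that of - \<gamma> / z, present for \<open>e\<close> =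
    0 alone, which \<open>0 ^ e\<close> encodes. The description operator merely inverts
    \<open>half_pt\<close>.\<close>
  define c where "c p = (if p = 0 then - \<gamma> * 0 ^ e else (\<lambda>m. \<kappa> m * rh_val u v h1 h2 m * (x * v m - y * u m) * half_pt m ^ e) (THE m. half_pt m = p))" for p
  have the: "(THE l. half_pt l = half_pt m) = m" for m by (rule the_equality) (auto simp: half_pt_inj)
  have c_hp: "c (half_pt m) = \<kappa> m * rh_val u v h1 h2 m * (x * v m - y * u m) * half_pt m ^ e" for m
    by (simp add: c_def half_pt_nonzero the)
  have y_holo: "y1 holomorphic_on (- range half_pt)" "y2 holomorphic_on (- range half_pt)" using row by (auto simp: rh_row_def)
  have "cmod (\<Sum>p\<in>?pts. c p) \<le> (B * real n ^ e) * real n"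
  proof (rule residue_sum_bound[where E = E and R = "real n + 1/4"])
    show "real n > 0" using n by simp
    show "finite ?pts" by simp
    show "cmod p < real n" if "p \<in> ?pts" for p using that n half_pt_less_iff by auto
    have "y1 holomorphic_on (ball 0 (real n + 1/4) - ?pts)" "y2 holomorphic_on (ball 0 (real n + 1/4) - ?pts)"
      by (rule holomorphic_on_subset[OF holomorphic_on_hp_ball[OF y_holo(1)]], blast,
          rule holomorphic_on_subset[OF holomorphic_on_hp_ball[OF y_holo(2)]], blast)
    then show "E holomorphic_on ball 0 (real n + 1/4) - ?pts"
      unfolding E_def by (intro holomorphic_intros) auto
    show "cmod (E z) \<le> B * real n ^ e" if "cmod z = real n" for z
      using mult_right_mono[OF bound[OF that], of "real n ^ e"] that by (simp add: E_def norm_mult norm_power mult.commute)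
  next
    fix p assume "p \<in> ?pts"
    then consider "p = 0" | m where "p = half_pt m" "m \<in> ?A" by auto
    then show "\<exists>r>0. \<exists>h. h holomorphic_on ball p r \<and> h p = c p \<and> (\<forall>z\<in>ball p r - {p}. E z = h z / (z - p))"
    proof cases
      case 1
      have sub: "ball 0 (1/4) \<subseteq> - range half_pt"
      proof
        fix z :: complex assume "z \<in> ball 0 (1/4)"
        then have "z \<noteq> half_pt m" for m using half_pt_less[of m 0] by auto
        then show "z \<in> - range half_pt" by blast
      qed
      define h where "h z = z ^ e * (z * (x * y1 z + y * y2 z - x) - \<gamma>)" for z
      have "h holomorphic_on ball 0 (1/4)"
        unfolding h_def by (intro holomorphic_intros holomorphic_on_subset[OF y_holo(1) sub] holomorphic_on_subset[OF y_holo(2) sub])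
      moreover have "h 0 = c 0" by (simp add: h_def c_def)
      moreover have "E z = h z / (z - 0)" if "z \<in> ball 0 (1/4) - {0}" for z
        using that by (simp add: E_def h_def field_simps)
      ultimately show ?thesis using 1 by (intro exI[of _ "1/4"] conjI exI[of _ h]) auto
    next
      case 2
      obtain r h where r: "r > 0" and h: "h holomorphic_on ball (half_pt m) r"
        "h (half_pt m) = \<kappa> m * rh_val u v h1 h2 m * (x * v m - y * u m)"
        and eq: "\<And>z. z \<in> ball (half_pt m) r - {half_pt m} \<Longrightarrow> x * y1 z + y * y2 z = h z / (z - half_pt m)"
        using lin_comb_pole[OF row, of m x y] by metis
      \<comment> \<open>A disc around the lattice point that avoids the possible pole at 0.\<close>
      define r' where "r' = min r (cmod (half_pt m))"
      have r': "r' > 0" using r half_pt_nonzero[of m] by (simp add: r'_def)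
      have nz: "z \<noteq> 0" if "z \<in> ball (half_pt m) r'" for z using that by (auto simp: r'_def)
      define k where "k z = z ^ e * (h z - (z - half_pt m) * (x + \<gamma> / z))" for z
      have "h holomorphic_on ball (half_pt m) r'" by (rule holomorphic_on_subset[OF h(1)]) (auto simp: r'_def)
      then have "k holomorphic_on ball (half_pt m) r'" unfolding k_def using nz by (intro holomorphic_intros) auto
      moreover have "k (half_pt m) = c (half_pt m)" by (simp add: k_def c_hp h(2) mult_ac)
      moreover have "E z = k z / (z - half_pt m)" if z: "z \<in> ball (half_pt m) r' - {half_pt m}" for z
      proof -
        have "z \<in> ball (half_pt m) r - {half_pt m}" using z by (auto simp: r'_def)
        from eq[OF this] have hz: "h z = (x * y1 z + y * y2 z) * (z - half_pt m)" using z by simp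
        have alg: "P * (q * d - d * (x + w)) = P * (q - x - w) * d" for P q d w :: complex
          by (simp add: algebra_simps)
        have "k z = E z * (z - half_pt m)" unfolding k_def E_def hz by (rule alg)
        then show ?thesis using z by simp
      qed
      ultimately show ?thesis using 2 r' by (intro exI[of _ r'] conjI exI[of _ k]) auto
    qed
  qed auto
  moreover have "0 \<notin> half_pt ` ?A" using half_pt_nonzero by auto
  then have "(\<Sum>p\<in>?pts. c p) = c 0 + (\<Sum>m\<in>?A. c (half_pt m))" by (simp add: sum_half_pt)
  ultimately show ?thesis unfolding c_hp by (simp add: c_def mult.assoc)
qed

text \<open>Residues of (u_b y1 + v_b y2 - u_b) / (z - b). At the point b itself the numerator is
  regular, which yields the value minus u_b; the other points give the Cauchy-type quotient that
  Christoffel--Darboux later identifies with an off-diagonal entry of M.\<close>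

lemma row_value_bound:
  assumes row: "rh_row u v \<kappa> y1 y2 h1 h2" and n: "n > 0" and b: "b \<in> {- int n..<int n}"
    and bound: "\<And>z. cmod z = real n \<Longrightarrow> cmod (u b * y1 z + v b * y2 z - u b) \<le> B"
  shows "cmod (rh_val u v h1 h2 b - u b
      - (\<Sum>m\<in>{- int n..<int n} - {b}. \<kappa> m * rh_val u v h1 h2 m * (v m * u b - u m * v b) / (half_pt b - half_pt m)))
      \<le> B / (real n - cmod (half_pt b)) * real n"
proof -
  let ?A = "{- int n..<int n}"
  define E where "E z = (u b * y1 z + v b * y2 z - u b) / (z - half_pt b)" for z
  define d where "d m = (if m = b then rh_val u v h1 h2 b - u b
     else \<kappa> m * rh_val u v h1 h2 m * (v m * u b - u m * v b) / (half_pt m - half_pt b))" for m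
  have the: "(THE l. half_pt l = half_pt m) = m" for m by (rule the_equality) (auto simp: half_pt_inj)
  have y_holo: "y1 holomorphic_on (- range half_pt)" "y2 holomorphic_on (- range half_pt)" using row by (auto simp: rh_row_def)
  have hb: "cmod (half_pt b) < real n" using b half_pt_less_iff by blast
  have "cmod (\<Sum>p\<in>half_pt ` ?A. d (THE l. half_pt l = p)) \<le> (B / (real n - cmod (half_pt b))) * real n"
  proof (rule residue_sum_bound[where E = E and R = "real n + 1/4"])
    show "real n > 0" using n by simp
    show "cmod p < real n" if "p \<in> half_pt ` ?A" for p using that half_pt_less_iff by auto
    show "E holomorphic_on ball 0 (real n + 1/4) - half_pt ` ?A"
      unfolding E_def using b
      by (intro holomorphic_intros holomorphic_on_hp_ball[OF y_holo(1)] holomorphic_on_hp_ball[OF y_holo(2)]) auto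
    show "cmod (E z) \<le> B / (real n - cmod (half_pt b))" if z: "cmod z = real n" for z
    proof -
      have "real n - cmod (half_pt b) \<le> cmod (z - half_pt b)" using norm_triangle_ineq2[of z "half_pt b"] z by simp
      moreover have "0 \<le> B" using bound[OF z] norm_ge_zero order_trans by blast
      ultimately show ?thesis unfolding E_def norm_divide using bound[OF z] hb by (intro frac_le) auto
    qed
  next
    fix p assume "p \<in> half_pt ` ?A"
    then obtain m where p: "p = half_pt m" "m \<in> ?A" by auto
    show "\<exists>r>0. \<exists>h. h holomorphic_on ball p r \<and> h p = d (THE l. half_pt l = p) \<and> (\<forall>z\<in>ball p r - {p}. E z = h z / (z - p))"
    proof (cases "m = b")
      case True
      obtain r where r: "r > 0" "h1 m holomorphic_on ball (half_pt m) r" "h2 m holomorphic_on ball (half_pt m) r"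
        and eq: "\<And>z. z \<in> ball (half_pt m) r - {half_pt m} \<Longrightarrow> u m * y1 z + v m * y2 z = u m * h1 m z + v m * h2 m z"
        using rh_row_local[OF row, of m] by metis
      define k where "k z = u m * h1 m z + v m * h2 m z - u m" for z
      have "k holomorphic_on ball (half_pt m) r" unfolding k_def by (intro holomorphic_intros r)
      moreover have "k (half_pt m) = d m" using True by (simp add: k_def d_def rh_val_def)
      moreover have "E z = k z / (z - half_pt m)" if "z \<in> ball (half_pt m) r - {half_pt m}" for z
        using eq[OF that] True by (simp add: E_def k_def)
      ultimately show ?thesis using r(1) p unfolding p the by (intro exI[of _ r] conjI exI[of _ k]) auto
    next
      case False
      obtain r h where r: "r > 0" and h: "h holomorphic_on ball (half_pt m) r"
        "h (half_pt m) = \<kappa> m * rh_val u v h1 h2 m * (u b * v m - v b * u m)"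
        and eq: "\<And>z. z \<in> ball (half_pt m) r - {half_pt m} \<Longrightarrow> u b * y1 z + v b * y2 z = h z / (z - half_pt m)"
        using lin_comb_pole[OF row, of m "u b" "v b"] by metis
      define r' where "r' = min r (dist (half_pt m) (half_pt b))"
      have r': "r' > 0" using r False by (simp add: r'_def half_pt_inj)
      have nz: "z \<noteq> half_pt b" if "z \<in> ball (half_pt m) r'" for z using that by (auto simp: r'_def)
      define k where "k z = (h z - (z - half_pt m) * u b) / (z - half_pt b)" for z
      have "h holomorphic_on ball (half_pt m) r'" by (rule holomorphic_on_subset[OF h(1)]) (auto simp: r'_def)
      then have "k holomorphic_on ball (half_pt m) r'" unfolding k_def using nz by (intro holomorphic_intros) auto
      moreover have "k (half_pt m) = d m" using False by (simp add: k_def d_def h(2) mult_ac)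
      moreover have "E z = k z / (z - half_pt m)" if z: "z \<in> ball (half_pt m) r' - {half_pt m}" for z
      proof -
        have "z \<in> ball (half_pt m) r - {half_pt m}" using z by (auto simp: r'_def)
        from eq[OF this] have e: "u b * y1 z + v b * y2 z - u b = (h z - (z - half_pt m) * u b) / (z - half_pt m)"
          using z by (simp add: diff_divide_distrib)
        show ?thesis unfolding E_def k_def e by (simp add: mult.commute)
      qed
      ultimately show ?thesis using r' unfolding p the by (intro exI[of _ r'] conjI exI[of _ k]) auto
    qed
  qed auto
  moreover have "(\<Sum>p\<in>half_pt ` ?A. d (THE l. half_pt l = p)) = rh_val u v h1 h2 b - u b
      - (\<Sum>m\<in>?A - {b}. \<kappa> m * rh_val u v h1 h2 m * (v m * u b - u m * v b) / (half_pt b - half_pt m))"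
  proof -
    have "(\<Sum>p\<in>half_pt ` ?A. d (THE l. half_pt l = p)) = d b + (\<Sum>m\<in>?A - {b}. d m)"
      unfolding sum_half_pt the using b by (simp add: sum.remove)
    also have "(\<Sum>m\<in>?A - {b}. d m) = (\<Sum>m\<in>?A - {b}. - (\<kappa> m * rh_val u v h1 h2 m * (v m * u b - u m * v b) / (half_pt b - half_pt m)))"
    proof (intro sum.cong refl)
      fix m assume "m \<in> ?A - {b}"
      then have "m \<noteq> b" by simp
      moreover have "half_pt m - half_pt b = - (half_pt b - half_pt m)" by simp
      ultimately show "d m = - (\<kappa> m * rh_val u v h1 h2 m * (v m * u b - u m * v b) / (half_pt b - half_pt m))"
        unfolding d_def by (simp only: if_False divide_minus_right)
    qed
    finally show ?thesis by (simp add: d_def sum_negf)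
  qed
  ultimately show ?thesis by simp
qed

text \<open>Passing from n to n + 1 adds the two points with codes n and -n - 1, that is, n + 1/2
  and its negative. The zeroth moments control the sum of the two residues and the first moments
  their difference, so each residue is O(1/n).\<close>

lemma moments_decay:
  fixes r :: "int \<Rightarrow> complex"
  assumes m0: "\<And>n. n \<ge> N \<Longrightarrow> n > 0 \<Longrightarrow> cmod ((\<Sum>m = - int n..<int n. r m) - \<gamma>) \<le> C / real n"
    and m1: "\<And>n. n \<ge> N \<Longrightarrow> n > 0 \<Longrightarrow> cmod (\<Sum>m = - int n..<int n. r m * half_pt m) \<le> C"
  shows "(\<lambda>n. \<Sum>m = - int n..<int n. r m) \<longlonglongrightarrow> \<gamma>"
    and "\<exists>K. \<forall>m. cmod (r m) * cmod (half_pt m) \<le> K"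
proof -
  have "(\<lambda>n. C / real n) \<longlonglongrightarrow> 0" by (rule lim_const_over_n)
  then have "(\<lambda>n. (\<Sum>m = - int n..<int n. r m) - \<gamma>) \<longlonglongrightarrow> 0"
    by (rule Lim_null_comparison[rotated])
      (use m0 in \<open>auto simp: eventually_sequentially intro!: exI[of _ "Suc N"]\<close>)
  then show "(\<lambda>n. \<Sum>m = - int n..<int n. r m) \<longlonglongrightarrow> \<gamma>" by (rule LIM_zero_cancel)
  define N' where "N' = Suc N"
  have C: "C \<ge> 0" using order_trans[OF norm_ge_zero m1[of N']] by (simp add: N'_def)
  have big: "cmod (r (int n)) * (real n + 1/2) \<le> 3 * C \<and> cmod (r (- int n - 1)) * (real n + 1/2) \<le> 3 * C" if "n \<ge> N'" for n
  proof -
    let ?A = "{- int n..<int n}" and ?a = "r (int n)" and ?b = "r (- int n - 1)"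
    have n: "n \<ge> N" "n > 0" using that by (auto simp: N'_def)
    have A: "{- int (Suc n)..<int (Suc n)} = insert (int n) (insert (- int n - 1) ?A)" by auto
    have "(\<Sum>m = - int (Suc n)..<int (Suc n). r m) - (\<Sum>m\<in>?A. r m) = ?a + ?b"
      unfolding A by simp
    then have "?a + ?b = ((\<Sum>m = - int (Suc n)..<int (Suc n). r m) - \<gamma>) - ((\<Sum>m\<in>?A. r m) - \<gamma>)" by simp
    then have "cmod (?a + ?b) \<le> C / real (Suc n) + C / real n"
      using norm_triangle_ineq4[of "(\<Sum>m = - int (Suc n)..<int (Suc n). r m) - \<gamma>" "(\<Sum>m\<in>?A. r m) - \<gamma>"]
        m0[of "Suc n"] m0[of n] n by simp
    also have "\<dots> \<le> 2 * (C / real n)"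
    proof -
      have "C / real (Suc n) \<le> C / real n" using C n by (intro divide_left_mono) auto
      then show ?thesis by simp
    qed
    finally have "cmod (?a + ?b) * (real n + 1/2) \<le> 2 * (C / real n) * (real n + 1/2)"
      by (intro mult_right_mono) auto
    also have "2 * (C / real n) * (real n + 1/2) = 2 * C + C / real n" using n by (simp add: field_simps)
    also have "\<dots> \<le> 3 * C" using C n divide_left_mono[of 1 "real n" C] by simp
    finally have p: "cmod (?a + ?b) * (real n + 1/2) \<le> 3 * C" .
    have "(\<Sum>m = - int (Suc n)..<int (Suc n). r m * half_pt m) - (\<Sum>m\<in>?A. r m * half_pt m) = ?a * half_pt (int n) + ?b * half_pt (- int n - 1)"
      unfolding A by simp
    also have "\<dots> = (?a - ?b) * of_real (real n + 1/2)" by (simp add: half_pt_def algebra_simps)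
    finally have eq: "(?a - ?b) * of_real (real n + 1/2) = (\<Sum>m = - int (Suc n)..<int (Suc n). r m * half_pt m) - (\<Sum>m\<in>?A. r m * half_pt m)" ..
    have "cmod ((?a - ?b) * of_real (real n + 1/2)) \<le> C + C"
      unfolding eq
      using norm_triangle_ineq4[of "\<Sum>m = - int (Suc n)..<int (Suc n). r m * half_pt m" "\<Sum>m\<in>?A. r m * half_pt m"]
        m1[of "Suc n"] m1[of n] n by simp
    then have q: "cmod (?a - ?b) * (real n + 1/2) \<le> 2 * C" unfolding norm_mult by (simp add: abs_of_nonneg del: of_real_add)
    have "2 * cmod ?a \<le> cmod (?a + ?b) + cmod (?a - ?b)"
    proof -
      have "(?a + ?b) + (?a - ?b) = 2 * ?a" by simp
      then show ?thesis using norm_triangle_ineq[of "?a + ?b" "?a - ?b"] by (simp only: norm_mult norm_numeral)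
    qed
    moreover have "2 * cmod ?b \<le> cmod (?a + ?b) + cmod (?a - ?b)"
    proof -
      have "(?a + ?b) - (?a - ?b) = 2 * ?b" by simp
      then show ?thesis using norm_triangle_ineq4[of "?a + ?b" "?a - ?b"] by (simp only: norm_mult norm_numeral)
    qed
    ultimately have "2 * cmod ?a * (real n + 1/2) \<le> (cmod (?a + ?b) + cmod (?a - ?b)) * (real n + 1/2)"
      "2 * cmod ?b * (real n + 1/2) \<le> (cmod (?a + ?b) + cmod (?a - ?b)) * (real n + 1/2)"
      by (auto intro!: mult_right_mono)
    then show ?thesis using p q C unfolding distrib_right by linarith
  qed
  define K where "K = 3 * C + (\<Sum>m = - int N'..<int N'. cmod (r m) * cmod (half_pt m))"
  have K: "3 * C \<le> K" unfolding K_def by (simp add: sum_nonneg)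
  have "cmod (r m) * cmod (half_pt m) \<le> K" for m
  proof (cases "m \<in> {- int N'..<int N'}")
    case True
    then have "cmod (r m) * cmod (half_pt m) \<le> (\<Sum>m = - int N'..<int N'. cmod (r m) * cmod (half_pt m))"
      by (intro member_le_sum) auto
    then show ?thesis using C by (simp add: K_def)
  next
    case False
    show ?thesis
    proof (cases "m \<ge> 0")
      case True
      then have "nat m \<ge> N'" "m = int (nat m)" using False by auto
      moreover from this(2) have "cmod (half_pt m) = real (nat m) + 1/2" unfolding norm_half_pt by linarith
      ultimately show ?thesis using big[of "nat m"] K by simp
    next
      case m: False
      define n where "n = nat (- m - 1)"
      have "n \<ge> N'" and m': "m = - int n - 1" using False m by (auto simp: n_def)
      moreover have "cmod (half_pt m) = real n + 1/2" unfolding norm_half_pt m' by simp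
      ultimately show ?thesis using big[of n] K by simp
    qed
  qed
  then show "\<exists>K. \<forall>m. cmod (r m) * cmod (half_pt m) \<le> K" by blast
qed

section \<open>Coefficients at infinity and the size of the values\<close>

definition row_expansion :: "(complex \<Rightarrow> complex) \<Rightarrow> (complex \<Rightarrow> complex) \<Rightarrow> complex \<Rightarrow> complex \<Rightarrow> bool" where
  "row_expansion y1 y2 \<alpha> \<beta> \<longleftrightarrow> (\<exists>C N. \<forall>n\<ge>N. \<forall>z. cmod z = real n \<longrightarrow>
     cmod (y1 z - 1 - \<alpha> / z) \<le> C / (real n)\<^sup>2 \<and> cmod (y2 z - \<beta> / z) \<le> C / (real n)\<^sup>2)"

text \<open>Multiplied by z^e and integrated over |z| = n, the error C/n^2 becomes C/n for e = 0 and
  C for e = 1, the two inputs of \<open>moments_decay\<close>.\<close>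

lemma row_coefficients:
  assumes row: "rh_row u v \<kappa> y1 y2 h1 h2" and ex: "row_expansion y1 y2 \<alpha> \<beta>"
  defines "G \<equiv> \<lambda>m. \<kappa> m * rh_val u v h1 h2 m"
  shows "(\<lambda>n. \<Sum>m = - int n..<int n. G m * v m) \<longlonglongrightarrow> \<alpha>"
    and "(\<lambda>n. \<Sum>m = - int n..<int n. - G m * u m) \<longlonglongrightarrow> \<beta>"
    and "\<exists>K. \<forall>m. cmod (G m * v m) * cmod (half_pt m) \<le> K \<and> cmod (G m * u m) * cmod (half_pt m) \<le> K"
    and "(\<lambda>n. \<Sum>m\<in>{- int n..<int n} - {b}. G m * (v m * u b - u m * v b) / (half_pt b - half_pt m))
           \<longlonglongrightarrow> rh_val u v h1 h2 b - u b"
proof -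
  obtain C N where ex1: "\<And>n z. n \<ge> N \<Longrightarrow> cmod z = real n \<Longrightarrow> cmod (y1 z - 1 - \<alpha> / z) \<le> C / (real n)\<^sup>2"
    and ex2: "\<And>n z. n \<ge> N \<Longrightarrow> cmod z = real n \<Longrightarrow> cmod (y2 z - \<beta> / z) \<le> C / (real n)\<^sup>2"
    using ex unfolding row_expansion_def by blast
  have C1: "C / (real n)\<^sup>2 * real n ^ 0 * real n = C / real n" "C / (real n)\<^sup>2 * real n ^ 1 * real n = C" if "n > 0" for n
    using that by (simp_all add: power2_eq_square)
  have mom_v: "cmod ((\<Sum>m = - int n..<int n. G m * v m * half_pt m ^ e) - \<alpha> * 0 ^ e) \<le> C / (real n)\<^sup>2 * real n ^ e * real n"
    if "n \<ge> N" "n > 0" for n e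
    using row_moment_bound[OF row that(2), of 1 0 \<alpha> "C / (real n)\<^sup>2" e] ex1[OF that(1)] unfolding G_def by simp
  have mom_u: "cmod ((\<Sum>m = - int n..<int n. - G m * u m * half_pt m ^ e) - \<beta> * 0 ^ e) \<le> C / (real n)\<^sup>2 * real n ^ e * real n"
    if "n \<ge> N" "n > 0" for n e
    using row_moment_bound[OF row that(2), of 0 1 \<beta> "C / (real n)\<^sup>2" e] ex2[OF that(1)] unfolding G_def by simp
  have v0: "cmod ((\<Sum>m = - int n..<int n. G m * v m) - \<alpha>) \<le> C / real n"
    and v1: "cmod (\<Sum>m = - int n..<int n. G m * v m * half_pt m) \<le> C"
    and u0: "cmod ((\<Sum>m = - int n..<int n. - G m * u m) - \<beta>) \<le> C / real n"
    and u1: "cmod (\<Sum>m = - int n..<int n. - G m * u m * half_pt m) \<le> C" if "n \<ge> N" "n > 0" for n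
    using mom_v[OF that, of 0, unfolded C1(1)[OF that(2)]] mom_v[OF that, of 1, unfolded C1(2)[OF that(2)]]
      mom_u[OF that, of 0, unfolded C1(1)[OF that(2)]] mom_u[OF that, of 1, unfolded C1(2)[OF that(2)]] by simp_all
  show "(\<lambda>n. \<Sum>m = - int n..<int n. G m * v m) \<longlonglongrightarrow> \<alpha>" by (rule moments_decay(1)[OF v0 v1])
  show "(\<lambda>n. \<Sum>m = - int n..<int n. - G m * u m) \<longlonglongrightarrow> \<beta>" by (rule moments_decay(1)[OF u0 u1])
  obtain K1 where K1: "\<And>m. cmod (G m * v m) * cmod (half_pt m) \<le> K1" using moments_decay(2)[OF v0 v1] by blast
  obtain K2 where K2: "\<And>m. cmod (- G m * u m) * cmod (half_pt m) \<le> K2" using moments_decay(2)[OF u0 u1] by blast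
  show "\<exists>K. \<forall>m. cmod (G m * v m) * cmod (half_pt m) \<le> K \<and> cmod (G m * u m) * cmod (half_pt m) \<le> K"
  proof (intro exI allI conjI)
    fix m
    show "cmod (G m * v m) * cmod (half_pt m) \<le> max K1 K2" using K1[of m] by simp
    show "cmod (G m * u m) * cmod (half_pt m) \<le> max K1 K2" using K2[of m] by (simp add: norm_mult)
  qed
  let ?s = "\<lambda>n. \<Sum>m\<in>{- int n..<int n} - {b}. G m * (v m * u b - u m * v b) / (half_pt b - half_pt m)"
  \<comment> \<open>On |z| = n both y1 - 1 and y2 are O(1/n), and D/n bounds their combination with
    weights u_b, v_b. Dividing by the distance to the point b leaves a bound that tends to
    0.\<close>
  define D where "D = cmod (u b) * (cmod \<alpha> + C) + cmod (v b) * (cmod \<beta> + C)"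
  define B where "B n = D / (real n - cmod (half_pt b))" for n
  have ev: "\<forall>\<^sub>F n in sequentially. cmod (?s n - (rh_val u v h1 h2 b - u b)) \<le> B n"
    using eventually_ge_at_top[of "nat \<bar>b\<bar> + 2 + N"]
  proof eventually_elim
    case (elim n)
    then have n: "n > 0" "n \<ge> N" "b \<in> {- int n..<int n}" by auto
    have n1: "real n \<ge> 1" using n by simp
    have le: "C / (real n)\<^sup>2 \<le> C / real n"
    proof -
      have "0 \<le> C / (real n)\<^sup>2" using order_trans[OF norm_ge_zero ex1[OF n(2), of "of_nat n"]] by simp
      then have "C \<ge> 0" using n1 by (simp add: zero_le_divide_iff)
      then show ?thesis using n1 by (intro divide_left_mono) (auto simp: power2_eq_square)
    qed
    have "cmod (rh_val u v h1 h2 b - u b - ?s n) \<le> D / real n / (real n - cmod (half_pt b)) * real n"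
      unfolding G_def
    proof (rule row_value_bound[OF row n(1) n(3)])
      fix z assume z: "cmod z = real n"
      have "cmod (y1 z - 1) \<le> cmod (y1 z - 1 - \<alpha> / z) + cmod (\<alpha> / z)"
        using norm_triangle_ineq[of "y1 z - 1 - \<alpha> / z" "\<alpha> / z"] by simp
      also have "\<dots> \<le> C / real n + cmod \<alpha> / real n" using ex1[OF n(2) z] le z by (simp add: norm_divide)
      finally have 1: "cmod (y1 z - 1) \<le> (cmod \<alpha> + C) / real n" by (simp add: add_divide_distrib)
      have "cmod (y2 z) \<le> cmod (y2 z - \<beta> / z) + cmod (\<beta> / z)"
        using norm_triangle_ineq[of "y2 z - \<beta> / z" "\<beta> / z"] by simp
      also have "\<dots> \<le> C / real n + cmod \<beta> / real n" using ex2[OF n(2) z] le z by (simp add: norm_divide)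
      finally have 2: "cmod (y2 z) \<le> (cmod \<beta> + C) / real n" by (simp add: add_divide_distrib)
      have "u b * y1 z + v b * y2 z - u b = u b * (y1 z - 1) + v b * y2 z" by (simp add: algebra_simps)
      then have "cmod (u b * y1 z + v b * y2 z - u b) \<le> cmod (u b) * cmod (y1 z - 1) + cmod (v b) * cmod (y2 z)"
        using norm_triangle_ineq[of "u b * (y1 z - 1)" "v b * y2 z"] by (simp only: norm_mult)
      also have "\<dots> \<le> cmod (u b) * ((cmod \<alpha> + C) / real n) + cmod (v b) * ((cmod \<beta> + C) / real n)"
        by (intro add_mono mult_left_mono 1 2) auto
      also have "\<dots> = D / real n" by (simp only: D_def add_divide_distrib[symmetric] times_divide_eq_right)
      finally show "cmod (u b * y1 z + v b * y2 z - u b) \<le> D / real n" .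
    qed
    also have "\<dots> = B n" using n by (simp add: B_def)
    finally show ?case by (subst norm_minus_commute)
  qed
  have "B \<longlonglongrightarrow> 0" unfolding B_def[abs_def]
  proof (intro tendsto_divide_0[OF tendsto_const] filterlim_at_top_imp_at_infinity)
    show "filterlim (\<lambda>n. real n - cmod (half_pt b)) at_top sequentially"
      using filterlim_tendsto_add_at_top[OF tendsto_const[of "- cmod (half_pt b)"] filterlim_real_sequentially] by simp
  qed
  then have "(\<lambda>n. ?s n - (rh_val u v h1 h2 b - u b)) \<longlonglongrightarrow> 0"
    by (rule Lim_null_comparison[OF ev])
  then show "?s \<longlonglongrightarrow> rh_val u v h1 h2 b - u b" by (rule LIM_zero_cancel)
qed

text \<open>The product of the two reciprocals is at most half the sum of their squares, and each
  square is summable over the lattice by a translate of the same series. Hence the bound is uniform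
  in \<open>b\<close>. The constants 8 and 2 are half of 16 and 4.\<close>

lemma lattice_sum_bound:
  obtains Z where "Z \<ge> 0" "\<And>A b. finite A \<Longrightarrow> (\<Sum>m\<in>A - {b}. 1 / (cmod (half_pt m) * cmod (half_pt b - half_pt m))) \<le> Z"
proof -
  define w where "w m = 1 / (real (nat \<bar>m\<bar>) + 1)\<^sup>2" for m :: int
  have "summable (\<lambda>n. 1 / (real n + 1)\<^sup>2)"
    using inverse_power_summable[of 2, where 'a = real] summable_Suc_iff[of "\<lambda>n. inverse (real n ^ 2)"]
    by (simp add: inverse_eq_divide add.commute)
  then have ws: "w summable_on UNIV" unfolding w_def by (rule summable_on_int) simp
  define W where "W = infsum w UNIV"
  have wW: "(\<Sum>m\<in>A. w m) \<le> W" if "finite A" for A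
    unfolding W_def using that by (intro finite_sum_le_infsum ws) (auto simp: w_def)
  have bound: "1 / (cmod (half_pt m) * cmod (half_pt b - half_pt m)) \<le> 8 * w m + 2 * w (b - m)" if "m \<noteq> b" for m b
  proof -
    define x where "x = 1 / cmod (half_pt m)"
    define y where "y = 1 / cmod (half_pt b - half_pt m)"
    have "half_pt b - half_pt m = of_int (b - m)" by (simp add: half_pt_def)
    then have d: "cmod (half_pt b - half_pt m) = of_int \<bar>b - m\<bar>" by (simp only: norm_of_int of_int_abs)
    have r: "real (nat \<bar>k\<bar>) = of_int \<bar>k\<bar>" for k :: int by simp
    have x: "x\<^sup>2 \<le> 16 * w m"
    proof -
      have "(of_int \<bar>m\<bar> + 1) / 4 \<le> cmod (half_pt m)" 
      proof (cases "m \<ge> 0")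
        case True
        then have "real_of_int m \<ge> 0" by simp
        then show ?thesis unfolding norm_half_pt by simp
      next
        case False
        then have "real_of_int m \<le> -1" by linarith
        then show ?thesis unfolding norm_half_pt by simp
      qed
      then have "((of_int \<bar>m\<bar> + 1) / 4)\<^sup>2 \<le> (cmod (half_pt m))\<^sup>2" by (intro power_mono) auto
      then have "1 / (cmod (half_pt m))\<^sup>2 \<le> 1 / ((of_int \<bar>m\<bar> + 1) / 4)\<^sup>2"
        by (intro divide_left_mono) (auto simp: half_pt_nonzero intro!: mult_pos_pos zero_less_power)
      then show ?thesis by (simp add: x_def w_def r power_divide)
    qed
    have y: "y\<^sup>2 \<le> 4 * w (b - m)"
    proof -
      have "1 \<le> \<bar>b - m\<bar>" using that by linarith
      then have "(of_int 1 :: real) \<le> of_int \<bar>b - m\<bar>" by (rule of_int_le_iff[THEN iffD2])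
      then have "(of_int \<bar>b - m\<bar> + 1) / 2 \<le> (of_int \<bar>b - m\<bar> :: real)" by simp
      then have "((of_int \<bar>b - m\<bar> + 1) / 2)\<^sup>2 \<le> (of_int \<bar>b - m\<bar> :: real)\<^sup>2" by (intro power_mono) auto
      then have "1 / (of_int \<bar>b - m\<bar> :: real)\<^sup>2 \<le> 1 / ((of_int \<bar>b - m\<bar> + 1) / 2)\<^sup>2"
        using that by (intro divide_left_mono) (auto intro!: mult_pos_pos zero_less_power)
      then show ?thesis unfolding y_def d w_def r by (simp add: power_divide)
    qed
    have "2 * (x * y) \<le> x\<^sup>2 + y\<^sup>2" using sum_squares_bound[of x y] by (simp add: mult.assoc)
    then show ?thesis using x y by (simp add: x_def y_def)
  qed
  have "(\<Sum>m\<in>A - {b}. 1 / (cmod (half_pt m) * cmod (half_pt b - half_pt m))) \<le> 10 * W" if A: "finite A" for A b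
  proof -
    have "(\<Sum>m\<in>A - {b}. 1 / (cmod (half_pt m) * cmod (half_pt b - half_pt m))) \<le> (\<Sum>m\<in>A - {b}. 8 * w m + 2 * w (b - m))"
      by (intro sum_mono bound) auto
    also have "\<dots> = 8 * (\<Sum>m\<in>A - {b}. w m) + 2 * (\<Sum>m\<in>A - {b}. w (b - m))"
      by (simp add: sum.distrib sum_distrib_left)
    also have "(\<Sum>m\<in>A - {b}. w (b - m)) = (\<Sum>d\<in>(\<lambda>m. b - m) ` (A - {b}). w d)"
      by (subst sum.reindex) (auto simp: inj_on_def)
    finally show ?thesis using wW[of "A - {b}"] wW[of "(\<lambda>m. b - m) ` (A - {b})"] A by simp
  qed
  moreover have "10 * W \<ge> 0" using wW[of "{}"] by simp
  ultimately show ?thesis using that by blast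
qed

text \<open>The residues are O(1/|m|), so the quotients in the value formula are summed by
  \<open>lattice_sum_bound\<close>. The point is square summability: the values are dominated by the
  square-summable sequences u and v.\<close>

lemma rh_val_bound:
  assumes row: "rh_row u v \<kappa> y1 y2 h1 h2" and ex: "row_expansion y1 y2 \<alpha> \<beta>"
  obtains K where "\<And>b. cmod (rh_val u v h1 h2 b) \<le> K * (cmod (u b) + cmod (v b))"
proof -
  let ?G = "\<lambda>m. \<kappa> m * rh_val u v h1 h2 m"
  obtain K where K: "\<And>m. cmod (?G m * v m) * cmod (half_pt m) \<le> K" "\<And>m. cmod (?G m * u m) * cmod (half_pt m) \<le> K"
    using row_coefficients(3)[OF row ex] by blast
  obtain Z where Z: "Z \<ge> 0" "\<And>A b. finite A \<Longrightarrow> (\<Sum>m\<in>A - {b}. 1 / (cmod (half_pt m) * cmod (half_pt b - half_pt m))) \<le> Z"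
    by (rule lattice_sum_bound) blast
  have K0: "K \<ge> 0" using order_trans[OF mult_nonneg_nonneg[OF norm_ge_zero norm_ge_zero] K(1)[of 0]] .
  have hpos: "cmod (half_pt m) > 0" for m using half_pt_nonzero by simp
  have "cmod (rh_val u v h1 h2 b) \<le> (1 + K * Z) * (cmod (u b) + cmod (v b))" for b
  proof -
    let ?U = "cmod (u b) + cmod (v b)"
    let ?s = "\<lambda>n. \<Sum>m\<in>{- int n..<int n} - {b}. ?G m * (v m * u b - u m * v b) / (half_pt b - half_pt m)"
    have le: "cmod (?s n) \<le> K * Z * ?U" for n
    proof -
      have "cmod (?s n) \<le> (\<Sum>m\<in>{- int n..<int n} - {b}. K * ?U * (1 / (cmod (half_pt m) * cmod (half_pt b - half_pt m))))"
      proof (rule sum_norm_le)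
        fix m
        have v: "cmod (?G m * v m) \<le> K / cmod (half_pt m)" and u: "cmod (?G m * u m) \<le> K / cmod (half_pt m)"
          using K[of m] hpos[of m] by (simp_all add: le_divide_eq)
        have "?G m * (v m * u b - u m * v b) = ?G m * v m * u b - ?G m * u m * v b" by (simp add: algebra_simps)
        then have "cmod (?G m * (v m * u b - u m * v b)) \<le> cmod (?G m * v m) * cmod (u b) + cmod (?G m * u m) * cmod (v b)"
          using norm_triangle_ineq4[of "?G m * v m * u b" "?G m * u m * v b"] by (simp only: norm_mult)
        also have "\<dots> \<le> K / cmod (half_pt m) * cmod (u b) + K / cmod (half_pt m) * cmod (v b)"
          by (intro add_mono mult_right_mono u v) auto
        finally have "cmod (?G m * (v m * u b - u m * v b)) \<le> K / cmod (half_pt m) * ?U" by (simp add: distrib_left)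
        then have "cmod (?G m * (v m * u b - u m * v b) / (half_pt b - half_pt m)) \<le> K / cmod (half_pt m) * ?U / cmod (half_pt b - half_pt m)"
          unfolding norm_divide by (intro divide_right_mono) auto
        then show "cmod (?G m * (v m * u b - u m * v b) / (half_pt b - half_pt m)) \<le> K * ?U * (1 / (cmod (half_pt m) * cmod (half_pt b - half_pt m)))"
          by (simp add: mult_ac)
      qed
      also have "\<dots> = K * ?U * (\<Sum>m\<in>{- int n..<int n} - {b}. 1 / (cmod (half_pt m) * cmod (half_pt b - half_pt m)))"
        by (rule sum_distrib_left[symmetric])
      also have "\<dots> \<le> K * ?U * Z" using K0 by (intro mult_left_mono Z(2)) auto
      finally show ?thesis by (simp add: mult_ac)
    qed
    have "cmod (rh_val u v h1 h2 b - u b) \<le> K * Z * ?U"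
    proof (rule LIMSEQ_le_const2)
      show "(\<lambda>n. cmod (?s n)) \<longlonglongrightarrow> cmod (rh_val u v h1 h2 b - u b)"
        by (intro tendsto_norm row_coefficients(4)[OF row ex])
      show "\<exists>N. \<forall>n\<ge>N. cmod (?s n) \<le> K * Z * ?U" using le by blast
    qed
    then have "cmod (rh_val u v h1 h2 b) \<le> cmod (u b) + K * Z * ?U"
      using norm_triangle_sub[of "rh_val u v h1 h2 b" "u b"] by linarith
    also have "\<dots> \<le> ?U + K * Z * ?U" by simp
    finally show ?thesis by (simp add: distrib_right)
  qed
  then show ?thesis using that by blast
qed

section \<open>From the Riemann--Hilbert problem to the resolvent equation\<close>

text \<open>The matrix of M. The sum runs over \<open>c\<close>, whereas \<open>bessel_gram\<close>
  sums the same products over \<open>k\<close>.\<close>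

definition kern :: "(int \<Rightarrow> real) \<Rightarrow> real \<Rightarrow> int \<Rightarrow> int \<Rightarrow> int \<Rightarrow> real" where
  "kern p t S k l = (\<Sum>\<^sub>\<infinity>c\<in>{S<..}. bvec p t c k * bvec p t c l)"

lemma abs_bvec_le: "weight p \<Longrightarrow> \<bar>bvec p t c k\<bar> \<le> \<bar>bessel (c + k) t\<bar>"
  using mult_right_mono[of "sqrt (p k)" 1 "\<bar>bessel (c + k) t\<bar>"]
  by (simp add: bvec_def weight_def abs_mult)

lemma bessel_prod_summable_sub: "(\<lambda>c. bessel (c + k) t * bessel (c + l) t) summable_on A"
  using summable_on_subset_banach[OF bessel_prod_summable[of k t l], of A] by (simp add: add.commute)

lemma kern_eq: "kern p t S k l = sqrt (p k) * sqrt (p l) * (\<Sum>\<^sub>\<infinity>c\<in>{S<..}. bessel (c + k) t * bessel (c + l) t)"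
proof -
  have "kern p t S k l = (\<Sum>\<^sub>\<infinity>c\<in>{S<..}. sqrt (p k) * sqrt (p l) * (bessel (c + k) t * bessel (c + l) t))"
    unfolding kern_def bvec_def by (simp only: mult_ac)
  also have "\<dots> = sqrt (p k) * sqrt (p l) * (\<Sum>\<^sub>\<infinity>c\<in>{S<..}. bessel (c + k) t * bessel (c + l) t)"
    by (rule infsum_cmult_right')
  finally show ?thesis .
qed

lemma bvec_col_summable: "(\<lambda>c. bvec p t c k * bvec p t c l) summable_on A"
proof -
  have "(\<lambda>c. sqrt (p k) * sqrt (p l) * (bessel (c + k) t * bessel (c + l) t)) summable_on A"
    by (rule summable_on_cmult_right[OF bessel_prod_summable_sub])
  moreover have "(\<lambda>c. sqrt (p k) * sqrt (p l) * (bessel (c + k) t * bessel (c + l) t)) = (\<lambda>c. bvec p t c k * bvec p t c l)"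
    by (simp add: bvec_def fun_eq_iff mult_ac)
  ultimately show ?thesis by simp
qed

lemma bessel_at_3n_tendsto: "(\<lambda>n. bessel (3 * int n + k) t) \<longlonglongrightarrow> 0"
proof (rule Lim_null_comparison)
  let ?R = "\<bar>t\<bar>"
  show "\<forall>\<^sub>F n in sequentially. norm (bessel (3 * int n + k) t) \<le> exp (?R\<^sup>2) * bessel_majorant ?R (int (nat (3 * int n + k)))"
    using eventually_ge_at_top[of "nat \<bar>k\<bar>"]
  proof eventually_elim
    case (elim n)
    then have "int (nat (3 * int n + k)) = 3 * int n + k" by simp
    then show ?case using abs_bessel_le_majorant[of t ?R "3 * int n + k"] by simp
  qed
  have "filterlim (\<lambda>n. nat (3 * int n + k)) at_top sequentially"
    unfolding filterlim_at_top
  proof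
    fix Z show "\<forall>\<^sub>F n in sequentially. Z \<le> nat (3 * int n + k)"
      using eventually_ge_at_top[of "Z + nat \<bar>k\<bar>"] by eventually_elim auto
  qed
  then have "(\<lambda>n. bessel_majorant ?R (int (nat (3 * int n + k)))) \<longlonglongrightarrow> 0"
    by (rule filterlim_compose[OF bessel_majorant_tendsto[OF abs_ge_zero]])
  from tendsto_mult_right[OF this, of "exp (?R\<^sup>2)"]
  show "(\<lambda>n. exp (?R\<^sup>2) * bessel_majorant ?R (int (nat (3 * int n + k)))) \<longlonglongrightarrow> 0" by simp
qed

text \<open>Christoffel--Darboux: the three-term recurrence telescopes the sum.\<close>
lemma kern_offdiag:
  "of_int (l - k) * kern p t S k l = t * (bvec p t (S + 1) k * bvec p t S l - bvec p t S k * bvec p t (S + 1) l)"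
proof -
  define w where "w c = bessel (c + 1 + k) t * bessel (c + l) t - bessel (c + k) t * bessel (c + 1 + l) t" for c
  have step: "of_int (l - k) * (bessel (c + k) t * bessel (c + l) t) = t * (w (c - 1) - w c)" for c
  proof -
    have 1: "of_int (c + k) * bessel (c + k) t = t * (bessel (c + k - 1) t + bessel (c + k + 1) t)"
      and 2: "of_int (c + l) * bessel (c + l) t = t * (bessel (c + l - 1) t + bessel (c + l + 1) t)"
      by (rule bessel_recurrence)+
    have "of_int (l - k) * (bessel (c + k) t * bessel (c + l) t)
        = bessel (c + k) t * (of_int (c + l) * bessel (c + l) t) - (of_int (c + k) * bessel (c + k) t) * bessel (c + l) t"
      by (simp add: algebra_simps)
    also have "\<dots> = t * (w (c - 1) - w c)" unfolding 1 2 w_def by (simp add: algebra_simps)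
    finally show ?thesis .
  qed
  let ?s = "\<lambda>c. bessel (c + k) t * bessel (c + l) t"
  have "(\<lambda>n. of_int (l - k) * (\<Sum>c\<in>{S<..3 * int n}. ?s c)) \<longlonglongrightarrow> of_int (l - k) * infsum ?s {S<..}"
    by (intro tendsto_mult tendsto_const has_sum_Ioc has_sum_infsum bessel_prod_summable_sub)
  moreover have "(\<lambda>n. of_int (l - k) * (\<Sum>c\<in>{S<..3 * int n}. ?s c)) \<longlonglongrightarrow> t * (w S - 0)"
  proof (rule Lim_transform_eventually)
    have "(\<lambda>n. w (3 * int n)) \<longlonglongrightarrow> 0 * 0 - 0 * 0"
      unfolding w_def add.assoc by (intro tendsto_intros bessel_at_3n_tendsto)
    then have w0: "(\<lambda>n. w (3 * int n)) \<longlonglongrightarrow> 0" by simp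
    show "(\<lambda>n. t * (w S - w (3 * int n))) \<longlonglongrightarrow> t * (w S - 0)" by (intro tendsto_intros w0)
    show "\<forall>\<^sub>F n in sequentially. t * (w S - w (3 * int n)) = of_int (l - k) * (\<Sum>c\<in>{S<..3 * int n}. ?s c)"
      using eventually_ge_at_top[of "nat \<bar>S\<bar>"]
    proof eventually_elim
      case (elim n)
      have "of_int (l - k) * (\<Sum>c\<in>{S<..3 * int n}. ?s c) = (\<Sum>c\<in>{S<..3 * int n}. t * (w (c - 1) - w c))"
        unfolding sum_distrib_left by (intro sum.cong refl step)
      also have "\<dots> = t * (w S - w (3 * int n))"
        unfolding sum_distrib_left[symmetric] using elim by (subst sum_telescope_Ioc) auto
      finally show ?case ..
    qed
  qed
  ultimately have "of_int (l - k) * infsum ?s {S<..} = t * (w S - 0)" by (rule LIMSEQ_unique)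
  then have h1: "sqrt (p k) * sqrt (p l) * (of_int (l - k) * infsum ?s {S<..}) = sqrt (p k) * sqrt (p l) * (t * w S)" by simp
  have h2: "of_int (l - k) * kern p t S k l = sqrt (p k) * sqrt (p l) * (of_int (l - k) * infsum ?s {S<..})"
    unfolding kern_eq by (simp only: mult_ac)
  have h3: "t * (bvec p t (S + 1) k * bvec p t S l - bvec p t S k * bvec p t (S + 1) l) = sqrt (p k) * sqrt (p l) * (t * w S)"
    unfolding bvec_def w_def by (simp add: algebra_simps)
  show ?thesis unfolding h2 h3 by (rule h1)
qed

text \<open>If the tail sum were $1$ then two consecutive Bessel functions would vanish at \<open>t\<close>, hence all of them.\<close>
lemma bessel_tail_less_1:
  assumes "t \<noteq> 0"
  shows "(\<Sum>\<^sub>\<infinity>c\<in>{S<..}. (bessel (c + k) t)\<^sup>2) < 1"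
proof (rule ccontr)
  let ?f = "\<lambda>c. (bessel (c + k) t)\<^sup>2"
  assume "\<not> infsum ?f {S<..} < 1"
  then have ge: "infsum ?f {S<..} \<ge> 1" by simp
  have sm: "?f summable_on A" for A
    using bessel_prod_summable_sub[of k t k A] by (simp add: power2_eq_square)
  have one: "infsum ?f UNIV = 1"
    using bessel_orthonormal[of k t k] by (simp add: has_sum_iff power2_eq_square add.commute)
  have zero: "bessel (c + k) t = 0" if "c \<le> S" for c
  proof -
    have "?f c + infsum ?f {S<..} = infsum ?f ({c} \<union> {S<..})"
      using that by (subst infsum_Un_disjoint) (auto intro: sm)
    also have "\<dots> \<le> infsum ?f UNIV"
      by (rule infsum_mono_neutral[OF sm sm]) auto
    finally have "?f c \<le> 0" using ge one by linarith
    then show ?thesis by simp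
  qed
  have all: "bessel n t = 0" for n
  proof -
    let ?b = "S + k"
    have up: "bessel (?b - 1 + int j) t = 0 \<and> bessel (?b + int j) t = 0" for j
    proof (induction j)
      case 0
      then show ?case using zero[of S] zero[of "S - 1"] by (simp add: algebra_simps)
    next
      case (Suc j)
      have "of_int (?b + int j) * bessel (?b + int j) t = t * (bessel (?b + int j - 1) t + bessel (?b + int j + 1) t)"
        by (rule bessel_recurrence)
      moreover have "?b + int j - 1 = ?b - 1 + int j" by simp
      ultimately have "bessel (?b + int j + 1) t = 0" using Suc assms by simp
      then show ?case using Suc by (simp add: algebra_simps)
    qed
    show ?thesis
    proof (cases "n \<le> ?b")
      case True
      then show ?thesis using zero[of "n - k"] by simp
    next
      case False
      then show ?thesis using up[of "nat (n - ?b)"] by simp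
    qed
  qed
  then show False using one by simp
qed

lemma kern_diag_less_1:
  assumes p: "weight p" and t: "t \<noteq> 0"
  shows "kern p t S k k < 1"
proof -
  let ?T = "\<Sum>\<^sub>\<infinity>c\<in>{S<..}. (bessel (c + k) t)\<^sup>2"
  have "kern p t S k k = p k * ?T"
    using p by (simp add: kern_eq power2_eq_square weight_def)
  also have "\<dots> \<le> 1 * ?T"
    using p by (intro mult_right_mono infsum_nonneg) (auto simp: weight_def)
  finally show ?thesis using bessel_tail_less_1[OF t, of k S] by simp
qed

text \<open>Finite trace leaves only finitely many diagonal entries above 1/2, and each of these is
  below 1. The gap bounds the denominators 1 - M_s(a,a) of the residue matrices uniformly.\<close>

lemma kern_diag_gap:
  assumes p: "weight p" and ps: "p summable_on {..<0}" and t: "t \<noteq> 0"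
  obtains \<delta> where "\<delta> > 0" "\<And>k. 1 - kern p t S k k \<ge> \<delta>"
proof -
  obtain T where T: "\<And>A B. finite A \<Longrightarrow> A \<subseteq> {S<..} \<Longrightarrow> finite B \<Longrightarrow> (\<Sum>c\<in>A. \<Sum>k\<in>B. (bvec p t c k)\<^sup>2) \<le> T"
    by (rule trace_bound[OF p ps, of S t]) blast
  have sumB: "(\<Sum>k\<in>B. kern p t S k k) \<le> T" if B: "finite B" for B
  proof -
    have hs: "((\<lambda>c. \<Sum>k\<in>B. bvec p t c k * bvec p t c k) has_sum (\<Sum>k\<in>B. kern p t S k k)) {S<..}"
      unfolding kern_def by (intro has_sum_sum has_sum_infsum bvec_col_summable)
    then have "(\<Sum>k\<in>B. kern p t S k k) = infsum (\<lambda>c. \<Sum>k\<in>B. bvec p t c k * bvec p t c k) {S<..}" by (simp add: infsumI)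
    also have "\<dots> \<le> T"
      by (rule infsum_le_finite_sums[OF has_sum_imp_summable[OF hs]]) (use T B in \<open>simp add: power2_eq_square\<close>)
    finally show ?thesis .
  qed
  let ?X = "{k. kern p t S k k > 1/2}"
  have "finite ?X"
  proof (rule ccontr)
    assume "infinite ?X"
    then obtain B where B: "finite B" "card B = nat \<lceil>2 * T\<rceil> + 1" "B \<subseteq> ?X" using infinite_arbitrarily_large by blast
    have "real (card B) * (1/2) \<le> (\<Sum>k\<in>B. kern p t S k k)"
      using B by (intro sum_bounded_below) (auto simp: less_imp_le)
    also have "\<dots> \<le> T" by (rule sumB[OF B(1)])
    finally show False using B(2) by linarith
  qed
  define \<delta> where "\<delta> = Min (insert (1/2) ((\<lambda>k. 1 - kern p t S k k) ` ?X))"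
  have fin: "finite (insert (1/2) ((\<lambda>k. 1 - kern p t S k k) ` ?X))" using \<open>finite ?X\<close> by simp
  have "\<delta> > 0"
    unfolding \<delta>_def by (subst Min_gr_iff[OF fin]) (auto simp: kern_diag_less_1[OF p t])
  moreover have "1 - kern p t S k k \<ge> \<delta>" for k
  proof (cases "k \<in> ?X")
    case True
    then show ?thesis unfolding \<delta>_def by (intro Min_le[OF fin]) auto
  next
    case False
    have "\<delta> \<le> 1/2" unfolding \<delta>_def by (rule Min_le[OF fin]) simp
    then show ?thesis using False by simp
  qed
  ultimately show ?thesis using that by blast
qed

text \<open>The weight is evaluated at a - s - 1/2, so the lattice code \<open>m\<close> corresponds
  to k = m - S. Summability makes the limit insensitive to this displacement of the symmetric
  intervals.\<close>

lemma tendsto_sum_shift: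
  fixes f :: "int \<Rightarrow> real"
  assumes "f summable_on UNIV"
  shows "(\<lambda>n. \<Sum>m = - int n..<int n. f (m - S)) \<longlonglongrightarrow> infsum f UNIV"
proof -
  have "bij_betw (\<lambda>m::int. m - S) UNIV UNIV" by (rule bij_betw_byWitness[of _ "\<lambda>m. m + S"]) auto
  then have "((\<lambda>m. f (m - S)) has_sum infsum f UNIV) UNIV"
    using has_sum_reindex_bij_betw[of "\<lambda>m::int. m - S" UNIV UNIV f] has_sum_infsum[OF assms] by simp
  then show ?thesis by (rule has_sum_int_interval)
qed

text \<open>The Riemann--Hilbert problem delivers the equation with the sum over \<open>c\<close>
  taken first, inside \<open>kern\<close>, and \<open>resolvent_eq\<close> takes the sum over
  \<open>k\<close> first. The two agree by Fubini.\<close>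

lemma resolvent_eqI:
  assumes p: "weight p" and G: "(\<lambda>k. (G k)\<^sup>2) summable_on UNIV"
    and eq: "\<And>l. (\<lambda>n. \<Sum>m = - int n..<int n. G (m - S) * kern p t S (m - S) l) \<longlonglongrightarrow> G l - \<tau> * bvec p t S l"
  shows "resolvent_eq p t S \<tau> G (\<lambda>c. \<Sum>\<^sub>\<infinity>k. bvec p t c k * G k)"
proof -
  define V where "V = infsum (\<lambda>k. (G k)\<^sup>2) UNIV"
  have VB: "(\<Sum>k\<in>B. (G k)\<^sup>2) \<le> V" if "finite B" for B
    unfolding V_def using that by (intro finite_sum_le_infsum[OF G]) auto
  have V0: "V \<ge> 0" using VB[of "{}"] by simp
  have "\<exists>C. \<forall>A. finite A \<longrightarrow> (\<Sum>c\<in>A. \<bar>bvec p t c l\<bar>) \<le> C" for l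
  proof -
    let ?R = "\<bar>t\<bar>"
    let ?g = "\<lambda>c. exp (?R\<^sup>2) * bessel_majorant ?R c"
    have s: "?g summable_on UNIV" by (intro summable_on_cmult_right bessel_majorant_summable) simp
    have "(\<Sum>c\<in>A. \<bar>bvec p t c l\<bar>) \<le> infsum ?g UNIV" if A: "finite A" for A
    proof -
      have "(\<Sum>c\<in>A. \<bar>bvec p t c l\<bar>) \<le> (\<Sum>c\<in>A. ?g (c + l))"
        using abs_bvec_le[OF p] abs_bessel_le_majorant[of t ?R] by (intro sum_mono) (meson order_refl order_trans)
      also have "\<dots> = (\<Sum>c\<in>(\<lambda>c. c + l) ` A. ?g c)" by (subst sum.reindex) (auto simp: inj_on_def)
      also have "\<dots> \<le> infsum ?g UNIV"
        using A by (intro finite_sum_le_infsum[OF s]) (auto simp: bessel_majorant_nonneg)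
      finally show ?thesis .
    qed
    then show ?thesis by blast
  qed
  then obtain C where C: "\<And>l A. finite A \<Longrightarrow> (\<Sum>c\<in>A. \<bar>bvec p t c l\<bar>) \<le> C l" by metis
  \<comment> \<open>Absolute summability over pairs: the sum over \<open>k\<close> is at most 1 + V
    for every \<open>c\<close>, and the Bessel values at fixed \<open>l\<close> are summable over
    \<open>c\<close>.\<close>
  have prod: "(\<lambda>(c, k). bvec p t c l * (bvec p t c k * G k)) summable_on ({S<..} \<times> UNIV)" for l
  proof (rule abs_summable_summable, rule nonneg_bdd_above_summable_on)
    show "bdd_above (sum (\<lambda>x. norm (case x of (c, k) \<Rightarrow> bvec p t c l * (bvec p t c k * G k))) ` {F. F \<subseteq> {S<..} \<times> UNIV \<and> finite F})"
    proof (rule bdd_aboveI2)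
      fix F assume F: "F \<in> {F. F \<subseteq> {S<..} \<times> (UNIV :: int set) \<and> finite F}"
      have "(\<Sum>x\<in>F. norm (case x of (c, k) \<Rightarrow> bvec p t c l * (bvec p t c k * G k)))
          \<le> (\<Sum>x\<in>fst ` F \<times> snd ` F. norm (case x of (c, k) \<Rightarrow> bvec p t c l * (bvec p t c k * G k)))"
        using F by (intro sum_mono2) (auto intro: rev_image_eqI)
      also have "\<dots> = (\<Sum>c\<in>fst ` F. \<Sum>k\<in>snd ` F. \<bar>bvec p t c l\<bar> * \<bar>bvec p t c k * G k\<bar>)"
        by (simp add: sum.cartesian_product abs_mult case_prod_unfold)
      also have "\<dots> \<le> (\<Sum>c\<in>fst ` F. \<bar>bvec p t c l\<bar> * (1 + V))"
        unfolding sum_distrib_left[symmetric]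
      proof (intro sum_mono mult_left_mono)
        fix c
        have "(\<Sum>k\<in>snd ` F. \<bar>bvec p t c k * G k\<bar>) \<le> (\<Sum>k\<in>snd ` F. (bvec p t c k)\<^sup>2 + (G k)\<^sup>2)" by (intro sum_mono abs_mult_le_sum_sq)
        also have "\<dots> \<le> 1 + V"
          unfolding sum.distrib using F by (intro add_mono VB bvec_norm_le p) auto
        finally show "(\<Sum>k\<in>snd ` F. \<bar>bvec p t c k * G k\<bar>) \<le> 1 + V" .
      qed auto
      also have "\<dots> = (\<Sum>c\<in>fst ` F. \<bar>bvec p t c l\<bar>) * (1 + V)" by (rule sum_distrib_right[symmetric])
      also have "\<dots> \<le> C l * (1 + V)" using F V0 by (intro mult_right_mono C) auto
      finally show "(\<Sum>x\<in>F. norm (case x of (c, k) \<Rightarrow> bvec p t c l * (bvec p t c k * G k))) \<le> C l * (1 + V)" .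
    qed
  qed auto
  let ?g = "\<lambda>c. \<Sum>\<^sub>\<infinity>k. bvec p t c k * G k"
  have inner: "(\<Sum>\<^sub>\<infinity>k. bvec p t c l * (bvec p t c k * G k)) = ?g c * bvec p t c l" for c l
    by (subst infsum_cmult_right') (rule mult.commute)
  have outer: "(\<Sum>\<^sub>\<infinity>c\<in>{S<..}. bvec p t c l * (bvec p t c k * G k)) = G k * kern p t S k l" for k l
  proof -
    have "(\<Sum>\<^sub>\<infinity>c\<in>{S<..}. bvec p t c l * (bvec p t c k * G k)) = (\<Sum>\<^sub>\<infinity>c\<in>{S<..}. G k * (bvec p t c k * bvec p t c l))"
      by (simp only: mult_ac)
    then show ?thesis unfolding kern_def by (simp only: infsum_cmult_right')
  qed
  have hs: "((\<lambda>c. ?g c * bvec p t c l) has_sum (G l - \<tau> * bvec p t S l)) {S<..}" for l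
  proof -
    have 1: "(\<lambda>c. ?g c * bvec p t c l) summable_on {S<..}"
      using summable_on_Sigma_banach[OF prod, of l] by (simp only: inner)
    have 2: "infsum (\<lambda>c. ?g c * bvec p t c l) {S<..} = (\<Sum>\<^sub>\<infinity>k. G k * kern p t S k l)"
      using infsum_swap_banach[OF prod, of l] by (simp only: inner outer)
    have "(\<lambda>(k, c). bvec p t c l * (bvec p t c k * G k)) summable_on (UNIV \<times> {S<..})"
    proof -
      let ?h = "\<lambda>(k, c). bvec p t c l * (bvec p t c k * G k)"
      have "?h \<circ> prod.swap = (\<lambda>(c, k). bvec p t c l * (bvec p t c k * G k))" by auto
      then have "(?h \<circ> prod.swap) summable_on ({S<..} \<times> UNIV)" using prod[of l] by (simp only:)
      then have "?h summable_on (prod.swap ` ({S<..} \<times> (UNIV :: int set)))"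
        by (rule summable_on_reindex[THEN iffD2, rotated]) (rule inj_swap)
      then show ?thesis by (simp only: product_swap)
    qed
    then have 3: "(\<lambda>k. G k * kern p t S k l) summable_on UNIV"
      using summable_on_Sigma_banach[of "\<lambda>k c. bvec p t c l * (bvec p t c k * G k)" UNIV "\<lambda>_. {S<..}"] by (simp only: outer)
    have "(\<Sum>\<^sub>\<infinity>k. G k * kern p t S k l) = G l - \<tau> * bvec p t S l"
      by (rule LIMSEQ_unique[OF tendsto_sum_shift[OF 3] eq])
    then show ?thesis using has_sum_infsum[OF 1] unfolding 2 by simp
  qed
  have "(\<lambda>n. coef p t G n c) \<longlonglongrightarrow> ?g c" for c
    unfolding coef_def by (intro has_sum_int_interval has_sum_infsum bvec_pairing_summable p G)
  then show ?thesis unfolding resolvent_eq_def by (intro conjI allI G hs)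
qed

section \<open>The Riemann--Hilbert data in integer coordinates\<close>

lemma half_pt_eq: "half_pt m = complex_of_real (of_int m + 1/2)"
  by (simp add: half_pt_def)

lemma range_half_pt: "complex_of_real ` Zp = range half_pt"
proof -
  have "complex_of_real ` Zp = range (\<lambda>k::int. complex_of_real (of_int k + 1/2))"
    unfolding Zp_eq image_image ..
  then show ?thesis unfolding half_pt_eq .
qed

lemma half_in_Zp: "of_int m + 1/2 \<in> Zp"
  unfolding Zp_eq by blast

text \<open>Substitution l = c - S - 1/2. It turns M_s(a,a) into the diagonal entry of M at k = m -
  S.\<close>

lemma KBe_eq: "KBe t (of_int m + 1/2) = (\<Sum>\<^sub>\<infinity>c\<in>{S<..}. (bessel (c + (m - S)) t)\<^sup>2)"
proof -
  have "bij_betw (\<lambda>c::int. of_int (c - S) - 1/2 :: real) {S<..} {l\<in>Zp. l > 0}"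
    unfolding bij_betw_def
  proof
    show "(\<lambda>c::int. of_int (c - S) - 1/2 :: real) ` {S<..} = {l\<in>Zp. l > 0}"
    proof (intro equalityI subsetI)
      fix l :: real assume "l \<in> {l\<in>Zp. l > 0}"
      then obtain k :: int where k: "l = of_int k + 1/2" "l > 0" by (auto simp: Zp_def)
      then have "k \<ge> 0" by linarith
      moreover have "l = of_int (k + S + 1 - S) - 1/2" using k by simp
      ultimately show "l \<in> (\<lambda>c::int. of_int (c - S) - 1/2 :: real) ` {S<..}"
        by (intro image_eqI[of _ _ "k + S + 1"]) auto
    next
      fix l :: real assume "l \<in> (\<lambda>c::int. of_int (c - S) - 1/2 :: real) ` {S<..}"
      then obtain c :: int where c: "l = of_int (c - S) - 1/2" "c > S" by auto
      then have "l = of_int (c - S - 1) + 1/2" by simp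
      moreover have "real_of_int (c - S) \<ge> 1" using c(2) by linarith
      ultimately show "l \<in> {l\<in>Zp. l > 0}" using c(1) half_in_Zp[of "c - S - 1"] by simp
    qed
  qed (auto simp: inj_on_def)
  from infsum_reindex_bij_betw[OF this, of "\<lambda>l. (J (of_int m + 1/2 + l) (2*t))\<^sup>2"]
  have "KBe t (of_int m + 1/2) = (\<Sum>\<^sub>\<infinity>c\<in>{S<..}. (J (of_int m + 1/2 + (of_int (c - S) - 1/2)) (2*t))\<^sup>2)"
    unfolding KBe_def by simp
  also have "\<dots> = (\<Sum>\<^sub>\<infinity>c\<in>{S<..}. (bessel (c + (m - S)) t)\<^sup>2)"
    by (intro infsum_cong arg_cong[where f = "\<lambda>x. x\<^sup>2"] J_eq_bessel) simp
  finally show ?thesis .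
qed

lemma shift_half: "s = of_int S - 1/2 \<Longrightarrow> of_int m + 1/2 - s - 1/2 = of_int (m - S) + (1/2 :: real)"
  by simp

lemma Ms_eq_kern:
  assumes \<sigma>: "\<forall>l\<in>Zp. 0 \<le> \<sigma> l \<and> \<sigma> l \<le> 1" and s: "s = of_int S - 1/2"
  shows "Ms \<sigma> t s (of_int m + 1/2) = kern (half_weight \<sigma>) t S (m - S) (m - S)"
proof -
  have p: "weight (half_weight \<sigma>)" by (rule weight_half_weight[OF \<sigma>])
  show ?thesis
    unfolding Ms_def shift_half[OF s] KBe_eq[of t m S] kern_eq half_weight_def[of \<sigma> "m - S", symmetric]
    using p by (simp add: power2_eq_square weight_def)
qed

lemma fvec_eq:
  assumes s: "s = of_int S - 1/2"
  shows "vec_nth (fvec \<sigma> t s (of_int m + 1/2)) 1 = bvec (half_weight \<sigma>) t S (m - S)"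
    and "vec_nth (fvec \<sigma> t s (of_int m + 1/2)) 2 = t * bvec (half_weight \<sigma>) t (S + 1) (m - S)"
    and "vec_nth (gvec \<sigma> t s (of_int m + 1/2)) 1 = t * bvec (half_weight \<sigma>) t (S + 1) (m - S)"
    and "vec_nth (gvec \<sigma> t s (of_int m + 1/2)) 2 = - bvec (half_weight \<sigma>) t S (m - S)"
proof -
  have J: "J (of_int m + 1/2 - 1/2) (2*t) = bessel m t" "J (of_int m + 1/2 + 1/2) (2*t) = bessel (m + 1) t"
    by (rule J_eq_bessel, simp)+
  show "vec_nth (fvec \<sigma> t s (of_int m + 1/2)) 1 = bvec (half_weight \<sigma>) t S (m - S)"
    "vec_nth (fvec \<sigma> t s (of_int m + 1/2)) 2 = t * bvec (half_weight \<sigma>) t (S + 1) (m - S)"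
    "vec_nth (gvec \<sigma> t s (of_int m + 1/2)) 1 = t * bvec (half_weight \<sigma>) t (S + 1) (m - S)"
    "vec_nth (gvec \<sigma> t s (of_int m + 1/2)) 2 = - bvec (half_weight \<sigma>) t S (m - S)"
    unfolding fvec_def gvec_def vector_2 shift_half[OF s] J
    by (simp_all add: bvec_def half_weight_def add.commute)
qed

text \<open>Multiplication from the right acts on each row of \<open>Y\<close> separately, so the
  first row satisfies a scalar-pair problem of its own.\<close>

lemma dRHP_row:
  assumes \<sigma>: "\<forall>l\<in>Zp. 0 \<le> \<sigma> l \<and> \<sigma> l \<le> 1" and s: "s = of_int S - 1/2"
    and rhp: "dRHP \<sigma> t s Y"
  defines "u \<equiv> \<lambda>m. complex_of_real (bvec (half_weight \<sigma>) t S (m - S))"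
    and "v \<equiv> \<lambda>m. complex_of_real (t * bvec (half_weight \<sigma>) t (S + 1) (m - S))"
    and "\<kappa> \<equiv> \<lambda>m. complex_of_real (1 / (1 - kern (half_weight \<sigma>) t S (m - S) (m - S)))"
  shows "\<exists>h1 h2. rh_row u v \<kappa> (\<lambda>z. vec_nth (vec_nth (Y z) 1) 1) (\<lambda>z. vec_nth (vec_nth (Y z) 1) 2) h1 h2"
proof -
  let ?y1 = "\<lambda>z. vec_nth (vec_nth (Y z) 1) 1" and ?y2 = "\<lambda>z. vec_nth (vec_nth (Y z) 1) 2"
  have holo: "?y1 holomorphic_on - range half_pt" "?y2 holomorphic_on - range half_pt"
    using rhp unfolding dRHP_def range_half_pt by blast+
  have W: "vec_nth (vec_nth (WY \<sigma> t s (of_int m + 1/2)) 1) 1 = \<kappa> m * u m * v m"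
    "vec_nth (vec_nth (WY \<sigma> t s (of_int m + 1/2)) 1) 2 = - (\<kappa> m * u m * u m)"
    "vec_nth (vec_nth (WY \<sigma> t s (of_int m + 1/2)) 2) 1 = \<kappa> m * v m * v m"
    "vec_nth (vec_nth (WY \<sigma> t s (of_int m + 1/2)) 2) 2 = - (\<kappa> m * v m * u m)" for m
    unfolding WY_def u_def v_def \<kappa>_def Ms_eq_kern[OF \<sigma> s] by (simp_all add: fvec_eq[OF s])
  have prod: "vec_nth (vec_nth (Y z ** (Finite_Cartesian_Product.mat 1
        - (\<chi> p q. vec_nth (vec_nth (WY \<sigma> t s (of_int m + 1/2)) p) q / (z - complex_of_real (of_int m + 1/2))))) 1) 1
      = ?y1 z - \<kappa> m * v m * (u m * ?y1 z + v m * ?y2 z) / (z - half_pt m)"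
    "vec_nth (vec_nth (Y z ** (Finite_Cartesian_Product.mat 1
        - (\<chi> p q. vec_nth (vec_nth (WY \<sigma> t s (of_int m + 1/2)) p) q / (z - complex_of_real (of_int m + 1/2))))) 1) 2
      = ?y2 z + \<kappa> m * u m * (u m * ?y1 z + v m * ?y2 z) / (z - half_pt m)" for z m
    unfolding half_pt_eq[symmetric] matrix_matrix_mult_def Finite_Cartesian_Product.mat_def
    by (simp_all only: vec_lambda_beta sum_2 vector_minus_component W)
      (simp_all add: divide_inverse algebra_simps)
  \<comment> \<open>The two regularisations are packed into a pair so that one application of choice
    yields both families on a common disc.\<close>
  have local_ex: "\<exists>h. (\<exists>r>0. fst h holomorphic_on ball (half_pt m) r \<and> snd h holomorphic_on ball (half_pt m) r \<and>
       (\<forall>z\<in>ball (half_pt m) r - {half_pt m}.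
          fst h z = ?y1 z - \<kappa> m * v m * (u m * ?y1 z + v m * ?y2 z) / (z - half_pt m) \<and>
          snd h z = ?y2 z + \<kappa> m * u m * (u m * ?y1 z + v m * ?y2 z) / (z - half_pt m)))" for m
  proof -
    have reg: "\<exists>r>0. \<exists>h. h holomorphic_on ball (half_pt m) r \<and> (\<forall>z\<in>ball (half_pt m) r - {half_pt m}.
        h z = vec_nth (vec_nth (Y z ** (Finite_Cartesian_Product.mat 1
          - (\<chi> p q. vec_nth (vec_nth (WY \<sigma> t s (of_int m + 1/2)) p) q / (z - complex_of_real (of_int m + 1/2))))) i) j)" for i j
      using rhp half_in_Zp[of m] unfolding dRHP_def half_pt_eq by blast
    obtain r1 h1 where r1: "r1 > 0" "h1 holomorphic_on ball (half_pt m) r1"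
      "\<And>z. z \<in> ball (half_pt m) r1 - {half_pt m} \<Longrightarrow> h1 z = ?y1 z - \<kappa> m * v m * (u m * ?y1 z + v m * ?y2 z) / (z - half_pt m)"
      using reg[of 1 1] unfolding prod by blast
    obtain r2 h2 where r2: "r2 > 0" "h2 holomorphic_on ball (half_pt m) r2"
      "\<And>z. z \<in> ball (half_pt m) r2 - {half_pt m} \<Longrightarrow> h2 z = ?y2 z + \<kappa> m * u m * (u m * ?y1 z + v m * ?y2 z) / (z - half_pt m)"
      using reg[of 1 2] unfolding prod by blast
    have sub: "ball (half_pt m) (min r1 r2) \<subseteq> ball (half_pt m) r1" "ball (half_pt m) (min r1 r2) \<subseteq> ball (half_pt m) r2" by auto
    show ?thesis
    proof (intro exI[of _ "(h1, h2)"] exI[of _ "min r1 r2"] conjI ballI)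
      show "min r1 r2 > 0" using r1 r2 by simp
      show "fst (h1, h2) holomorphic_on ball (half_pt m) (min r1 r2)"
        using holomorphic_on_subset[OF r1(2) sub(1)] by simp
      show "snd (h1, h2) holomorphic_on ball (half_pt m) (min r1 r2)"
        using holomorphic_on_subset[OF r2(2) sub(2)] by simp
      fix z assume z: "z \<in> ball (half_pt m) (min r1 r2) - {half_pt m}"
      then have z1: "z \<in> ball (half_pt m) r1 - {half_pt m}" and z2: "z \<in> ball (half_pt m) r2 - {half_pt m}" by auto
      show "fst (h1, h2) z = ?y1 z - \<kappa> m * v m * (u m * ?y1 z + v m * ?y2 z) / (z - half_pt m)"
        using r1(3)[OF z1] by simp
      show "snd (h1, h2) z = ?y2 z + \<kappa> m * u m * (u m * ?y1 z + v m * ?y2 z) / (z - half_pt m)"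
        using r2(3)[OF z2] by simp
    qed
  qed
  from choice[OF allI[OF local_ex]] obtain h where
    h: "\<forall>m. \<exists>r>0. fst (h m) holomorphic_on ball (half_pt m) r \<and> snd (h m) holomorphic_on ball (half_pt m) r \<and>
       (\<forall>z\<in>ball (half_pt m) r - {half_pt m}.
          fst (h m) z = ?y1 z - \<kappa> m * v m * (u m * ?y1 z + v m * ?y2 z) / (z - half_pt m) \<and>
          snd (h m) z = ?y2 z + \<kappa> m * u m * (u m * ?y1 z + v m * ?y2 z) / (z - half_pt m))" ..
  have "rh_row u v \<kappa> ?y1 ?y2 (\<lambda>m. fst (h m)) (\<lambda>m. snd (h m))"
    unfolding rh_row_def by (intro conjI holo h)
  then show ?thesis by (intro exI)
qed

lemma has_expansion_row:
  assumes "has_expansion Y \<alpha> \<beta> \<gamma>"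
  shows "row_expansion (\<lambda>z. vec_nth (vec_nth (Y z) 1) 1) (\<lambda>z. vec_nth (vec_nth (Y z) 1) 2) \<alpha> \<beta>"
proof -
  obtain C N where CN: "\<And>n z. n \<ge> N \<Longrightarrow> cmod z = real n \<Longrightarrow>
      norm (Y z - Finite_Cartesian_Product.mat 1 - (\<chi> i j. (if i = 1 then (if j = 1 then \<alpha> else \<beta>)
                                              else (if j = 1 then \<gamma> else - \<alpha>)) / z)) \<le> C / (real n)\<^sup>2"
    using assms unfolding has_expansion_def by blast
  have entry: "cmod (vec_nth (vec_nth X 1) j) \<le> norm X" for X :: "complex^2^2" and j
    by (rule order_trans[OF Finite_Cartesian_Product.norm_nth_le Finite_Cartesian_Product.norm_nth_le])
  have "cmod (vec_nth (vec_nth (Y z) 1) 1 - 1 - \<alpha> / z) \<le> C / (real n)\<^sup>2 \<and> cmod (vec_nth (vec_nth (Y z) 1) 2 - \<beta> / z) \<le> C / (real n)\<^sup>2"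
    if "n \<ge> N" "cmod z = real n" for n z
    using order_trans[OF entry[of _ 1] CN[OF that]] order_trans[OF entry[of _ 2] CN[OF that]]
    by (simp add: Finite_Cartesian_Product.mat_def)
  then show ?thesis unfolding row_expansion_def by blast
qed

text \<open>The residues of the first row, divided by $g$, form an $\ell^2$ solution of $(1 - M) G = f_S$;
  real and imaginary parts are treated separately because $\alpha$, $\beta$ are a priori complex.\<close>
lemma dRHP_resolvent:
  assumes t: "t > 0" and \<sigma>: "\<forall>l\<in>Zp. 0 \<le> \<sigma> l \<and> \<sigma> l \<le> 1" and sm: "\<sigma> summable_on {l\<in>Zp. l < 0}"
    and s: "s = of_int S - 1/2" and rhp: "dRHP \<sigma> t s Y" and ex: "has_expansion Y \<alpha> \<beta> \<gamma>"
  obtains Gr Gi gr gi where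
    "resolvent_eq (half_weight \<sigma>) t S 1 Gr gr" "resolvent_eq (half_weight \<sigma>) t S 0 Gi gi"
    "\<alpha> = Complex (t * gr (S + 1)) (t * gi (S + 1))" "\<beta> = Complex (- gr S) (- gi S)"
proof -
  let ?p = "half_weight \<sigma>"
  have p: "weight ?p" and ps: "?p summable_on {..<0}" using weight_half_weight[OF \<sigma>] half_weight_summable[OF sm] .
  define u where "u m = complex_of_real (bvec ?p t S (m - S))" for m
  define v where "v m = complex_of_real (t * bvec ?p t (S + 1) (m - S))" for m
  define \<kappa> where "\<kappa> m = complex_of_real (1 / (1 - kern ?p t S (m - S) (m - S)))" for m
  let ?y1 = "\<lambda>z. vec_nth (vec_nth (Y z) 1) 1" and ?y2 = "\<lambda>z. vec_nth (vec_nth (Y z) 1) 2"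
  obtain h1 h2 where row: "rh_row u v \<kappa> ?y1 ?y2 h1 h2"
    using dRHP_row[OF \<sigma> s rhp] unfolding u_def[abs_def] v_def[abs_def] \<kappa>_def[abs_def] by blast
  have rex: "row_expansion ?y1 ?y2 \<alpha> \<beta>" by (rule has_expansion_row[OF ex])
  let ?F = "rh_val u v h1 h2"
  define H where "H m = \<kappa> m * ?F m" for m
  obtain \<delta> where \<delta>: "\<delta> > 0" "\<And>k. 1 - kern ?p t S k k \<ge> \<delta>"
    using kern_diag_gap[OF p ps, of t S] t by auto
  obtain K where K: "\<And>b. cmod (?F b) \<le> K * (cmod (u b) + cmod (v b))"
    by (rule rh_val_bound[OF row rex]) blast
  \<comment> \<open>\<open>H\<close> is the residue stripped of g, \<open>?F\<close> the value. The
    denominator in the residue matrix makes them differ by the diagonal of M, exactly the entry that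
    the sum over other lattice points omits.\<close>
  have F_H: "?F m = (1 - kern ?p t S (m - S) (m - S)) * H m" for m
    using \<delta>(2)[of "m - S"] \<delta>(1) by (simp add: H_def \<kappa>_def)
  have H_sq: "(cmod (H (k + S)))\<^sup>2 \<le> 2 * (K / \<delta>)\<^sup>2 * ((bvec ?p t S k)\<^sup>2 + t\<^sup>2 * (bvec ?p t (S + 1) k)\<^sup>2)" for k
  proof -
    have "cmod (\<kappa> (k + S)) \<le> 1 / \<delta>"
      using \<delta>(2)[of k] \<delta>(1) unfolding \<kappa>_def norm_of_real by (simp add: frac_le)
    then have "cmod (H (k + S)) \<le> 1 / \<delta> * (K * (cmod (u (k + S)) + cmod (v (k + S))))"
      unfolding H_def norm_mult using K[of "k + S"] \<delta>(1) by (intro mult_mono) auto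
    then have "(cmod (H (k + S)))\<^sup>2 \<le> (1 / \<delta> * (K * (cmod (u (k + S)) + cmod (v (k + S)))))\<^sup>2"
      by (intro power_mono) auto
    also have "\<dots> = (K / \<delta>)\<^sup>2 * (\<bar>bvec ?p t S k\<bar> + \<bar>t * bvec ?p t (S + 1) k\<bar>)\<^sup>2"
      unfolding u_def v_def norm_of_real by (simp add: power_mult_distrib power_divide)
    also have "\<dots> \<le> (K / \<delta>)\<^sup>2 * (2 * (\<bar>bvec ?p t S k\<bar>\<^sup>2 + \<bar>t * bvec ?p t (S + 1) k\<bar>\<^sup>2))"
    proof (intro mult_left_mono)
      show "(a + b)\<^sup>2 \<le> 2 * (a\<^sup>2 + b\<^sup>2)" for a b :: real
        using sum_squares_bound[of a b] by (simp add: power2_sum)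
    qed simp
    finally show ?thesis by (simp add: power_mult_distrib algebra_simps)
  qed
  have H_summable: "(\<lambda>k. (cmod (H (k + S)))\<^sup>2) summable_on UNIV"
  proof (rule summable_on_dominated)
    show "(\<lambda>k. 2 * (K / \<delta>)\<^sup>2 * ((bvec ?p t S k)\<^sup>2 + t\<^sup>2 * (bvec ?p t (S + 1) k)\<^sup>2)) summable_on UNIV"
      unfolding power2_eq_square[of "bvec ?p t _ _"]
      by (intro summable_on_cmult_right summable_on_add bvec_prod_summable p)
    show "\<bar>(cmod (H (k + S)))\<^sup>2\<bar> \<le> 2 * (K / \<delta>)\<^sup>2 * ((bvec ?p t S k)\<^sup>2 + t\<^sup>2 * (bvec ?p t (S + 1) k)\<^sup>2)" for k
      using H_sq[of k] by simp
  qed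
  \<comment> \<open>Christoffel--Darboux divided by b - m: the Cauchy-type quotient is an entry of
    M.\<close>
  have ker: "(v m * u b - u m * v b) / (half_pt b - half_pt m) = complex_of_real (kern ?p t S (m - S) (b - S))" if "m \<noteq> b" for m b
  proof -
    have eq: "of_int (b - m) * kern ?p t S (m - S) (b - S)
        = t * bvec ?p t (S + 1) (m - S) * bvec ?p t S (b - S) - bvec ?p t S (m - S) * (t * bvec ?p t (S + 1) (b - S))"
      using kern_offdiag[of "b - S" "m - S" ?p t S] by (simp add: algebra_simps)
    have "half_pt b - half_pt m = complex_of_real (of_int (b - m))" by (simp add: half_pt_def)
    moreover have "v m * u b - u m * v b = complex_of_real (of_int (b - m) * kern ?p t S (m - S) (b - S))"
      unfolding eq u_def v_def by simp
    ultimately show ?thesis using that by simp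
  qed
  have conv: "(\<lambda>n. \<Sum>m = - int n..<int n. H m * complex_of_real (kern ?p t S (m - S) (b - S))) \<longlonglongrightarrow> H b - u b" for b
  proof -
    let ?k = "\<lambda>m. complex_of_real (kern ?p t S (m - S) (b - S))"
    have "(\<lambda>n. \<Sum>m\<in>{- int n..<int n} - {b}. H m * (v m * u b - u m * v b) / (half_pt b - half_pt m)) \<longlonglongrightarrow> ?F b - u b"
      using row_coefficients(4)[OF row rex, of b] unfolding H_def .
    moreover have "(\<Sum>m\<in>{- int n..<int n} - {b}. H m * (v m * u b - u m * v b) / (half_pt b - half_pt m))
        = (\<Sum>m\<in>{- int n..<int n} - {b}. H m * ?k m)" for n
      by (intro sum.cong refl) (simp add: ker[symmetric])
    ultimately have "(\<lambda>n. (\<Sum>m\<in>{- int n..<int n} - {b}. H m * ?k m) + H b * ?k b) \<longlonglongrightarrow> (?F b - u b) + H b * ?k b"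
      by (intro tendsto_add tendsto_const) simp
    \<comment> \<open>Adding the diagonal term to the off-diagonal sum completes the row of M and
      turns the value into the residue: M H = H - u.\<close>
    moreover have "(?F b - u b) + H b * ?k b = H b - u b" unfolding F_H by (simp add: algebra_simps)
    moreover have "\<forall>\<^sub>F n in sequentially. (\<Sum>m\<in>{- int n..<int n} - {b}. H m * ?k m) + H b * ?k b = (\<Sum>m = - int n..<int n. H m * ?k m)"
      using eventually_ge_at_top[of "nat \<bar>b\<bar> + 1"]
    proof eventually_elim
      case (elim n)
      then have "b \<in> {- int n..<int n}" by auto
      then show ?case by (simp add: sum.remove[of "{- int n..<int n}" b])
    qed
    ultimately show ?thesis by (simp add: Lim_transform_eventually)
  qed
  define Gr where "Gr k = Re (H (k + S))" for k
  define Gi where "Gi k = Im (H (k + S))" for k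
  have Gr_s: "(\<lambda>k. (Gr k)\<^sup>2) summable_on UNIV" and Gi_s: "(\<lambda>k. (Gi k)\<^sup>2) summable_on UNIV"
    by (rule summable_on_dominated[OF H_summable], simp add: Gr_def Gi_def cmod_power2)+
  have r: "resolvent_eq ?p t S 1 Gr (\<lambda>c. \<Sum>\<^sub>\<infinity>k. bvec ?p t c k * Gr k)"
  proof (rule resolvent_eqI[OF p Gr_s])
    fix l
    show "(\<lambda>n. \<Sum>m = - int n..<int n. Gr (m - S) * kern ?p t S (m - S) l) \<longlonglongrightarrow> Gr l - 1 * bvec ?p t S l"
      using tendsto_Re[OF conv[of "l + S"]] by (simp add: Gr_def u_def)
  qed
  have i: "resolvent_eq ?p t S 0 Gi (\<lambda>c. \<Sum>\<^sub>\<infinity>k. bvec ?p t c k * Gi k)"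
  proof (rule resolvent_eqI[OF p Gi_s])
    fix l
    show "(\<lambda>n. \<Sum>m = - int n..<int n. Gi (m - S) * kern ?p t S (m - S) l) \<longlonglongrightarrow> Gi l - 0 * bvec ?p t S l"
      using tendsto_Im[OF conv[of "l + S"]] by (simp add: Gi_def u_def)
  qed
  have limr: "(\<lambda>n. \<Sum>m = - int n..<int n. bvec ?p t c (m - S) * Gr (m - S)) \<longlonglongrightarrow> (\<Sum>\<^sub>\<infinity>k. bvec ?p t c k * Gr k)"
    and limi: "(\<lambda>n. \<Sum>m = - int n..<int n. bvec ?p t c (m - S) * Gi (m - S)) \<longlonglongrightarrow> (\<Sum>\<^sub>\<infinity>k. bvec ?p t c k * Gi k)" for c
    by (rule tendsto_sum_shift[OF bvec_pairing_summable[OF p Gr_s]], rule tendsto_sum_shift[OF bvec_pairing_summable[OF p Gi_s]])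
  have H_C: "H m = Complex (Gr (m - S)) (Gi (m - S))" for m by (simp add: Gr_def Gi_def)
  have \<alpha>: "(\<lambda>n. \<Sum>m = - int n..<int n. H m * v m) \<longlonglongrightarrow> \<alpha>" and \<beta>: "(\<lambda>n. \<Sum>m = - int n..<int n. - H m * u m) \<longlonglongrightarrow> \<beta>"
    using row_coefficients(1,2)[OF row rex] unfolding H_def by simp_all
  have "Re \<alpha> = t * (\<Sum>\<^sub>\<infinity>k. bvec ?p t (S + 1) k * Gr k)"
  proof (rule LIMSEQ_unique[OF tendsto_Re[OF \<alpha>]])
    show "(\<lambda>n. Re (\<Sum>m = - int n..<int n. H m * v m)) \<longlonglongrightarrow> t * (\<Sum>\<^sub>\<infinity>k. bvec ?p t (S + 1) k * Gr k)"
      using tendsto_mult_left[OF limr[of "S + 1"], of t] by (simp add: H_C v_def sum_distrib_left mult_ac)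
  qed
  moreover have "Im \<alpha> = t * (\<Sum>\<^sub>\<infinity>k. bvec ?p t (S + 1) k * Gi k)"
  proof (rule LIMSEQ_unique[OF tendsto_Im[OF \<alpha>]])
    show "(\<lambda>n. Im (\<Sum>m = - int n..<int n. H m * v m)) \<longlonglongrightarrow> t * (\<Sum>\<^sub>\<infinity>k. bvec ?p t (S + 1) k * Gi k)"
      using tendsto_mult_left[OF limi[of "S + 1"], of t] by (simp add: H_C v_def sum_distrib_left mult_ac)
  qed
  moreover have "Re \<beta> = - (\<Sum>\<^sub>\<infinity>k. bvec ?p t S k * Gr k)"
  proof (rule LIMSEQ_unique[OF tendsto_Re[OF \<beta>]])
    show "(\<lambda>n. Re (\<Sum>m = - int n..<int n. - H m * u m)) \<longlonglongrightarrow> - (\<Sum>\<^sub>\<infinity>k. bvec ?p t S k * Gr k)"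
      using tendsto_minus[OF limr[of S]] by (simp add: H_C u_def sum_negf mult_ac)
  qed
  moreover have "Im \<beta> = - (\<Sum>\<^sub>\<infinity>k. bvec ?p t S k * Gi k)"
  proof (rule LIMSEQ_unique[OF tendsto_Im[OF \<beta>]])
    show "(\<lambda>n. Im (\<Sum>m = - int n..<int n. - H m * u m)) \<longlonglongrightarrow> - (\<Sum>\<^sub>\<infinity>k. bvec ?p t S k * Gi k)"
      using tendsto_minus[OF limi[of S]] by (simp add: H_C u_def sum_negf mult_ac)
  qed
  ultimately have "\<alpha> = Complex (t * (\<Sum>\<^sub>\<infinity>k. bvec ?p t (S + 1) k * Gr k)) (t * (\<Sum>\<^sub>\<infinity>k. bvec ?p t (S + 1) k * Gi k))"
    "\<beta> = Complex (- (\<Sum>\<^sub>\<infinity>k. bvec ?p t S k * Gr k)) (- (\<Sum>\<^sub>\<infinity>k. bvec ?p t S k * Gi k))"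
    by (simp_all add: complex_eq_iff)
  with r i show ?thesis by (rule that)
qed

theorem theorem3p5:
  fixes \<sigma> :: "real \<Rightarrow> real" and L s :: real
    and Y :: "complex \<Rightarrow> complex^2^2" and \<alpha> \<beta> \<gamma> :: complex
  assumes "L > 0"
    and "\<forall>l\<in>Zp. 0 \<le> \<sigma> l \<and> \<sigma> l \<le> 1"
    and "\<sigma> summable_on {l\<in>Zp. l < 0}"
    and "s \<in> Zp"
    and "Q \<sigma> L s > 0"
    and "dRHP \<sigma> L s Y"
    and "has_expansion Y \<alpha> \<beta> \<gamma>"
  shows "complex_of_real (Q \<sigma> L (s - 1) / Q \<sigma> L s - 1) = \<beta> \<and>
         (\<exists>D. ((\<lambda>L'. ln (Q \<sigma> L' s)) has_real_derivative D) (at L) \<and>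
              complex_of_real D = - 2 * \<alpha> / complex_of_real L)"
proof -
  obtain k :: int where "s = of_int k + 1/2" using assms(4) by (auto simp: Zp_def)
  \<comment> \<open>\<open>S\<close> exceeds \<open>k\<close> by one, because the index c of the
    Bessel vectors codes c - 1/2 while weights are coded by k + 1/2.\<close>
  then obtain S :: int where s: "s = of_int S - 1/2" using that[of "k + 1"] by simp
  have s': "s - 1 = of_int (S - 1) - 1/2" using s by simp
  note p = weight_half_weight[OF assms(2)]
  have q: "(\<lambda>n. trunc_det (half_weight \<sigma>) n S t) \<longlonglongrightarrow> Q \<sigma> t s" for t
    by (rule trunc_det_tendsto_Q[OF assms(2,3) s])
  obtain Gr Gi gr gi where r: "resolvent_eq (half_weight \<sigma>) L S 1 Gr gr" and i: "resolvent_eq (half_weight \<sigma>) L S 0 Gi gi"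
    and \<alpha>: "\<alpha> = Complex (L * gr (S + 1)) (L * gi (S + 1))" and \<beta>: "\<beta> = Complex (- gr S) (- gi S)"
    by (rule dRHP_resolvent[OF assms(1-3) s assms(6,7)]) (rule that; assumption)
  \<comment> \<open>The imaginary part solves the homogeneous equation and Q is positive, so
    \<alpha> and \<beta> are real.\<close>
  have gi: "gi c = 0" for c
    using homogeneous_pairing_zero[OF p i q] assms(5) by simp
  have "Q \<sigma> L (s - 1) = Q \<sigma> L s * (1 - gr S)"
    by (rule LIMSEQ_unique[OF trunc_det_tendsto_Q[OF assms(2,3) s'] trunc_det_pred_tendsto[OF p r q]])
  then have "complex_of_real (Q \<sigma> L (s - 1) / Q \<sigma> L s - 1) = \<beta>"
    using assms(5) by (simp add: \<beta> gi complex_eq_iff)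
  moreover have "((\<lambda>L'. ln (Q \<sigma> L' s)) has_real_derivative - 2 * gr (S + 1)) (at L)"
    using DERIV_chain2[OF DERIV_ln_divide[OF assms(5)] limit_has_derivative[OF p r q]] assms(5) by simp
  moreover have "complex_of_real (- 2 * gr (S + 1)) = - 2 * \<alpha> / complex_of_real L"
    using assms(1) by (simp add: \<alpha> gi complex_eq_iff Re_divide_of_real Im_divide_of_real)
  ultimately show ?thesis by blast
qed

end
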